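(* Let $G$ be a simple graph. A partition of the edge set of $G$ into $k$ pseudoforests can be converted into a partition into $\lceil 4k/3\rceil$ forests in linear time.
   Context: A pseudoforest is a graph in which each connected component contains at most one cycle. *)

theory Defs
  imports Complex_Main "HOL-Library.Disjoint_Sets"
begin

section \<open>Simple graphs, forests and pseudoforests\<close>

definition simple_graph :: "'a set \<Rightarrow> 'a set set \<Rightarrow> bool" where
  "simple_graph V E \<longleftrightarrow> finite V \<and> (\<forall>e\<in>E. e \<subseteq> V \<and> card e = 2)"

definition connected_component :: "'a set set \<Rightarrow> 'a \<Rightarrow> 'a set" where
  "connected_component E v = {w. (v, w) \<in> {(x, y). {x, y} \<in> E}\<^sup>*}"

definition components :: "'a set \<Rightarrow> 'a set set \<Rightarrow> 'a set set" where
  "components V E = connected_component E ` V"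

text \<open>
  A cycle is identified with its set of edges, so that neither the starting point nor the
  direction of traversal matters when cycles are counted.
\<close>

definition cycle_edges :: "'a list \<Rightarrow> 'a set set" where
  "cycle_edges xs = {{xs ! i, xs ! (Suc i mod length xs)} | i. i < length xs}"

definition is_cycle :: "'a set set \<Rightarrow> 'a set set \<Rightarrow> bool" where
  "is_cycle E C \<longleftrightarrow>
     (\<exists>xs. distinct xs \<and> 3 \<le> length xs \<and> C = cycle_edges xs \<and> C \<subseteq> E)"

definition forest :: "'a set set \<Rightarrow> bool" where
  "forest E \<longleftrightarrow> (\<nexists>C. is_cycle E C)"

definition pseudoforest :: "'a set \<Rightarrow> 'a set set \<Rightarrow> bool" where
  "pseudoforest V E \<longleftrightarrow>
     (\<forall>X \<in> components V E. \<exists>\<^sub>\<le>\<^sub>1 C. is_cycle E C \<and> \<Union> C \<subseteq> X)"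

text \<open>Parts are allowed to be empty; the values \<^term>\<open>P i\<close> for \<open>i \<ge> k\<close> are irrelevant.\<close>

definition edge_partition ::
    "('a set set \<Rightarrow> bool) \<Rightarrow> nat \<Rightarrow> 'a set set \<Rightarrow> (nat \<Rightarrow> 'a set set) \<Rightarrow> bool" where
  "edge_partition Q k E P \<longleftrightarrow>
     (\<Union>i<k. P i) = E \<and> disjoint_family_on P {..<k} \<and> (\<forall>i<k. Q (P i))"


section \<open>Word RAM\<close>

text \<open>
  Programs are while-programs over finitely many registers and arrays of natural numbers.
  Every arithmetic operation, comparison, connective, memory access and assignment takes
  one unit of time. Every number occurring during a computation has to fit into a machine
  word, i.e. be at most the parameter \<open>W\<close> below: a program that produces a larger number is stuck.
\<close>

datatype expr =
    Const nat
  | Reg nat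
  | Arr nat expr
  | Add expr expr
  | Sub expr expr

datatype cond =
    Less expr expr
  | Equal expr expr
  | Neg cond
  | Conj cond cond

datatype com =
    Skip
  | Set_Reg nat expr
  | Set_Arr nat expr expr
  | Seq com com
  | If cond com com
  | While cond com

datatype state = State (reg: "nat \<Rightarrow> nat") (arr: "nat \<Rightarrow> nat \<Rightarrow> nat")

text \<open>Subtraction is truncated at 0.\<close>

fun expr_val :: "state \<Rightarrow> expr \<Rightarrow> nat" where
  "expr_val s (Const i) = i"
| "expr_val s (Reg x) = reg s x"
| "expr_val s (Arr a e) = arr s a (expr_val s e)"
| "expr_val s (Add e1 e2) = expr_val s e1 + expr_val s e2"
| "expr_val s (Sub e1 e2) = expr_val s e1 - expr_val s e2"

fun expr_fits :: "nat \<Rightarrow> state \<Rightarrow> expr \<Rightarrow> bool" where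
  "expr_fits W s (Const i) \<longleftrightarrow> i \<le> W"
| "expr_fits W s (Reg x) \<longleftrightarrow> reg s x \<le> W"
| "expr_fits W s (Arr a e) \<longleftrightarrow> expr_fits W s e \<and> expr_val s (Arr a e) \<le> W"
| "expr_fits W s (Add e1 e2) \<longleftrightarrow>
     expr_fits W s e1 \<and> expr_fits W s e2 \<and> expr_val s (Add e1 e2) \<le> W"
| "expr_fits W s (Sub e1 e2) \<longleftrightarrow> expr_fits W s e1 \<and> expr_fits W s e2"

fun expr_time :: "expr \<Rightarrow> nat" where
  "expr_time (Const i) = 1"
| "expr_time (Reg x) = 1"
| "expr_time (Arr a e) = expr_time e + 1"
| "expr_time (Add e1 e2) = expr_time e1 + expr_time e2 + 1"
| "expr_time (Sub e1 e2) = expr_time e1 + expr_time e2 + 1"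

fun cond_val :: "state \<Rightarrow> cond \<Rightarrow> bool" where
  "cond_val s (Less e1 e2) \<longleftrightarrow> expr_val s e1 < expr_val s e2"
| "cond_val s (Equal e1 e2) \<longleftrightarrow> expr_val s e1 = expr_val s e2"
| "cond_val s (Neg b) \<longleftrightarrow> \<not> cond_val s b"
| "cond_val s (Conj b1 b2) \<longleftrightarrow> cond_val s b1 \<and> cond_val s b2"

fun cond_fits :: "nat \<Rightarrow> state \<Rightarrow> cond \<Rightarrow> bool" where
  "cond_fits W s (Less e1 e2) \<longleftrightarrow> expr_fits W s e1 \<and> expr_fits W s e2"
| "cond_fits W s (Equal e1 e2) \<longleftrightarrow> expr_fits W s e1 \<and> expr_fits W s e2"
| "cond_fits W s (Neg b) \<longleftrightarrow> cond_fits W s b"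
| "cond_fits W s (Conj b1 b2) \<longleftrightarrow> cond_fits W s b1 \<and> cond_fits W s b2"

fun cond_time :: "cond \<Rightarrow> nat" where
  "cond_time (Less e1 e2) = expr_time e1 + expr_time e2 + 1"
| "cond_time (Equal e1 e2) = expr_time e1 + expr_time e2 + 1"
| "cond_time (Neg b) = cond_time b + 1"
| "cond_time (Conj b1 b2) = cond_time b1 + cond_time b2 + 1"

text \<open>
  \<open>run W p s t s'\<close>: with largest word \<open>W\<close>, the program \<open>p\<close> started in state \<open>s\<close> halts after
  exactly \<open>t\<close> units of time in state \<open>s'\<close>.
\<close>

inductive run :: "nat \<Rightarrow> com \<Rightarrow> state \<Rightarrow> nat \<Rightarrow> state \<Rightarrow> bool" for W :: nat where
  Skip: "run W Skip s 1 s"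
| Set_Reg: "expr_fits W s e \<Longrightarrow>
    run W (Set_Reg x e) s (expr_time e + 1) (State ((reg s)(x := expr_val s e)) (arr s))"
| Set_Arr: "expr_fits W s i \<Longrightarrow> expr_fits W s e \<Longrightarrow>
    run W (Set_Arr a i e) s (expr_time i + expr_time e + 1)
      (State (reg s) ((arr s)(a := (arr s a)(expr_val s i := expr_val s e))))"
| Seq: "run W p s t1 s' \<Longrightarrow> run W q s' t2 s'' \<Longrightarrow> run W (Seq p q) s (t1 + t2) s''"
| If_True: "cond_fits W s b \<Longrightarrow> cond_val s b \<Longrightarrow> run W p s t s' \<Longrightarrow>
    run W (If b p q) s (cond_time b + t + 1) s'"
| If_False: "cond_fits W s b \<Longrightarrow> \<not> cond_val s b \<Longrightarrow> run W q s t s' \<Longrightarrow>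
    run W (If b p q) s (cond_time b + t + 1) s'"
| While_True: "cond_fits W s b \<Longrightarrow> cond_val s b \<Longrightarrow> run W p s t1 s' \<Longrightarrow>
    run W (While b p) s' t2 s'' \<Longrightarrow> run W (While b p) s (cond_time b + t1 + t2 + 1) s''"
| While_False: "cond_fits W s b \<Longrightarrow> \<not> cond_val s b \<Longrightarrow>
    run W (While b p) s (cond_time b + 1) s"

text \<open>
  Programs are deterministic, so the existence of a halting run is a statement about the only
  possible behaviour of the program.
\<close>

lemma run_deterministic:
  "run W p s t s' \<Longrightarrow> run W p s u s'' \<Longrightarrow> u = t \<and> s'' = s'"
proof (induction arbitrary: u s'' rule: run.induct)
  case Skip
  then show ?case by (auto elim: run.cases)
next
  case Set_Reg
  from Set_Reg.prems show ?case by (cases rule: run.cases) auto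
next
  case Set_Arr
  from Set_Arr.prems show ?case by (cases rule: run.cases) auto
next
  case Seq
  from Seq.prems show ?case by (cases rule: run.cases) (use Seq.IH in blast)+
next
  case If_True
  from If_True.prems show ?case by (cases rule: run.cases) (use If_True in blast)+
next
  case If_False
  from If_False.prems show ?case by (cases rule: run.cases) (use If_False in blast)+
next
  case While_True
  from While_True.prems show ?case by (cases rule: run.cases) (use While_True in blast)+
next
  case While_False
  from While_False.prems show ?case by (cases rule: run.cases) (use While_False in auto)
qed


section \<open>Encoding of graphs and edge partitions\<close>

text \<open>
  The vertices of an input graph are \<open>0, \<dots>, n - 1\<close>. The edges are listed in an arbitrary order
  and with arbitrary orientations, each edge exactly once. A partition of the edges is stored
  by the index of the part of every listed edge.
\<close>

definition undirected :: "'a \<times> 'a \<Rightarrow> 'a set" where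
  "undirected e = {fst e, snd e}"

definition edge_list :: "'a set set \<Rightarrow> ('a \<times> 'a) list \<Rightarrow> bool" where
  "edge_list E es \<longleftrightarrow> set (map undirected es) = E \<and> distinct (map undirected es)"

definition part_indices ::
    "('a \<times> 'a) list \<Rightarrow> nat \<Rightarrow> (nat \<Rightarrow> 'a set set) \<Rightarrow> (nat \<Rightarrow> nat) \<Rightarrow> bool" where
  "part_indices es k P f \<longleftrightarrow>
     (\<forall>j < length es. f j < k \<and> undirected (es ! j) \<in> P (f j))"

text \<open>
  Registers 0, 1, 2 hold the numbers of vertices, edges and parts; arrays 0, 1, 2 hold the two
  endpoints and the part of each edge. All other memory is 0. The output is read from array 3.
\<close>

definition input_state :: "nat \<Rightarrow> (nat \<times> nat) list \<Rightarrow> nat \<Rightarrow> (nat \<Rightarrow> nat) \<Rightarrow> state" where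
  "input_state n es k f = State
     ((\<lambda>_. 0)(0 := n, 1 := length es, 2 := k))
     ((\<lambda>_ _. 0)(0 := (\<lambda>j. if j < length es then fst (es ! j) else 0),
                1 := (\<lambda>j. if j < length es then snd (es ! j) else 0),
                2 := (\<lambda>j. if j < length es then f j else 0)))"

definition output_array :: "state \<Rightarrow> nat \<Rightarrow> nat" where
  "output_array s = arr s 3"

end

theory Submission
  imports Defs
begin

text \<open>
  Group the pseudoforests into triples, with colours 0, 1, 2, and add one extra forest per triple. It
  suffices to remove an edge from every cycle such that the removed edges of a triple are acyclic.
  Two cycles of the same pseudoforest are disjoint, so each colour contributes a matching. If the
  removed edges of colours 0 and 1 form a matching, then colour 2 is easy: all components of the extra
  forest remain paths, and a vertex on an unbroken cycle of colour 2 is an end of its path, so among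
  three consecutive vertices of that cycle some edge joins different paths.

  Breaking all cycles of colours 0 and 1 by a matching is impossible in general. But an edge of a
  cycle \<open>D\<close> of one of these colours may instead be moved to the other one if it joins vertices on
  different cycles there, as these lie in different components, provided that one of the two
  components has not received an edge before. Cycles are broken along a chain: whenever the removed
  edge covers a vertex of an unbroken cycle of the other colour, that cycle is next, so it has only one
  covered vertex. If some other vertex \<open>w\<close> on it is not on an unbroken cycle of the other colour, an
  edge at \<open>w\<close> avoiding the covered vertex is removed. Otherwise an edge is moved, which joins two
  components, one of them fresh, and the cycle of the fresh component is next. Only the start of a
  chain may touch two fresh components at once; the second one is kept pending.

  Cycles are found by repeatedly deleting vertices of degree 1: in what remains, all degrees are 2.
\<close>

section \<open>Connectivity, cycles and forests\<close>

text \<open>The time bound involves neither \<open>k\<close> nor the \<open>k * n\<close> vertices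
  of all pseudoforests together, and the machine cannot multiply. So parts are renumbered as they
  occur, and vertex \<open>v\<close> of part \<open>p\<close> becomes the number
  \<open>1 + p * n + v\<close>, computed by running counters. All pseudoforests thus form one graph
  with at most one cycle per component, on which peeling and traversal run only once. Memory starts
  at 0, so arrays over this large range need no initialisation.

  An incomplete last group is harmless: with \<open>r\<close> pseudoforests it yields at most
  \<open>r + 1\<close> forests, and \<open>4 * r / 3\<close> rounds up to \<open>r + 1\<close> for
  \<open>r = 1\<close> and \<open>r = 2\<close>.

  Which edges of the cycles are finally deleted is unknown while edges are being moved. Moves are
  therefore justified by \<open>safe\<close>, which speaks about all forests inside the original
  edges and survives a move as soon as one end of the moved edge is fresh.

  Deciding how to break a cycle scans that cycle at most a constant number of times, so the number
  of vertices on unbroken cycles pays for the whole search.\<close>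

definition conn :: "'a set set \<Rightarrow> ('a \<times> 'a) set" where
  "conn E = {(x, y). {x, y} \<in> E}\<^sup>*"

lemma conn_refl [simp]: "(x, x) \<in> conn E"
  by (simp add: conn_def)

lemma conn_edge: "{x, y} \<in> E \<Longrightarrow> (x, y) \<in> conn E"
  by (auto simp: conn_def)

lemma conn_trans: "(x, y) \<in> conn E \<Longrightarrow> (y, z) \<in> conn E \<Longrightarrow> (x, z) \<in> conn E"
  unfolding conn_def by (rule rtrancl_trans)

lemma conn_sym: "(x, y) \<in> conn E \<Longrightarrow> (y, x) \<in> conn E"
proof -
  have "sym {(x, y). {x, y} \<in> E}"
    by (auto simp: sym_def insert_commute)
  then show "(x, y) \<in> conn E \<Longrightarrow> (y, x) \<in> conn E"
    unfolding conn_def by (meson sym_rtrancl symD)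
qed

lemma conn_mono: "E \<subseteq> E' \<Longrightarrow> (x, y) \<in> conn E \<Longrightarrow> (x, y) \<in> conn E'"
  unfolding conn_def by (rule subsetD [OF rtrancl_mono]) auto

lemma conn_closed:
  assumes "(x, y) \<in> conn E" "x \<in> S" "\<And>u v. {u, v} \<in> E \<Longrightarrow> u \<in> S \<Longrightarrow> v \<in> S"
  shows "y \<in> S"
  using assms(1) unfolding conn_def
  by (induction rule: rtrancl_induct) (use assms(2,3) in auto)

text \<open>Crossing the new edge back undoes an earlier crossing, so a walk can be shortened until
  it uses that edge at most once.\<close>

lemma conn_insert:
  assumes "(x, y) \<in> conn (insert {a, b} E)"
  shows "(x, y) \<in> conn E \<or> (x, a) \<in> conn E \<and> (b, y) \<in> conn E
    \<or> (x, b) \<in> conn E \<and> (a, y) \<in> conn E"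
  using assms unfolding conn_def[of "insert {a, b} E"]
proof (induction rule: rtrancl_induct)
  case base
  then show ?case by simp
next
  case (step y z)
  from step(2) consider "{y, z} \<in> E" | "y = a" "z = b" | "y = b" "z = a"
    by (auto simp: doubleton_eq_iff)
  then show ?case
  proof cases
    case 1
    then show ?thesis using step(3) by (meson conn_edge conn_trans)
  next
    case 2
    then show ?thesis using step(3) by (meson conn_refl conn_sym conn_trans)
  next
    case 3
    then show ?thesis using step(3) by (meson conn_refl conn_sym conn_trans)
  qed
qed

lemma conn_nth:
  assumes "\<And>i. Suc i < length xs \<Longrightarrow> {xs ! i, xs ! Suc i} \<in> E" "i < length xs"
  shows "(xs ! 0, xs ! i) \<in> conn E"
  using assms(2)
proof (induction i)
  case (Suc i)
  then show ?case using assms(1)[of i] by (meson Suc_lessD conn_edge conn_trans)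
qed simp

lemma cycle_edges_rotate: "cycle_edges (rotate r xs) = cycle_edges xs"
proof (induction r)
  case (Suc r)
  let ?ys = "rotate r xs"
  have "cycle_edges (rotate1 ?ys) = cycle_edges ?ys"
  proof (cases "?ys = []")
    case False
    let ?n = "length ?ys"
    have n: "0 < ?n" using False by simp
    have eq: "rotate1 ?ys ! i = ?ys ! (Suc i mod ?n)" if "i < ?n" for i
      using that nth_rotate1 by metis
    have "cycle_edges (rotate1 ?ys)
        = (\<lambda>i. {?ys ! (Suc i mod ?n), ?ys ! (Suc (Suc i mod ?n) mod ?n)}) ` {..<?n}"
      using n eq unfolding cycle_edges_def by (force simp: image_def)
    also have "\<dots> = (\<lambda>i. {?ys ! i, ?ys ! (Suc i mod ?n)}) ` (\<lambda>i. Suc i mod ?n) ` {..<?n}"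
      by (simp add: image_image)
    also have "(\<lambda>i. Suc i mod ?n) ` {..<?n} = {..<?n}"
    proof -
      have "j \<in> (\<lambda>i. Suc i mod ?n) ` {..<?n}" if "j < ?n" for j
      proof (cases j)
        case 0
        then show ?thesis using n by (intro image_eqI[of _ _ "?n - 1"]) auto
      next
        case (Suc i)
        then show ?thesis using that by (intro image_eqI[of _ _ i]) auto
      qed
      then show ?thesis using n by auto
    qed
    also have "(\<lambda>i. {?ys ! i, ?ys ! (Suc i mod ?n)}) ` {..<?n} = cycle_edges ?ys"
      by (auto simp: cycle_edges_def)
    finally show ?thesis .
  qed simp
  then show ?case using Suc.IH by simp
qed simp

lemma Union_cycle_edges: "\<Union> (cycle_edges xs) = set xs"
proof
  show "\<Union> (cycle_edges xs) \<subseteq> set xs"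
  proof (cases xs)
    case (Cons a as)
    then have "0 < length xs" by simp
    then show ?thesis by (force simp: cycle_edges_def)
  qed (auto simp: cycle_edges_def)
  show "set xs \<subseteq> \<Union> (cycle_edges xs)"
  proof
    fix x assume "x \<in> set xs"
    then obtain i where "i < length xs" "x = xs ! i"
      by (auto simp: in_set_conv_nth)
    then show "x \<in> \<Union> (cycle_edges xs)"
      unfolding cycle_edges_def by blast
  qed
qed

lemma cycle_edges_eq_image:
  "cycle_edges xs = (\<lambda>i. {xs ! i, xs ! (Suc i mod length xs)}) ` {..<length xs}"
  by (auto simp: cycle_edges_def)

lemma cycle_edges_map: "cycle_edges (map h xs) = (`) h ` cycle_edges xs"
  unfolding cycle_edges_eq_image image_image
proof (rule image_cong)
  fix i assume "i \<in> {..<length xs}"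
  then have "i < length xs"
    by simp
  moreover from this have "Suc i mod length xs < length xs"
    by (intro mod_less_divisor) linarith
  ultimately show "{map h xs ! i, map h xs ! (Suc i mod length (map h xs))}
      = h ` {xs ! i, xs ! (Suc i mod length xs)}"
    by simp
qed simp

lemma nth_cycle_edges: "i < length xs \<Longrightarrow> {xs ! i, xs ! (Suc i mod length xs)} \<in> cycle_edges xs"
  by (auto simp: cycle_edges_def)

lemma nth_Suc_cycle_edges: "Suc i < length xs \<Longrightarrow> {xs ! i, xs ! Suc i} \<in> cycle_edges xs"
  using nth_cycle_edges[of i xs] by simp

lemma cycle_edges_conn:
  assumes "x \<in> set xs" "y \<in> set xs"
  shows "(x, y) \<in> conn (cycle_edges xs)"
proof -
  have "(xs ! 0, z) \<in> conn (cycle_edges xs)" if "z \<in> set xs" for z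
    using that conn_nth[of xs "cycle_edges xs"] nth_Suc_cycle_edges[of _ xs]
    by (auto simp: in_set_conv_nth)
  then show ?thesis using assms by (meson conn_sym conn_trans)
qed

text \<open>Rotating the cycle makes the given edge the closing one.\<close>

lemma cycle_edges_conn_remove:
  assumes xs: "distinct xs" "3 \<le> length xs" and e: "{a, b} \<in> cycle_edges xs"
  shows "(a, b) \<in> conn (cycle_edges xs - {{a, b}})"
proof -
  let ?n = "length xs"
  obtain i where i: "i < ?n" "{a, b} = {xs ! i, xs ! (Suc i mod ?n)}"
    using e by (auto simp: cycle_edges_def)
  define ys where "ys = rotate (Suc i) xs"
  have ys: "distinct ys" "length ys = ?n" "cycle_edges ys = cycle_edges xs"
    using xs by (auto simp: ys_def cycle_edges_rotate simp del: rotate_Suc)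
  have 0: "ys ! 0 = xs ! (Suc i mod ?n)"
    using xs i nth_rotate[of 0 xs "Suc i"] by (cases "xs = []") (simp_all add: ys_def del: rotate_Suc)
  have "ys ! (?n - 1) = xs ! ((Suc i + (?n - 1)) mod ?n)"
    using xs i nth_rotate[of "?n - 1" xs "Suc i"] by (simp add: ys_def del: rotate_Suc)
  also have "Suc i + (?n - 1) = i + ?n"
    using xs by simp
  also have "(i + ?n) mod ?n = i"
    using i by simp
  finally have last: "ys ! (?n - 1) = xs ! i" .
  have ab: "{a, b} = {ys ! 0, ys ! (?n - 1)}"
    using i 0 last by auto
  have "(ys ! 0, ys ! (?n - 1)) \<in> conn (cycle_edges ys - {{a, b}})"
  proof (rule conn_nth)
    fix j assume j: "Suc j < length ys"
    have "{ys ! j, ys ! Suc j} \<noteq> {ys ! 0, ys ! (?n - 1)}"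
    proof -
      have n: "0 < length ys" "?n - 1 < length ys" "j < length ys"
        using xs ys(2) j by linarith+
      have "ys ! Suc j \<noteq> ys ! 0" "ys ! j \<noteq> ys ! (?n - 1)" "ys ! j = ys ! 0 \<longleftrightarrow> j = 0"
        "ys ! Suc j = ys ! (?n - 1) \<longleftrightarrow> Suc j = ?n - 1"
        using ys(1,2) n j by (simp_all add: nth_eq_iff_index_eq[OF ys(1)])
      moreover from this have "\<not> (ys ! j = ys ! 0 \<and> ys ! Suc j = ys ! (?n - 1))"
        using xs(2) by linarith
      ultimately show ?thesis
        unfolding doubleton_eq_iff by blast
    qed
    then show "{ys ! j, ys ! Suc j} \<in> cycle_edges ys - {{a, b}}"
      using j ab nth_Suc_cycle_edges by auto
  qed (use xs ys in auto)
  then have "(ys ! 0, ys ! (?n - 1)) \<in> conn (cycle_edges xs - {{a, b}})"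
    by (simp add: ys(3))
  moreover have "a = ys ! 0 \<and> b = ys ! (?n - 1) \<or> b = ys ! 0 \<and> a = ys ! (?n - 1)"
    using ab by (auto simp: doubleton_eq_iff)
  ultimately show ?thesis using conn_sym by fastforce
qed

text \<open>Length at least 3 keeps the successor and the predecessor apart. Peeling relies on this:
  a vertex with a single remaining edge lies on no cycle.\<close>

lemma cycle_edges_two_edges:
  assumes xs: "distinct xs" "3 \<le> length xs" and x: "x \<in> set xs"
  shows "\<exists>y z. y \<noteq> z \<and> {x, y} \<in> cycle_edges xs \<and> {x, z} \<in> cycle_edges xs"
proof -
  let ?n = "length xs"
  obtain i where i: "i < ?n" "x = xs ! i"
    using x by (auto simp: in_set_conv_nth)
  define j where "j = (if i = 0 then ?n - 1 else i - 1)"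
  have j: "j < ?n" "Suc j mod ?n = i"
    using i xs by (auto simp: j_def)
  have ne: "Suc i mod ?n \<noteq> j"
    using i xs by (cases "Suc i = ?n") (auto simp: j_def)
  have "{x, xs ! (Suc i mod ?n)} \<in> cycle_edges xs"
    using i nth_cycle_edges by auto
  moreover have "{x, xs ! j} \<in> cycle_edges xs"
    using nth_cycle_edges[OF j(1)] j i by (simp add: insert_commute)
  moreover have "xs ! (Suc i mod ?n) \<noteq> xs ! j"
    using ne j(1) xs nth_eq_iff_index_eq[OF xs(1), of "Suc i mod ?n" j]
      mod_less_divisor[of ?n "Suc i"] by linarith
  ultimately show ?thesis by blast
qed

lemma forest_mono: "forest E \<Longrightarrow> E' \<subseteq> E \<Longrightarrow> forest E'"
  unfolding forest_def is_cycle_def by (meson subset_trans)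

text \<open>A cycle must use the new edge, and its other edges would connect \<open>a\<close> and
  \<open>b\<close> inside \<open>E\<close>.\<close>

lemma forest_insert:
  assumes "forest E" "(a, b) \<notin> conn E"
  shows "forest (insert {a, b} E)"
  unfolding forest_def
proof
  assume "\<exists>C. is_cycle (insert {a, b} E) C"
  then obtain xs where xs: "distinct xs" "3 \<le> length xs" "cycle_edges xs \<subseteq> insert {a, b} E"
    by (auto simp: is_cycle_def)
  have "{a, b} \<in> cycle_edges xs"
    using xs assms(1) by (auto simp: forest_def is_cycle_def)
  then have "(a, b) \<in> conn (cycle_edges xs - {{a, b}})"
    using xs by (intro cycle_edges_conn_remove)
  moreover have "cycle_edges xs - {{a, b}} \<subseteq> E"
    using xs by auto
  ultimately show False using assms(2) conn_mono by metis
qed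

lemma is_cycle_image:
  assumes "is_cycle E C" "inj_on h (\<Union> C)" "\<And>e. e \<in> C \<Longrightarrow> h ` e \<in> E'"
  shows "is_cycle E' ((`) h ` C)"
proof -
  obtain xs where xs: "distinct xs" "3 \<le> length xs" "C = cycle_edges xs" "C \<subseteq> E"
    using assms(1) by (auto simp: is_cycle_def)
  have "distinct (map h xs)"
    using xs assms(2) by (simp add: distinct_map Union_cycle_edges)
  then show ?thesis
    unfolding is_cycle_def using xs assms(3)
    by (intro exI[of _ "map h xs"]) (auto simp: cycle_edges_map)
qed

text \<open>This is how acyclicity of a graph on copies of vertices is transferred to the original
  vertices.\<close>

lemma forest_image:
  assumes "forest E'" "inj_on h (\<Union> E)" "\<And>e. e \<in> E \<Longrightarrow> h ` e \<in> E'"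
  shows "forest E"
proof -
  have "is_cycle E' ((`) h ` C)" if "is_cycle E C" for C
  proof (rule is_cycle_image[OF that])
    have "C \<subseteq> E" using that by (auto simp: is_cycle_def)
    then show "inj_on h (\<Union> C)" "\<And>e. e \<in> C \<Longrightarrow> h ` e \<in> E'"
      using assms by (auto intro: inj_on_subset)
  qed
  then show ?thesis using assms(1) by (auto simp: forest_def)
qed

lemma is_cycle_conn:
  assumes "is_cycle E C" "x \<in> \<Union> C" "y \<in> \<Union> C"
  shows "(x, y) \<in> conn E"
proof -
  obtain xs where xs: "C = cycle_edges xs" "C \<subseteq> E"
    using assms(1) by (auto simp: is_cycle_def)
  then show ?thesis
    using assms cycle_edges_conn[of x xs y] conn_mono[of C E] by (auto simp: Union_cycle_edges)
qed

lemma is_cycle_edge_exists: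
  assumes "is_cycle E C"
  obtains e where "e \<in> C" "e \<in> E"
proof -
  obtain xs where xs: "3 \<le> length xs" "C = cycle_edges xs" "C \<subseteq> E"
    using assms by (auto simp: is_cycle_def)
  then show ?thesis using that nth_cycle_edges[of 0 xs] by force
qed


section \<open>Edge sets with at most one cycle per component\<close>

text \<open>In contrast to \<open>pseudoforest\<close>, no vertex set is mentioned, so the notion
  applies directly to graphs on copies of vertices.\<close>

definition unicyclic :: "'a set set \<Rightarrow> bool" where
  "unicyclic E \<longleftrightarrow> (\<forall>C C' x y. is_cycle E C \<and> is_cycle E C' \<and> x \<in> \<Union> C \<and> y \<in> \<Union> C'
     \<and> (x, y) \<in> conn E \<longrightarrow> C = C')"

lemma unicyclicD:
  "unicyclic E \<Longrightarrow> is_cycle E C \<Longrightarrow> is_cycle E C' \<Longrightarrow> x \<in> \<Union> C \<Longrightarrow> y \<in> \<Union> C' \<Longrightarrow> (x, y) \<in> conn E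
    \<Longrightarrow> C = C'"
  unfolding unicyclic_def by blast

lemma is_cycle_mono: "is_cycle E C \<Longrightarrow> E \<subseteq> E' \<Longrightarrow> is_cycle E' C"
  unfolding is_cycle_def by blast

lemma unicyclic_mono: "unicyclic E \<Longrightarrow> E' \<subseteq> E \<Longrightarrow> unicyclic E'"
  unfolding unicyclic_def by (meson is_cycle_mono conn_mono)

text \<open>A cycle lies inside the component of each of its vertices, so two cycles with connected
  vertices are counted in the same component.\<close>

lemma unicyclic_pseudoforest:
  assumes E: "\<And>e. e \<in> E \<Longrightarrow> e \<subseteq> V" and pf: "pseudoforest V E"
  shows "unicyclic E"
  unfolding unicyclic_def
proof (intro allI impI, elim conjE)
  fix C C' x y
  assume C: "is_cycle E C" "is_cycle E C'" "x \<in> \<Union> C" "y \<in> \<Union> C'" "(x, y) \<in> conn E"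
  have "C \<subseteq> E" using C(1) by (auto simp: is_cycle_def)
  then have "x \<in> V" using C(3) E by blast
  then have comp: "connected_component E x \<in> components V E"
    by (simp add: components_def)
  have eq: "connected_component E x = {w. (x, w) \<in> conn E}"
    by (simp add: connected_component_def conn_def)
  have "\<Union> C \<subseteq> connected_component E x" "\<Union> C' \<subseteq> connected_component E x"
    unfolding eq using is_cycle_conn[OF C(1) C(3)] is_cycle_conn[OF C(2) C(4)]
      conn_trans[OF C(5)] by blast+
  then show "C = C'"
    using pf comp C(1,2) by (auto simp: pseudoforest_def Uniq_def)
qed

definition degree :: "'a set set \<Rightarrow> 'a \<Rightarrow> nat" where
  "degree E v = card {e \<in> E. v \<in> e}"

text \<open>The first vertex of a longest path has a second neighbour, which lies on the path.\<close>

lemma cycle_of_degree_ne_1: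
  assumes fin: "finite E" "E \<noteq> {}" and two: "\<And>e. e \<in> E \<Longrightarrow> card e = 2"
    and deg: "\<And>v. degree E v \<noteq> 1"
  shows "\<exists>C. is_cycle E C"
proof -
  define paths where "paths = {xs. distinct xs \<and> 2 \<le> length xs
    \<and> (\<forall>i. Suc i < length xs \<longrightarrow> {xs ! i, xs ! Suc i} \<in> E)}"
  have finV: "finite (\<Union> E)"
    using fin two by (metis card.infinite finite_Union zero_neq_numeral)
  have len: "length xs < Suc (card (\<Union> E))" if "xs \<in> paths" for xs
  proof -
    have "x \<in> \<Union> E" if "x \<in> set xs" for x
    proof -
      obtain i where i: "i < length xs" "x = xs ! i"
        using \<open>x \<in> set xs\<close> by (metis in_set_conv_nth)
      show ?thesis
      proof (cases "Suc i < length xs")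
        case True
        then show ?thesis using i \<open>xs \<in> paths\<close> by (auto simp: paths_def)
      next
        case False
        then have "Suc (i - 1) = i" "i < length xs"
          using i \<open>xs \<in> paths\<close> by (auto simp: paths_def)
        then have "{xs ! (i - 1), xs ! i} \<in> E"
          using \<open>xs \<in> paths\<close> by (auto simp: paths_def dest: spec[of _ "i - 1"])
        then show ?thesis using i by auto
      qed
    qed
    then have "card (set xs) \<le> card (\<Union> E)"
      using finV by (intro card_mono) auto
    then show ?thesis using that by (simp add: paths_def distinct_card)
  qed
  obtain e where e: "e \<in> E" using fin by auto
  then obtain a b where ab: "e = {a, b}" "a \<noteq> b"
    using two[OF e] by (auto simp: card_2_iff)
  have "[a, b] \<in> paths"
    using ab e by (auto simp: paths_def nth_Cons split: nat.splits)
  then obtain xs where xs: "xs \<in> paths" and max: "\<And>ys. ys \<in> paths \<Longrightarrow> length ys \<le> length xs"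
    using ex_has_greatest_nat[of "\<lambda>xs. xs \<in> paths" "[a, b]" length] len by blast
  have dist: "distinct xs" and xs2: "2 \<le> length xs"
    and adj: "\<And>i. Suc i < length xs \<Longrightarrow> {xs ! i, xs ! Suc i} \<in> E"
    using xs by (auto simp: paths_def)
  have e0: "{xs ! 0, xs ! 1} \<in> {e \<in> E. xs ! 0 \<in> e}"
    using adj[of 0] xs2 by auto
  have "\<exists>e' \<in> {e \<in> E. xs ! 0 \<in> e}. e' \<noteq> {xs ! 0, xs ! 1}"
  proof (rule ccontr)
    assume "\<not> ?thesis"
    then have "{e \<in> E. xs ! 0 \<in> e} = {{xs ! 0, xs ! 1}}"
      using e0 by blast
    then show False using deg[of "xs ! 0"] by (simp add: degree_def)
  qed
  then obtain e' where e': "e' \<in> E" "xs ! 0 \<in> e'" "e' \<noteq> {xs ! 0, xs ! 1}"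
    by blast
  obtain c where c: "e' = {xs ! 0, c}" "c \<noteq> xs ! 0"
    using two[OF e'(1)] e'(2) by (auto simp: card_2_iff)
  have c1: "c \<noteq> xs ! 1" using e'(3) c by auto
  have "c \<in> set xs"
  proof (rule ccontr)
    assume "c \<notin> set xs"
    then have "c # xs \<in> paths"
      using dist xs2 adj e'(1) c by (auto simp: paths_def nth_Cons insert_commute split: nat.splits)
    then show False using max by fastforce
  qed
  then obtain i where i: "i < length xs" "c = xs ! i"
    by (auto simp: in_set_conv_nth)
  \<comment> \<open>\<open>c\<close> is neither of the first two vertices of the path, so the closed
    segment has at least three vertices.\<close>
  have i2: "2 \<le> i"
    using c c1 i by (cases i; cases "i - 1") auto
  let ?ys = "take (Suc i) xs"
  have "cycle_edges ?ys \<subseteq> E"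
  proof
    fix f assume "f \<in> cycle_edges ?ys"
    then obtain j where j: "j < Suc i" "f = {?ys ! j, ?ys ! (Suc j mod Suc i)}"
      using i by (auto simp: cycle_edges_def)
    show "f \<in> E"
    proof (cases "j = i")
      case True
      then show ?thesis using j i c e' by (simp add: insert_commute)
    next
      case False
      then show ?thesis using j i adj[of j] by simp
    qed
  qed
  then have "is_cycle E (cycle_edges ?ys)"
    unfolding is_cycle_def using dist i i2 by (intro exI[of _ ?ys]) auto
  then show ?thesis by blast
qed

text \<open>Induction by deleting a leaf, which exists because otherwise
  \<open>cycle_of_degree_ne_1\<close> yields a cycle. Isolated vertices are not counted, hence the
  strict inequality needs at least one edge.\<close>

lemma forest_card:
  assumes "finite E" "E \<noteq> {}" "\<And>e. e \<in> E \<Longrightarrow> card e = 2" "forest E"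
  shows "card E < card (\<Union> E)"
  using assms
proof (induction "card E" arbitrary: E)
  case 0
  then show ?case by simp
next
  case (Suc k)
  have finV: "finite (\<Union> E)"
    using Suc.prems by (metis card.infinite finite_Union zero_neq_numeral)
  obtain v where v: "degree E v = 1"
    using cycle_of_degree_ne_1[of E] Suc.prems by (auto simp: forest_def)
  then obtain e where e: "{e \<in> E. v \<in> e} = {e}"
    unfolding degree_def by (meson card_1_singletonE)
  then have eE: "e \<in> E" "v \<in> e" by auto
  let ?E = "E - {e}"
  have card: "card E = Suc (card ?E)"
    using eE Suc.prems by (meson card.remove)
  have V: "\<Union> ?E \<subseteq> \<Union> E - {v}" using e by blast
  have le: "card (\<Union> ?E) \<le> card (\<Union> E) - 1"
    using card_mono[OF _ V] finV eE by (metis UnionI card_Diff_singleton finite_Diff)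
  show ?case
  proof (cases "?E = {}")
    case True
    then have "E = {e}" using eE by auto
    then show ?thesis using Suc.prems(3)[of e] by simp
  next
    case False
    have "card ?E < card (\<Union> ?E)"
      using Suc.hyps card False Suc.prems forest_mono[of E ?E] by (intro Suc.hyps(1)) auto
    then show ?thesis using card le by linarith
  qed
qed

lemma sum_degree:
  assumes "finite E" "\<And>e. e \<in> E \<Longrightarrow> card e = 2" "finite V" "\<Union> E \<subseteq> V"
  shows "(\<Sum>v\<in>V. degree E v) = 2 * card E"
proof -
  have "(\<Sum>v\<in>V. degree E v) = (\<Sum>v\<in>V. \<Sum>e\<in>E. if v \<in> e then 1 else 0)"
    using assms(1) by (intro sum.cong) (simp_all add: degree_def sum.If_cases Int_def)
  also have "\<dots> = (\<Sum>e\<in>E. \<Sum>v\<in>V. if v \<in> e then 1 else 0)"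
    by (rule sum.swap)
  also have "\<dots> = (\<Sum>e\<in>E. card e)"
  proof (rule sum.cong)
    fix e assume "e \<in> E"
    then have "V \<inter> e = e" using assms(4) by auto
    then show "(\<Sum>v\<in>V. if v \<in> e then 1 else 0) = card e"
      using assms(3) by (simp add: sum.If_cases Int_def)
  qed simp
  also have "\<dots> = 2 * card E"
    using assms(2) by simp
  finally show ?thesis .
qed

text \<open>
  Inside one component, deleting an edge of the only cycle leaves a forest, so there are at most
  as many edges as vertices and no degree can exceed the average 2.
\<close>

lemma unicyclic_degree_le_2:
  assumes fin: "finite E" and two: "\<And>e. e \<in> E \<Longrightarrow> card e = 2"
    and uni: "unicyclic E" and deg: "\<And>v. degree E v \<noteq> 1"
  shows "degree E v \<le> 2"
proof (cases "degree E v = 0")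
  case False
  define S where "S = {w. (v, w) \<in> conn E}"
  \<comment> \<open>Restricting to one component makes its cycle the only one of \<open>D\<close>.
    Degrees inside \<open>S\<close> are unchanged and all others become 0, so still no degree is
    1.\<close>
  define D where "D = {e \<in> E. e \<subseteq> S}"
  have D_eq: "{e \<in> D. w \<in> e} = {e \<in> E. w \<in> e}" if "w \<in> S" for w
  proof -
    have "e \<subseteq> S" if e: "e \<in> E" "w \<in> e" for e
    proof
      fix u assume "u \<in> e"
      then have "u = w \<or> e = {w, u}"
        using two[OF e(1)] e(2) by (auto simp: card_2_iff)
      then show "u \<in> S"
        using \<open>w \<in> S\<close> e(1) conn_edge[of w u E] conn_trans by (fastforce simp: S_def)
    qed
    then show ?thesis by (auto simp: D_def)
  qed
  have deg_in: "degree D w = degree E w" if "w \<in> S" for w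
    using D_eq[OF that] by (simp add: degree_def)
  have deg_out: "degree D w = 0" if "w \<notin> S" for w
  proof -
    have "{e \<in> D. w \<in> e} = {}" using that by (auto simp: D_def)
    then show ?thesis unfolding degree_def by (simp only: card.empty)
  qed
  have D: "finite D" "\<And>e. e \<in> D \<Longrightarrow> card e = 2" "D \<subseteq> E"
    using fin two by (auto simp: D_def)
  have finV: "finite (\<Union> D)"
    using D by (metis card.infinite finite_Union zero_neq_numeral)
  have vS: "v \<in> S" by (simp add: S_def)
  then have "D \<noteq> {}"
    using False deg_in[of v] by (auto simp: degree_def)
  moreover have "degree D w \<noteq> 1" for w
    using deg deg_in deg_out by (cases "w \<in> S") auto
  ultimately obtain C where C: "is_cycle D C"
    using cycle_of_degree_ne_1[of D] D by blast
  obtain e where e: "e \<in> C" "e \<in> D"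
    using is_cycle_edge_exists[OF C] .
  have inS: "\<Union> C' \<subseteq> S" if "is_cycle D C'" for C'
    using that by (auto simp: is_cycle_def D_def)
  have uniq: "C' = C" if C': "is_cycle D C'" for C'
  proof -
    obtain f where f: "f \<in> C'" "f \<in> D"
      using is_cycle_edge_exists[OF C'] .
    obtain x y where xy: "x \<in> e" "y \<in> f"
      using e f D(2) by (metis card.empty ex_in_conv zero_neq_numeral)
    then have "(v, x) \<in> conn E" "(v, y) \<in> conn E"
      using inS[OF C] inS[OF C'] e f by (auto simp: S_def)
    then have "(y, x) \<in> conn E" using conn_sym conn_trans by metis
    then show ?thesis
      using unicyclicD[OF uni is_cycle_mono[OF C' D(3)] is_cycle_mono[OF C D(3)], of y x] xy e f
      by blast
  qed
  have "forest (D - {e})"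
    unfolding forest_def
  proof
    assume "\<exists>C. is_cycle (D - {e}) C"
    then obtain C' where C': "is_cycle (D - {e}) C'" by blast
    then have "C' = C" using uniq is_cycle_mono[of "D - {e}" C' D] by blast
    then show False using C' e by (auto simp: is_cycle_def)
  qed
  have "card D \<le> card (\<Union> D)"
  proof (cases "D - {e} = {}")
    case True
    then have "D = {e}" using e by auto
    then show ?thesis using D(2)[of e] by simp
  next
    case False
    have "card (D - {e}) < card (\<Union> (D - {e}))"
      using forest_card[of "D - {e}"] False D \<open>forest (D - {e})\<close> by blast
    also have "\<dots> \<le> card (\<Union> D)"
      using finV by (intro card_mono) auto
    finally show ?thesis using card.remove[OF D(1) e(2)] by linarith
  qed
  then have "(\<Sum>w\<in>\<Union> D. degree D w) \<le> (\<Sum>w\<in>\<Union> D. 2)"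
    using sum_degree[OF D(1,2) finV] by simp
  moreover have "2 \<le> degree D w" if w: "w \<in> \<Union> D" for w
  proof -
    have "w \<in> S" using w by (auto simp: D_def)
    moreover have "degree D w \<noteq> 0" using w D(1) by (auto simp: degree_def)
    ultimately show ?thesis using deg[of w] deg_in[of w] by simp
  qed
  ultimately have "degree D w = 2" if "w \<in> \<Union> D" for w
    using that finV sum_strict_mono_ex1[of "\<Union> D" "\<lambda>_. 2" "degree D"]
    by (metis leD le_neq_implies_less)
  moreover have "v \<in> \<Union> D"
  proof (rule ccontr)
    assume "v \<notin> \<Union> D"
    then have "{e \<in> D. v \<in> e} = {}" by auto
    then have "degree D v = 0" unfolding degree_def by (simp only: card.empty)
    then show False using False deg_in[OF vS] by simp
  qed
  ultimately show ?thesis using deg_in[OF vS] by simp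
qed simp

section \<open>Program logic for the word RAM\<close>

definition setr :: "nat \<Rightarrow> nat \<Rightarrow> state \<Rightarrow> state" where
  "setr x v s = State ((reg s)(x := v)) (arr s)"

definition seta :: "nat \<Rightarrow> nat \<Rightarrow> nat \<Rightarrow> state \<Rightarrow> state" where
  "seta a i v s = State (reg s) ((arr s)(a := (arr s a)(i := v)))"

lemma reg_arr_upd [simp]:
  "reg (setr x v s) = (reg s)(x := v)"
  "arr (setr x v s) = arr s"
  "reg (seta a i v s) = reg s"
  "arr (seta a i v s) = (arr s)(a := (arr s a)(i := v))"
  by (simp_all add: setr_def seta_def)

fun block :: "com list \<Rightarrow> com" where
  "block [] = Skip"
| "block (c # cs) = Seq c (block cs)"

fun const_le :: "nat \<Rightarrow> expr \<Rightarrow> bool" where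
  "const_le b (Const i) \<longleftrightarrow> i \<le> b"
| "const_le b (Reg x) \<longleftrightarrow> True"
| "const_le b (Arr a e) \<longleftrightarrow> const_le b e"
| "const_le b (Add e1 e2) \<longleftrightarrow> const_le b e1 \<and> const_le b e2"
| "const_le b (Sub e1 e2) \<longleftrightarrow> const_le b e1 \<and> const_le b e2"

text \<open>Expressions with at most 16 operations and constants at most 4 fit into a word.\<close>

definition small :: "expr \<Rightarrow> bool" where
  "small e \<longleftrightarrow> const_le 4 e \<and> expr_time e \<le> 16"

fun small_cond :: "cond \<Rightarrow> bool" where
  "small_cond (Less e1 e2) \<longleftrightarrow> small e1 \<and> small e2"
| "small_cond (Equal e1 e2) \<longleftrightarrow> small e1 \<and> small e2"
| "small_cond (Neg b) \<longleftrightarrow> small_cond b"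
| "small_cond (Conj b1 b2) \<longleftrightarrow> small_cond b1 \<and> small_cond b2"

definition bounded :: "nat \<Rightarrow> state \<Rightarrow> bool" where
  "bounded B s \<longleftrightarrow> (\<forall>x. reg s x \<le> B) \<and> (\<forall>a i. arr s a i \<le> B)"

text \<open>Only sums can exceed the memory bound.\<close>

fun storable :: "nat \<Rightarrow> state \<Rightarrow> expr \<Rightarrow> bool" where
  "storable B s (Const i) \<longleftrightarrow> True"
| "storable B s (Reg x) \<longleftrightarrow> True"
| "storable B s (Arr a e) \<longleftrightarrow> True"
| "storable B s (Add e1 e2) \<longleftrightarrow> expr_val s (Add e1 e2) \<le> B"
| "storable B s (Sub e1 e2) \<longleftrightarrow> storable B s e1"

text \<open>Two bounds: every memory cell stays at most \<open>B\<close>, and the values inside an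
  expression, being built from few such cells and constants, stay at most \<open>W\<close>. Size
  conditions then arise only at assignments.\<close>

locale machine =
  fixes W B :: nat
  assumes B: "4 \<le> B" and W: "16 * B \<le> W"
begin

lemma expr_val_le:
  "const_le 4 e \<Longrightarrow> bounded B s \<Longrightarrow> expr_val s e \<le> expr_time e * B"
proof (induction e)
  case (Arr a e)
  have "arr s a (expr_val s e) \<le> 1 * B"
    using Arr by (simp add: bounded_def)
  also have "\<dots> \<le> expr_time (Arr a e) * B"
    by (intro mult_right_mono) auto
  finally show ?case by simp
next
  case (Add e1 e2)
  then show ?case by (simp add: algebra_simps)
next
  case (Sub e1 e2)
  then have "expr_val s e1 \<le> expr_time e1 * B" by simp
  then show ?case by (simp add: algebra_simps)
qed (use B in \<open>auto simp: bounded_def\<close>)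

lemma expr_fits:
  "const_le 4 e \<Longrightarrow> bounded B s \<Longrightarrow> expr_time e \<le> 16 \<Longrightarrow> expr_fits W s e"
proof (induction e)
  case (Const i)
  then show ?case using B W by simp
next
  case (Reg x)
  then have "reg s x \<le> B" by (simp add: bounded_def)
  then show ?case using W by simp
next
  case (Arr a e)
  then have "arr s a (expr_val s e) \<le> B" by (simp add: bounded_def)
  then show ?case using Arr W by simp
next
  case (Add e1 e2)
  have "expr_val s (Add e1 e2) \<le> expr_time (Add e1 e2) * B"
    using Add.prems expr_val_le[of "Add e1 e2"] by blast
  also have "\<dots> \<le> 16 * B"
    using Add.prems by (intro mult_right_mono) auto
  finally show ?case using Add W by simp
qed simp_all

lemma small_fits: "small e \<Longrightarrow> bounded B s \<Longrightarrow> expr_fits W s e"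
  by (simp add: small_def expr_fits)

lemma small_cond_fits: "small_cond b \<Longrightarrow> bounded B s \<Longrightarrow> cond_fits W s b"
  by (induction b) (auto simp: small_fits)

lemma storable_le:
  "storable B s e \<Longrightarrow> small e \<Longrightarrow> bounded B s \<Longrightarrow> expr_val s e \<le> B"
proof (induction e)
  case (Sub e1 e2)
  then show ?case by (fastforce simp: small_def)
qed (use B in \<open>auto simp: bounded_def small_def\<close>)

text \<open>Total correctness, with the elapsed time as an argument of the postcondition. The memory
  bound is threaded through implicitly, so that no loop invariant has to mention it.\<close>

definition wp :: "com \<Rightarrow> (nat \<Rightarrow> state \<Rightarrow> bool) \<Rightarrow> state \<Rightarrow> bool" where
  "wp p Q s \<longleftrightarrow> (bounded B s \<longrightarrow> (\<exists>t s'. run W p s t s' \<and> bounded B s' \<and> Q t s'))"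

lemma wp_mono: "wp p Q s \<Longrightarrow> (\<And>t s'. Q t s' \<Longrightarrow> Q' t s') \<Longrightarrow> wp p Q' s"
  unfolding wp_def by blast

lemma wp_Seq: "wp p (\<lambda>t s'. wp q (\<lambda>u. Q (t + u)) s') s \<Longrightarrow> wp (Seq p q) Q s"
  unfolding wp_def using run.Seq by metis

lemma wp_Set_Reg:
  assumes "small e" "storable B s e" "Q (expr_time e + 1) (setr x (expr_val s e) s)"
  shows "wp (Set_Reg x e) Q s"
  unfolding wp_def
proof
  assume b: "bounded B s"
  have "bounded B (setr x (expr_val s e) s)"
    using b storable_le[OF assms(2,1) b] by (auto simp: bounded_def)
  then show "\<exists>t s'. run W (Set_Reg x e) s t s' \<and> bounded B s' \<and> Q t s'"
    using run.Set_Reg[OF small_fits[OF assms(1) b], of x] assms(3) by (auto simp: setr_def)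
qed

lemma wp_Set_Arr:
  assumes "small i" "small e" "storable B s e"
    "Q (expr_time i + expr_time e + 1) (seta a (expr_val s i) (expr_val s e) s)"
  shows "wp (Set_Arr a i e) Q s"
  unfolding wp_def
proof
  assume b: "bounded B s"
  have "bounded B (seta a (expr_val s i) (expr_val s e) s)"
    using b storable_le[OF assms(3,2) b] by (auto simp: bounded_def)
  then show "\<exists>t s'. run W (Set_Arr a i e) s t s' \<and> bounded B s' \<and> Q t s'"
    using run.Set_Arr[OF small_fits[OF assms(1) b] small_fits[OF assms(2) b], of a] assms(4)
    by (auto simp: seta_def)
qed

lemma wp_If:
  assumes "small_cond b"
    "cond_val s b \<Longrightarrow> wp p (\<lambda>t. Q (cond_time b + t + 1)) s"
    "\<not> cond_val s b \<Longrightarrow> wp q (\<lambda>t. Q (cond_time b + t + 1)) s"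
  shows "wp (If b p q) Q s"
  unfolding wp_def
proof
  assume bd: "bounded B s"
  note fits = small_cond_fits[OF assms(1) bd]
  show "\<exists>t s'. run W (If b p q) s t s' \<and> bounded B s' \<and> Q t s'"
  proof (cases "cond_val s b")
    case True
    then show ?thesis
      using assms(2) bd run.If_True[OF fits True] unfolding wp_def by metis
  next
    case False
    then show ?thesis
      using assms(3) bd run.If_False[OF fits False] unfolding wp_def by metis
  qed
qed

text \<open>These equations let the simplifier execute straight-line code symbolically; loops remain
  as \<open>wp\<close> obligations.\<close>

fun vc :: "com \<Rightarrow> (nat \<Rightarrow> state \<Rightarrow> bool) \<Rightarrow> state \<Rightarrow> bool" where
  "vc Skip Q s \<longleftrightarrow> Q 1 s"
| "vc (Set_Reg x e) Q s \<longleftrightarrow> small e \<and> storable B s e \<and> Q (expr_time e + 1) (setr x (expr_val s e) s)"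
| "vc (Set_Arr a i e) Q s \<longleftrightarrow> small i \<and> small e \<and> storable B s e \<and>
     Q (expr_time i + expr_time e + 1) (seta a (expr_val s i) (expr_val s e) s)"
| "vc (Seq p q) Q s \<longleftrightarrow> vc p (\<lambda>t. vc q (\<lambda>u. Q (t + u))) s"
| "vc (If b p q) Q s \<longleftrightarrow> small_cond b \<and>
     (cond_val s b \<longrightarrow> vc p (\<lambda>t. Q (cond_time b + t + 1)) s) \<and>
     (\<not> cond_val s b \<longrightarrow> vc q (\<lambda>t. Q (cond_time b + t + 1)) s)"
| "vc (While b p) Q s \<longleftrightarrow> wp (While b p) Q s"

lemma vc_wp: "vc p Q s \<Longrightarrow> wp p Q s"
proof (induction p arbitrary: Q s)
  case Skip
  then show ?case using run.Skip by (auto simp: wp_def)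
next
  case (Seq p q)
  have "vc p (\<lambda>t. vc q (\<lambda>u. Q (t + u))) s" using Seq.prems by simp
  from Seq.IH(1)[OF this] show ?case
    by (intro wp_Seq) (erule wp_mono, rule Seq.IH(2))
next
  case (If b p q)
  then show ?case by (auto intro!: wp_If)
qed (auto intro: wp_Set_Reg wp_Set_Arr)

text \<open>
  The potential \<open>\<mu>\<close> pays for the iterations, so that the costs of nested loops can be amortised.
\<close>

lemma wp_While:
  assumes "I s" "small_cond b"
    and body: "\<And>s. I s \<Longrightarrow> cond_val s b
      \<Longrightarrow> wp p (\<lambda>t s'. I s' \<and> t + cond_time b + 1 + \<mu> s' \<le> \<mu> s) s"
    and post: "\<And>t s'. I s' \<Longrightarrow> \<not> cond_val s' b \<Longrightarrow> t + \<mu> s' \<le> \<mu> s + cond_time b + 1 \<Longrightarrow> Q t s'"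
  shows "wp (While b p) Q s"
proof -
  \<comment> \<open>The body lowers the potential by at least \<open>cond_time b + 1\<close>, so the
    quantity that pays for the time also proves termination.\<close>
  have "bounded B s \<Longrightarrow> \<exists>t s'. run W (While b p) s t s' \<and> bounded B s' \<and> I s' \<and> \<not> cond_val s' b
      \<and> t + \<mu> s' \<le> \<mu> s + cond_time b + 1"
    using assms(1)
  proof (induction "\<mu> s" arbitrary: s rule: less_induct)
    case (less s)
    note fits = small_cond_fits[OF assms(2) less.prems(1)]
    show ?case
    proof (cases "cond_val s b")
      case False
      then show ?thesis using less.prems run.While_False[OF fits False] by fastforce
    next
      case True
      obtain t1 s1 where s1: "run W p s t1 s1" "bounded B s1" "I s1"
        "t1 + cond_time b + 1 + \<mu> s1 \<le> \<mu> s"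
        using body[OF less.prems(2) True] less.prems(1) unfolding wp_def by blast
      obtain t2 s2 where s2: "run W (While b p) s1 t2 s2" "bounded B s2" "I s2"
        "\<not> cond_val s2 b" "t2 + \<mu> s2 \<le> \<mu> s1 + cond_time b + 1"
        using less.hyps[of s1] s1 by auto
      have "cond_time b + t1 + t2 + 1 + \<mu> s2 \<le> \<mu> s + cond_time b + 1"
        using s1(4) s2(5) by linarith
      then show ?thesis
        using run.While_True[OF fits True s1(1) s2(1)] s2 by blast
    qed
  qed
  then show ?thesis unfolding wp_def using post by blast
qed

end

section \<open>Finding the cycles\<close>

definition same_arrays :: "nat set \<Rightarrow> state \<Rightarrow> state \<Rightarrow> bool" where
  "same_arrays A s s' \<longleftrightarrow> (\<forall>a. a \<notin> A \<longrightarrow> arr s' a = arr s a) \<and> (\<forall>x<3. reg s' x = reg s x)"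

lemma same_arrays_refl [simp]: "same_arrays A s s"
  by (simp add: same_arrays_def)

lemma same_arrays_trans: "same_arrays A s s' \<Longrightarrow> same_arrays A s' s'' \<Longrightarrow> same_arrays A s s''"
  by (simp add: same_arrays_def)

lemma same_arraysD:
  "same_arrays A s s' \<Longrightarrow> a \<notin> A \<Longrightarrow> arr s' a = arr s a"
  "same_arrays A s s' \<Longrightarrow> reg s' 0 = reg s 0"
  "same_arrays A s s' \<Longrightarrow> reg s' 1 = reg s 1"
  "same_arrays A s s' \<Longrightarrow> reg s' 2 = reg s 2"
  by (simp_all add: same_arrays_def)

text \<open>Otherwise the simplifier would turn register and array number 1 into \<open>Suc 0\<close>.\<close>

declare One_nat_def [simp del]

lemma less_plus_1_iff: "x < y + 1 \<longleftrightarrow> x < y \<or> x = y" for x y :: nat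
  by auto

text \<open>
  Array \<open>asum\<close> holds the sum of the indices of the unpeeled edges at each vertex. It is the only such
  edge at a vertex of degree 1, and it turns one edge into the other at a vertex of degree 2, so that
  no adjacency lists are needed.
\<close>

abbreviation (input) "rm \<equiv> 1 :: nat"
abbreviation (input) "rj \<equiv> 3 :: nat"
abbreviation (input) "rz \<equiv> 8 :: nat"
abbreviation (input) "re \<equiv> 9 :: nat"
abbreviation (input) "rw \<equiv> 10 :: nat"
abbreviation (input) "rC \<equiv> 11 :: nat"

abbreviation (input) "aout \<equiv> 3 :: nat"
abbreviation (input) "aU \<equiv> 7 :: nat"
abbreviation (input) "aV \<equiv> 8 :: nat"
abbreviation (input) "adeg \<equiv> 12 :: nat"
abbreviation (input) "asum \<equiv> 13 :: nat"
abbreviation (input) "apeel \<equiv> 16 :: nat"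
abbreviation (input) "anx \<equiv> 17 :: nat"
abbreviation (input) "apv \<equiv> 18 :: nat"
abbreviation (input) "ane \<equiv> 19 :: nat"
abbreviation (input) "acid \<equiv> 20 :: nat"
abbreviation (input) "ase \<equiv> 21 :: nat"

abbreviation (input) "other_end \<equiv> Sub (Add (Arr aU (Reg re)) (Arr aV (Reg re))) (Reg rz)"

section \<open>Peeling off vertices of degree 1\<close>

definition peel_loop :: com where
  "peel_loop = While (Equal (Arr adeg (Reg rz)) (Const 1)) (block [
     Set_Reg re (Arr asum (Reg rz)),
     Set_Reg rw other_end,
     Set_Arr apeel (Reg re) (Const 1),
     Set_Arr adeg (Reg rz) (Const 0),
     Set_Arr asum (Reg rz) (Const 0),
     Set_Arr adeg (Reg rw) (Sub (Arr adeg (Reg rw)) (Const 1)),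
     Set_Arr asum (Reg rw) (Sub (Arr asum (Reg rw)) (Reg re)),
     Set_Reg rz (Reg rw)])"

definition peel :: com where
  "peel = block [
     Set_Reg rj (Const 0),
     While (Less (Reg rj) (Reg rm)) (block [
       Set_Reg rz (Arr aU (Reg rj)),
       peel_loop,
       Set_Reg rz (Arr aV (Reg rj)),
       peel_loop,
       Set_Reg rj (Add (Reg rj) (Const 1))])]"

text \<open>Edges are addressed by index, as in the arrays of the program; distinct indices give
  distinct edges, so counting indices is counting edges.\<close>

locale indexed_graph =
  fixes m :: nat and U V :: "nat \<Rightarrow> nat"
  assumes ends_ne: "j < m \<Longrightarrow> U j \<noteq> V j"
    and ends_inj: "i < m \<Longrightarrow> j < m \<Longrightarrow> {U i, V i} = {U j, V j} \<Longrightarrow> i = j"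
    and uni: "unicyclic ((\<lambda>j. {U j, V j}) ` {..<m})"
begin

definition ed :: "nat \<Rightarrow> nat set" where
  "ed j = {U j, V j}"

definition inc :: "nat set \<Rightarrow> nat \<Rightarrow> nat set" where
  "inc L z = {j \<in> L. z \<in> ed j}"

definition all_edges :: "nat set set" where
  "all_edges = ed ` {..<m}"

lemma inj_ed: "inj_on ed {..<m}"
  using ends_inj by (auto simp: inj_on_def ed_def)

lemma ed_cong: "i < m \<Longrightarrow> j < m \<Longrightarrow> ed i = ed j \<Longrightarrow> i = j"
  using ends_inj by (simp add: ed_def)

lemma card_ed: "j < m \<Longrightarrow> card (ed j) = 2"
  using ends_ne by (simp add: ed_def)

lemma unicyclic_all_edges: "unicyclic all_edges"
  using uni by (simp add: all_edges_def ed_def)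

lemma ed_other: "z \<in> ed j \<Longrightarrow> ed j = {z, U j + V j - z}"
  by (auto simp: ed_def)

lemma ed_other_ne: "j < m \<Longrightarrow> z \<in> ed j \<Longrightarrow> U j + V j - z \<noteq> z"
  using ends_ne[of j] by (auto simp: ed_def)

lemma finite_inc: "L \<subseteq> {..<m} \<Longrightarrow> finite (inc L z)"
  unfolding inc_def by (rule finite_subset[of _ "{..<m}"]) auto

lemma degree_image: "L \<subseteq> {..<m} \<Longrightarrow> degree (ed ` L) z = card (inc L z)"
proof -
  assume L: "L \<subseteq> {..<m}"
  have "{e \<in> ed ` L. z \<in> e} = ed ` inc L z"
    by (auto simp: inc_def)
  moreover have "inj_on ed (inc L z)"
    using L inj_ed by (auto simp: inc_def intro: inj_on_subset)
  ultimately show ?thesis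
    by (simp add: degree_def card_image)
qed

text \<open>The sum alone cannot tell edge 0 from no edge at all; the degree can.\<close>

definition peel_inv :: "nat set \<Rightarrow> (nat \<Rightarrow> nat) \<Rightarrow> (nat \<Rightarrow> nat) \<Rightarrow> (nat \<Rightarrow> nat) \<Rightarrow> bool" where
  "peel_inv L pe dg sm \<longleftrightarrow> L = {j. j < m \<and> pe j = 0}
     \<and> dg = (\<lambda>z. card (inc L z)) \<and> sm = (\<lambda>z. \<Sum>(inc L z))
     \<and> (\<forall>C. is_cycle all_edges C \<longrightarrow> C \<subseteq> ed ` L)"

definition live :: "(nat \<Rightarrow> nat) \<Rightarrow> nat" where
  "live pe = card {j. j < m \<and> pe j = 0}"

lemma live_upd:
  assumes "e < m" "pe e = 0"
  shows "live pe = live (pe(e := 1)) + 1"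
proof -
  have "{j. j < m \<and> pe j = 0} = insert e {j. j < m \<and> (pe(e := 1)) j = 0}"
    using assms by auto
  then show ?thesis by (simp add: live_def)
qed

text \<open>The sum over a one-element set is its element, so \<open>sm z\<close> is the only edge
  left at \<open>z\<close>. No cycle loses an edge, because a cycle through \<open>z\<close> would
  need two edges there.\<close>

lemma peel_step:
  assumes inv: "peel_inv L pe dg sm" and z: "dg z = 1"
  defines "e \<equiv> sm z"
  defines "w \<equiv> U e + V e - z"
  shows "e \<in> L" "w \<noteq> z"
    "peel_inv (L - {e}) (pe(e := 1)) (dg(z := 0, w := dg w - 1)) (sm(z := 0, w := sm w - e))"
proof -
  have L: "L = {j. j < m \<and> pe j = 0}" and dg: "dg = (\<lambda>z. card (inc L z))"
    and sm: "sm = (\<lambda>z. \<Sum>(inc L z))" and cyc: "\<And>C. is_cycle all_edges C \<Longrightarrow> C \<subseteq> ed ` L"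
    using inv by (auto simp: peel_inv_def)
  have "card (inc L z) = 1" using z dg by simp
  then obtain e' where "inc L z = {e'}" by (rule card_1_singletonE)
  then have e: "inc L z = {e}" by (simp add: e_def sm)
  then have eL: "e \<in> L" "z \<in> ed e" by (auto simp: inc_def)
  then show "e \<in> L" by simp
  have em: "e < m" using eL L by auto
  have ed: "ed e = {z, w}" using ed_other[OF eL(2)] by (simp add: w_def)
  show wz: "w \<noteq> z" using ed_other_ne[OF em eL(2)] by (simp add: w_def)
  have Lm: "L \<subseteq> {..<m}" using L by auto
  have inc': "inc (L - {e}) y = (if y = z then {} else if y = w then inc L w - {e} else inc L y)" for y
    using e ed by (auto simp: inc_def)
  have ew: "e \<in> inc L w" using eL ed by (auto simp: inc_def)
  have "L - {e} = {j. j < m \<and> (pe(e := 1)) j = 0}"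
    using L by auto
  moreover have "dg(z := 0, w := dg w - 1) = (\<lambda>y. card (inc (L - {e}) y))"
    using wz ew by (auto simp: inc' dg)
  moreover have "sm(z := 0, w := sm w - e) = (\<lambda>y. \<Sum>(inc (L - {e}) y))"
    using wz sum.remove[OF finite_inc[OF Lm] ew, of "\<lambda>x. x"] by (auto simp: inc' sm)
  moreover have "C \<subseteq> ed ` (L - {e})" if C: "is_cycle all_edges C" for C
  proof -
    have "ed e \<notin> C"
    proof
      assume "ed e \<in> C"
      obtain xs where xs: "distinct xs" "3 \<le> length xs" "C = cycle_edges xs"
        using C by (auto simp: is_cycle_def)
      have "z \<in> set xs"
        using \<open>ed e \<in> C\<close> eL(2) Union_cycle_edges[of xs] xs(3) by auto
      then obtain y y' where y: "y \<noteq> y'" "{z, y} \<in> C" "{z, y'} \<in> C"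
        using cycle_edges_two_edges[OF xs(1,2)] xs(3) by blast
      obtain i i' where i: "i \<in> L" "ed i = {z, y}" "i' \<in> L" "ed i' = {z, y'}"
      proof -
        have "{z, y} \<in> ed ` L" "{z, y'} \<in> ed ` L" using y(2,3) cyc[OF C] by auto
        then obtain i i' where "i \<in> L" "{z, y} = ed i" "i' \<in> L" "{z, y'} = ed i'" by blast
        then show ?thesis using that[of i i'] by simp
      qed
      then have "i \<in> inc L z" "i' \<in> inc L z" by (auto simp: inc_def)
      then have "{z, y} = {z, y'}" using e i by auto
      then show False using y(1) by (auto simp: doubleton_eq_iff)
    qed
    then show ?thesis using cyc[OF C] by auto
  qed
  ultimately show "peel_inv (L - {e}) (pe(e := 1)) (dg(z := 0, w := dg w - 1)) (sm(z := 0, w := sm w - e))"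
    unfolding peel_inv_def by blast
qed

text \<open>The loops check only ends of edges, but all other vertices have degree 0. So no degree
  is 1, and in a unicyclic graph this excludes degrees above 2 as well.\<close>

lemma peel_inv_final:
  assumes "peel_inv L pe dg sm" "\<And>j. j < m \<Longrightarrow> dg (U j) \<noteq> 1 \<and> dg (V j) \<noteq> 1"
  shows "card (inc L z) = 0 \<or> card (inc L z) = 2"
proof -
  have L: "L \<subseteq> {..<m}" and dg: "dg = (\<lambda>z. card (inc L z))"
    using assms(1) by (auto simp: peel_inv_def)
  have "degree (ed ` L) y \<noteq> 1" for y
  proof (cases "inc L y = {}")
    case False
    then obtain j where "j < m" "y \<in> ed j" using L by (auto simp: inc_def)
    then show ?thesis using assms(2)[of j] degree_image[OF L] dg by (auto simp: ed_def)
  qed (simp add: degree_image[OF L])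
  moreover have "finite (ed ` L)" using L finite_subset by blast
  moreover have "unicyclic (ed ` L)"
    using unicyclic_mono[OF unicyclic_all_edges, of "ed ` L"] image_mono[OF L, of ed]
    by (simp add: all_edges_def)
  moreover have "card e = 2" if "e \<in> ed ` L" for e using that L card_ed by auto
  ultimately have "degree (ed ` L) z \<le> 2" "degree (ed ` L) z \<noteq> 1"
    using unicyclic_degree_le_2[of "ed ` L" z] by auto
  then show ?thesis using degree_image[OF L, of z] by linarith
qed

end

locale machine_graph = machine W B + indexed_graph m U V
  for W B m :: nat and U V :: "nat \<Rightarrow> nat" +
  assumes sum_ends_le: "U j + V j \<le> B" and m_le: "m < B"
begin

definition peel_mem :: "state \<Rightarrow> nat set \<Rightarrow> state \<Rightarrow> bool" where
  "peel_mem s0 L s \<longleftrightarrow> same_arrays {adeg, asum, apeel} s0 s \<and> reg s rm = m \<and> arr s aU = U \<and> arr s aV = V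
     \<and> peel_inv L (arr s apeel) (arr s adeg) (arr s asum)"

text \<open>\<open>S\<close> collects the vertices already known not to have degree 1. One step
  changes the degrees of the current vertex, which becomes 0, and of the vertex visited next; hence
  the current vertex is always the only possible exception.\<close>

lemma wp_peel_loop:
  assumes "peel_mem s0 L s" "\<And>y. y \<in> S \<Longrightarrow> y \<noteq> reg s rz \<Longrightarrow> arr s adeg y \<noteq> 1"
    and post: "\<And>t s' L'. peel_mem s0 L' s' \<Longrightarrow> reg s' rj = reg s rj \<Longrightarrow>
      (\<And>y. y \<in> insert (reg s rz) S \<Longrightarrow> arr s' adeg y \<noteq> 1) \<Longrightarrow>
      t + 50 * card L' \<le> 50 * card L + 10 \<Longrightarrow> Q t s'"
  shows "wp peel_loop Q s"
  unfolding peel_loop_def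
proof (rule wp_While[where \<mu> = "\<lambda>s. 50 * live (arr s apeel)"
    and I = "\<lambda>s'. (\<exists>L'. peel_mem s0 L' s') \<and> reg s' rj = reg s rj \<and>
      (\<forall>y \<in> insert (reg s rz) S. y \<noteq> reg s' rz \<longrightarrow> arr s' adeg y \<noteq> 1)"])
  show "(\<exists>L'. peel_mem s0 L' s) \<and> reg s rj = reg s rj \<and>
      (\<forall>y \<in> insert (reg s rz) S. y \<noteq> reg s rz \<longrightarrow> arr s adeg y \<noteq> 1)"
    using assms(1,2) by blast
next
  show "small_cond (Equal (Arr adeg (Reg rz)) (Const 1))" by (simp add: small_def)
next
  fix s1 assume I: "(\<exists>L'. peel_mem s0 L' s1) \<and> reg s1 rj = reg s rj \<and>
      (\<forall>y \<in> insert (reg s rz) S. y \<noteq> reg s1 rz \<longrightarrow> arr s1 adeg y \<noteq> 1)"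
    and cond: "cond_val s1 (Equal (Arr adeg (Reg rz)) (Const 1))"
  then obtain L1 where L1: "peel_mem s0 L1 s1" by blast
  define z where "z = reg s1 rz"
  define e where "e = arr s1 asum z"
  define w where "w = U e + V e - z"
  have mem: "same_arrays {adeg, asum, apeel} s0 s1" "reg s1 rm = m" "arr s1 aU = U" "arr s1 aV = V"
    and inv: "peel_inv L1 (arr s1 apeel) (arr s1 adeg) (arr s1 asum)"
    using L1 by (auto simp: peel_mem_def)
  have one: "arr s1 adeg z = 1" using cond by (simp add: z_def)
  note step = peel_step[OF inv one, folded e_def, folded w_def]
  have L1eq: "L1 = {j. j < m \<and> arr s1 apeel j = 0}" using inv by (simp add: peel_inv_def)
  have card: "live (arr s1 apeel) = live ((arr s1 apeel)(e := 1)) + 1"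
    using step(1) L1eq by (intro live_upd) auto
  have mem': "\<exists>L'. peel_mem s0 L' s2"
    if "same_arrays {adeg, asum, apeel} s1 s2" "arr s2 apeel = (arr s1 apeel)(e := 1)"
       "arr s2 adeg = (arr s1 adeg)(z := 0, w := arr s1 adeg w - 1)"
       "arr s2 asum = (arr s1 asum)(z := 0, w := arr s1 asum w - e)" for s2
    unfolding peel_mem_def using that step(3) mem same_arrays_trans[OF mem(1) that(1)]
    by (intro exI[of _ "L1 - {e}"]) (auto simp: same_arrays_def)
  show "wp (block [
     Set_Reg re (Arr asum (Reg rz)),
     Set_Reg rw other_end,
     Set_Arr apeel (Reg re) (Const 1),
     Set_Arr adeg (Reg rz) (Const 0),
     Set_Arr asum (Reg rz) (Const 0),
     Set_Arr adeg (Reg rw) (Sub (Arr adeg (Reg rw)) (Const 1)),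
     Set_Arr asum (Reg rw) (Sub (Arr asum (Reg rw)) (Reg re)),
     Set_Reg rz (Reg rw)])
   (\<lambda>t s'. ((\<exists>L'. peel_mem s0 L' s') \<and> reg s' rj = reg s rj \<and>
      (\<forall>y \<in> insert (reg s rz) S. y \<noteq> reg s' rz \<longrightarrow> arr s' adeg y \<noteq> 1)) \<and>
      t + cond_time (Equal (Arr adeg (Reg rz)) (Const 1)) + 1 + 50 * live (arr s' apeel)
      \<le> 50 * live (arr s1 apeel)) s1"
    apply (rule vc_wp)
    using I mem step(2) card one
    apply (simp add: small_def sum_ends_le z_def[symmetric] e_def[symmetric] w_def[symmetric])
    apply (intro conjI mem')
    apply (auto simp: same_arrays_def)
    done
next
  fix t s'
  assume "(\<exists>L'. peel_mem s0 L' s') \<and> reg s' rj = reg s rj \<and>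
      (\<forall>y \<in> insert (reg s rz) S. y \<noteq> reg s' rz \<longrightarrow> arr s' adeg y \<noteq> 1)"
    and "\<not> cond_val s' (Equal (Arr adeg (Reg rz)) (Const 1))"
    and t: "t + 50 * live (arr s' apeel)
       \<le> 50 * live (arr s apeel) + cond_time (Equal (Arr adeg (Reg rz)) (Const 1)) + 1"
  moreover from this have "y \<in> insert (reg s rz) S \<Longrightarrow> arr s' adeg y \<noteq> 1" for y
    by (cases "y = reg s' rz") auto
  ultimately obtain L' where L': "peel_mem s0 L' s'" "reg s' rj = reg s rj"
     "\<And>y. y \<in> insert (reg s rz) S \<Longrightarrow> arr s' adeg y \<noteq> 1"
    by blast
  have "L = {j. j < m \<and> arr s apeel j = 0}" "L' = {j. j < m \<and> arr s' apeel j = 0}"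
    using assms(1) L'(1) by (auto simp: peel_mem_def peel_inv_def)
  then show "Q t s'" using post[OF L'] t by (simp add: live_def)
qed

lemma vc_peel_loop: "vc peel_loop Q s = wp peel_loop Q s"
  by (simp add: peel_loop_def)

lemma wp_peel:
  assumes mem: "reg s rm = m" "arr s aU = U" "arr s aV = V" "arr s apeel = (\<lambda>_. 0)"
      "arr s adeg = (\<lambda>z. card (inc {..<m} z))" "arr s asum = (\<lambda>z. \<Sum>(inc {..<m} z))"
    and post: "\<And>t s' L. peel_mem s L s' \<Longrightarrow> (\<And>z. card (inc L z) = 0 \<or> card (inc L z) = 2)
      \<Longrightarrow> t \<le> 200 * m + 50 \<Longrightarrow> Q t s'"
  shows "wp peel Q s"
proof -
  have start: "peel_mem s {..<m} s"
    using mem by (auto simp: peel_mem_def peel_inv_def all_edges_def is_cycle_def)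
  have mem_set: "peel_mem s L (setr x v s1)" if "peel_mem s L s1" "x \<ge> 3" for L x v s1
    using that by (auto simp: peel_mem_def same_arrays_def)
  let ?I = "\<lambda>s1. (\<exists>L. peel_mem s L s1) \<and> reg s1 rj \<le> m \<and>
      (\<forall>y \<in> \<Union>(ed ` {..<reg s1 rj}). arr s1 adeg y \<noteq> 1)"
  \<comment> \<open>The outer loop visits each edge once, and all inner loops together peel each
    edge at most once.\<close>
  let ?\<mu> = "\<lambda>s1. 100 * (m - reg s1 rj) + 50 * live (arr s1 apeel)"
  let ?body = "block [
       Set_Reg rz (Arr aU (Reg rj)),
       peel_loop,
       Set_Reg rz (Arr aV (Reg rj)),
       peel_loop,
       Set_Reg rj (Add (Reg rj) (Const 1))]"
  have body: "wp ?body (\<lambda>t s'. ?I s' \<and> t + cond_time (Less (Reg rj) (Reg rm)) + 1 + ?\<mu> s' \<le> ?\<mu> s1) s1"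
    if I: "?I s1" and cond: "cond_val s1 (Less (Reg rj) (Reg rm))" for s1
  proof -
    obtain L1 where L1: "peel_mem s L1 s1" using I by blast
    define j where "j = reg s1 rj"
    have m1: "reg s1 rm = m" "arr s1 aU = U" "arr s1 aV = V" and
      card1: "L1 = {j. j < m \<and> arr s1 apeel j = 0}"
      using L1 by (auto simp: peel_mem_def peel_inv_def)
    have j: "j < m" using cond m1 by (simp add: j_def)
    have card_eq: "card L' = live (arr s' apeel)" if "peel_mem s L' s'" for L' s'
      using that by (simp add: peel_mem_def peel_inv_def live_def)
    have facts: "arr s' aV = V" "reg s' 1 = m" if "peel_mem s L' s'" for L' s'
      using that by (auto simp: peel_mem_def)
    show ?thesis
      apply (rule vc_wp)
      apply (simp add: vc_peel_loop small_def m1 j_def[symmetric])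
      apply (rule wp_peel_loop[where L = L1
            and S = "\<Union>(ed ` {..<j})" and ?s0.0 = s])
      subgoal using mem_set[OF L1] by simp
      subgoal using I by (auto simp: j_def)
      subgoal for t2 s2 L2
        apply (simp add: small_def facts vc_peel_loop)
        apply (rule wp_peel_loop[where L = L2
            and S = "insert (U j) (\<Union>(ed ` {..<j}))" and ?s0.0 = s])
        subgoal using mem_set[of L2 s2] by simp
        subgoal by (auto simp: j_def)
        subgoal premises p for t3 s3 L3
        proof -
          have "arr s3 adeg (U y) \<noteq> 1 \<and> arr s3 adeg (V y) \<noteq> 1" if "y < j + 1" for y
            using that p(7)[of "U y"] p(7)[of "V y"] by (auto simp: less_plus_1_iff ed_def j_def)
          then show ?thesis
            using p mem_set[of L3 s3] m_le j card_eq[of L1 s1] card_eq[of L2 s2] card_eq[of L3 s3] L1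
          by (auto simp: small_def less_plus_1_iff ed_def j_def intro: exI[of _ L3])
        qed
        done
      done
  qed
  show ?thesis
    unfolding peel_def
    apply (rule vc_wp)
    apply (simp add: small_def)
    apply (rule wp_While[where I = ?I and \<mu> = ?\<mu>, OF _ _ body[unfolded block.simps]])
    subgoal using mem_set[OF start] by auto
    subgoal by (simp add: small_def)
    subgoal by simp
    subgoal by simp
    subgoal premises prems for t s1
    proof -
      obtain L where L: "peel_mem s L s1" using prems by blast
      have rj: "reg s1 rj = m"
        using prems L by (auto simp: peel_mem_def)
      have "card (inc L z) = 0 \<or> card (inc L z) = 2" for z
      proof (rule peel_inv_final)
        show "peel_inv L (arr s1 apeel) (arr s1 adeg) (arr s1 asum)"
          using L by (simp add: peel_mem_def)
        show "arr s1 adeg (U j) \<noteq> 1 \<and> arr s1 adeg (V j) \<noteq> 1" if "j < m" for j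
          using prems(1) rj that by (auto simp: ed_def)
      qed
      moreover have "live (arr s apeel) = m" using mem by (simp add: live_def)
      ultimately show ?thesis using post[OF L] prems(3) mem by simp
    qed
    done
qed

end

section \<open>Walking around the cycles that survive the peeling\<close>

lemma card_2_eq: "card A = 2 \<Longrightarrow> a \<in> A \<Longrightarrow> b \<in> A \<Longrightarrow> a \<noteq> b \<Longrightarrow> A = {a, b}"
  by (auto simp: card_2_iff)

context indexed_graph
begin

definition verts :: "nat set \<Rightarrow> nat set" where
  "verts L = \<Union> (ed ` L)"

definition cycle_list :: "(nat \<Rightarrow> nat) \<Rightarrow> (nat \<Rightarrow> nat) \<Rightarrow> (nat \<Rightarrow> nat) \<Rightarrow> nat list \<Rightarrow> bool" where
  "cycle_list nx pv ne zs \<longleftrightarrow> distinct zs \<and> 3 \<le> length zs \<and> (\<forall>k < length zs.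
     nx (zs ! k) = zs ! (Suc k mod length zs) \<and> pv (zs ! (Suc k mod length zs)) = zs ! k \<and>
     ne (zs ! k) < m \<and> ed (ne (zs ! k)) = {zs ! k, zs ! (Suc k mod length zs)})"

definition core :: "nat set \<Rightarrow> bool" where
  "core L \<longleftrightarrow> L \<subseteq> {..<m} \<and> (\<forall>z. card (inc L z) = 0 \<or> card (inc L z) = 2)
     \<and> (\<forall>C. is_cycle all_edges C \<longrightarrow> C \<subseteq> ed ` L)"

lemma core_inc:
  assumes "core L" "z \<in> verts L"
  shows "card (inc L z) = 2"
proof -
  have "inc L z \<noteq> {}" using assms by (auto simp: verts_def inc_def)
  then have "card (inc L z) \<noteq> 0"
    using assms finite_inc[of L z] by (simp add: core_def)
  moreover have "card (inc L z) = 0 \<or> card (inc L z) = 2"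
    using assms(1) unfolding core_def by (elim conjE allE[of _ z])
  ultimately show ?thesis by linarith
qed

text \<open>Cycles are numbered from 1, since 0 means unvisited. As visited vertices are closed
  under the remaining edges, one end of an edge already tells whether its cycle is known.\<close>

definition traverse_inv :: "nat set \<Rightarrow> nat \<Rightarrow> nat \<Rightarrow> (nat \<Rightarrow> nat) \<Rightarrow> (nat \<Rightarrow> nat) \<Rightarrow> (nat \<Rightarrow> nat)
    \<Rightarrow> (nat \<Rightarrow> nat) \<Rightarrow> (nat \<Rightarrow> nat) \<Rightarrow> bool" where
  "traverse_inv L j C nx pv ne cid se \<longleftrightarrow>
     (\<forall>z. cid z \<le> C) \<and> (\<forall>z. cid z \<noteq> 0 \<longrightarrow> z \<in> verts L) \<and>
     (\<forall>i. 1 \<le> i \<and> i \<le> C \<longrightarrow> se i < m \<and>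
       (\<exists>zs. cycle_list nx pv ne zs \<and> set zs = {z. cid z = i} \<and> U (se i) \<in> set zs)) \<and>
     (\<forall>e\<in>L. \<forall>x\<in>ed e. \<forall>y\<in>ed e. cid x \<noteq> 0 \<longrightarrow> cid y \<noteq> 0) \<and>
     (\<forall>i\<in>L. i < j \<longrightarrow> cid (U i) \<noteq> 0)"

text \<open>The walk has passed \<open>zs\<close>, stands at \<open>z\<close> and is about to leave
  along \<open>e\<close>, which is not the edge it came by. Only \<open>zs ! 0\<close> may be met
  again. The functions with index 0 are the arrays before the walk; they describe everything outside
  it.\<close>

definition path_inv :: "nat set \<Rightarrow> nat \<Rightarrow> nat \<Rightarrow> (nat \<Rightarrow> nat) \<Rightarrow> (nat \<Rightarrow> nat) \<Rightarrow> (nat \<Rightarrow> nat) \<Rightarrow> (nat \<Rightarrow> nat)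
    \<Rightarrow> nat list \<Rightarrow> nat \<Rightarrow> nat
    \<Rightarrow> (nat \<Rightarrow> nat) \<Rightarrow> (nat \<Rightarrow> nat) \<Rightarrow> (nat \<Rightarrow> nat) \<Rightarrow> (nat \<Rightarrow> nat) \<Rightarrow> bool" where
  "path_inv L C z0 nx0 pv0 ne0 cid0 zs z e nx pv ne cid \<longleftrightarrow>
     distinct zs \<and> (\<forall>x\<in>set zs. cid0 x = 0 \<and> x \<in> verts L) \<and> e \<in> L \<and> z \<in> ed e
     \<and> z \<notin> set (tl zs) \<and> cid0 z = 0
     \<and> cid = (\<lambda>y. if y \<in> set zs then C else cid0 y)
     \<and> (\<forall>k < length zs. nx (zs ! k) = (zs @ [z]) ! Suc k \<and> pv ((zs @ [z]) ! Suc k) = zs ! k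
          \<and> ne (zs ! k) \<in> L \<and> ed (ne (zs ! k)) = {zs ! k, (zs @ [z]) ! Suc k})
     \<and> (\<forall>k. Suc k < length zs \<longrightarrow> ne (zs ! k) \<noteq> ne (zs ! Suc k))
     \<and> (zs = [] \<longrightarrow> z = z0) \<and> (zs \<noteq> [] \<longrightarrow> zs ! 0 = z0 \<and> e \<noteq> ne (last zs))
     \<and> (\<forall>y. y \<notin> set zs \<longrightarrow> nx y = nx0 y \<and> ne y = ne0 y)
     \<and> (\<forall>y. y \<notin> set (tl (zs @ [z])) \<longrightarrow> pv y = pv0 y)"

text \<open>The next vertex \<open>w\<close> cannot lie on the walk after its start: both edges of
  such a vertex have been used, so \<open>e\<close> would be one of them. Then \<open>z\<close>
  would already be on the walk, or the walk would go back along the edge it came by.\<close>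

lemma path_step:
  assumes core: "core L"
    and closed: "\<forall>e\<in>L. \<forall>x\<in>ed e. \<forall>y\<in>ed e. cid0 x \<noteq> 0 \<longrightarrow> cid0 y \<noteq> 0"
    and inv: "path_inv L C z0 nx0 pv0 ne0 cid0 zs z e nx pv ne cid"
    and cidz: "cid z = 0" and C: "C \<noteq> 0"
  defines "w \<equiv> U e + V e - z"
  shows "path_inv L C z0 nx0 pv0 ne0 cid0 (zs @ [z]) w (\<Sum>(inc L w) - e)
    (nx(z := w)) (pv(w := z)) (ne(z := e)) (cid(z := C))" and "z \<in> verts L"
proof -
  have dist: "distinct zs" and old: "\<And>x. x \<in> set zs \<Longrightarrow> cid0 x = 0 \<and> x \<in> verts L"
    and eL: "e \<in> L" and ze: "z \<in> ed e" and ztl: "z \<notin> set (tl zs)" and cid0z: "cid0 z = 0"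
    and cid: "cid = (\<lambda>y. if y \<in> set zs then C else cid0 y)"
    and adj: "\<And>k. k < length zs \<Longrightarrow> nx (zs ! k) = (zs @ [z]) ! Suc k \<and> pv ((zs @ [z]) ! Suc k) = zs ! k
          \<and> ne (zs ! k) \<in> L \<and> ed (ne (zs ! k)) = {zs ! k, (zs @ [z]) ! Suc k}"
    and ne_ne: "\<And>k. Suc k < length zs \<Longrightarrow> ne (zs ! k) \<noteq> ne (zs ! Suc k)"
    and first: "zs = [] \<Longrightarrow> z = z0" "zs \<noteq> [] \<Longrightarrow> zs ! 0 = z0 \<and> e \<noteq> ne (last zs)"
    and frame: "\<And>y. y \<notin> set zs \<Longrightarrow> nx y = nx0 y \<and> ne y = ne0 y"
      "\<And>y. y \<notin> set (tl (zs @ [z])) \<Longrightarrow> pv y = pv0 y"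
    using inv unfolding path_inv_def by blast+
  show zv: "z \<in> verts L" using eL ze by (auto simp: verts_def)
  have Lm: "L \<subseteq> {..<m}" using core by (simp add: core_def)
  have zzs: "z \<notin> set zs" using cidz cid C by auto
  have em: "e < m" using Lm eL by auto
  have ed: "ed e = {z, w}" using ed_other[OF ze] by (simp add: w_def)
  have wz: "w \<noteq> z" using ed_other_ne[OF em ze] by (simp add: w_def)
  have cid0w: "cid0 w = 0" using closed eL ed cid0z by auto
  have wv: "w \<in> verts L" using eL ed by (auto simp: verts_def)
  have wtl: "w \<notin> set (tl zs)"
  proof
    assume "w \<in> set (tl zs)"
    then obtain i' where "i' < length (tl zs)" "w = tl zs ! i'"
      by (metis in_set_conv_nth)
    then obtain i where i: "Suc i < length zs" "w = zs ! Suc i"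
      by (cases zs) auto
    have "ne (zs ! i) \<in> inc L w" "ne (zs ! Suc i) \<in> inc L w"
      using adj[of i] adj[of "Suc i"] i by (auto simp: inc_def nth_append)
    then have "inc L w = {ne (zs ! i), ne (zs ! Suc i)}"
      using ne_ne[OF i(1)] core_inc[OF core wv] card_2_eq by metis
    moreover have "e \<in> inc L w" using eL ed by (auto simp: inc_def)
    ultimately consider "e = ne (zs ! i)" | "e = ne (zs ! Suc i)" by blast
    then show False
    proof cases
      case 1
      then have "z \<in> {zs ! i, (zs @ [z]) ! Suc i}" using adj[of i] i ed by auto
      then show ?thesis using i zzs by (auto simp: nth_append)
    next
      case 2
      then have "z \<in> {zs ! Suc i, (zs @ [z]) ! Suc (Suc i)}" using adj[of "Suc i"] i ed by auto
      then have "\<not> Suc (Suc i) < length zs" using i zzs by (auto simp: nth_append)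
      then have "zs ! Suc i = last zs" using i
        by (metis Suc_lessI diff_Suc_1 last_conv_nth length_0_conv not_less_zero)
      moreover have "zs \<noteq> []" using i by auto
      ultimately show ?thesis using first(2) 2 i by auto
    qed
  qed
  have "e \<in> inc L w" using eL ed by (auto simp: inc_def)
  moreover from this have "card (inc L w - {e}) = 1"
    using core_inc[OF core wv] by simp
  then obtain e' where "inc L w - {e} = {e'}" by (rule card_1_singletonE)
  ultimately have e': "inc L w = {e, e'}" "e' \<noteq> e" by auto
  have sum: "\<Sum>(inc L w) - e = e'" using e' by simp
  have e'L: "e' \<in> L" "w \<in> ed e'" using e' by (auto simp: inc_def)
  have wtl': "w \<notin> set (tl (zs @ [z]))" using wtl wz by (cases zs) auto
  have adj': "(nx(z := w)) ((zs @ [z]) ! k) = ((zs @ [z]) @ [w]) ! Suc k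
      \<and> (pv(w := z)) (((zs @ [z]) @ [w]) ! Suc k) = (zs @ [z]) ! k
      \<and> (ne(z := e)) ((zs @ [z]) ! k) \<in> L
      \<and> ed ((ne(z := e)) ((zs @ [z]) ! k)) = {(zs @ [z]) ! k, ((zs @ [z]) @ [w]) ! Suc k}"
    if k: "k < length (zs @ [z])" for k
  proof (cases "k = length zs")
    case True
    then show ?thesis using eL ed by (simp add: nth_append)
  next
    case False
    then have k': "k < length zs" using k by simp
    have "(zs @ [z]) ! Suc k \<in> set (tl (zs @ [z]))"
      using k' by (cases zs) (auto simp: nth_append)
    then have "(zs @ [z]) ! Suc k \<noteq> w" using wtl' by auto
    moreover have "zs ! k \<noteq> z" using k' zzs by auto
    moreover have "((zs @ [z]) @ [w]) ! Suc k = (zs @ [z]) ! Suc k"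
      using k' nth_append[of "zs @ [z]" "[w]" "Suc k"] by simp
    ultimately show ?thesis using adj[OF k'] k' by (simp add: nth_append)
  qed
  have ne_ne': "(ne(z := e)) ((zs @ [z]) ! k) \<noteq> (ne(z := e)) ((zs @ [z]) ! Suc k)"
    if k: "Suc k < length (zs @ [z])" for k
  proof (cases "Suc k = length zs")
    case True
    then have "zs \<noteq> []" "length zs - 1 = k" by auto
    then have "zs ! k = last zs" "zs \<noteq> []" using last_conv_nth[of zs] by auto
    then show ?thesis using True first(2) zzs k by (auto simp: nth_append)
  next
    case False
    then have "Suc k < length zs" using k by simp
    then show ?thesis using ne_ne[of k] zzs by (auto simp: nth_append)
  qed
  show "path_inv L C z0 nx0 pv0 ne0 cid0 (zs @ [z]) w (\<Sum>(inc L w) - e)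
    (nx(z := w)) (pv(w := z)) (ne(z := e)) (cid(z := C))"
    unfolding path_inv_def sum
  proof (intro conjI allI impI ballI)
    show "w \<notin> set (tl (zs @ [z]))" by (rule wtl')
    show "(cid(z := C)) = (\<lambda>y. if y \<in> set (zs @ [z]) then C else cid0 y)"
      using cid by auto
    show "(zs @ [z]) ! 0 = z0" using first by (cases zs) auto
    show "(pv(w := z)) y = pv0 y" if "y \<notin> set (tl ((zs @ [z]) @ [w]))" for y
      using that frame(2)[of y] by (cases zs) auto
  qed (use dist zzs old e'L cid0w cid0z zv e' adj' ne_ne' frame(1) in auto)
qed

text \<open>The numbered vertex reached can only be the start. Length 1 is excluded because edges
  have two ends, and length 2 because consecutive edges differ. The cycle uses both edges at each of
  its vertices, so no remaining edge leaves it.\<close>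

lemma path_closed:
  assumes core: "core L" and C: "C \<noteq> 0"
    and inv: "path_inv L C z0 nx0 pv0 ne0 cid0 zs z e nx pv ne cid" and cidz: "cid z \<noteq> 0"
  shows "cycle_list nx pv ne zs" "z0 \<in> set zs"
    and "\<And>e x y. e \<in> L \<Longrightarrow> x \<in> ed e \<Longrightarrow> y \<in> ed e \<Longrightarrow> x \<in> set zs \<Longrightarrow> y \<in> set zs"
    and "\<And>y. y \<notin> set zs \<Longrightarrow> nx y = nx0 y \<and> pv y = pv0 y \<and> ne y = ne0 y"
proof -
  let ?n = "length zs"
  have dist: "distinct zs" and old: "\<And>x. x \<in> set zs \<Longrightarrow> cid0 x = 0 \<and> x \<in> verts L"
    and ztl: "z \<notin> set (tl zs)" and cid0z: "cid0 z = 0"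
    and cid: "cid = (\<lambda>y. if y \<in> set zs then C else cid0 y)"
    and adj: "\<And>k. k < ?n \<Longrightarrow> nx (zs ! k) = (zs @ [z]) ! Suc k \<and> pv ((zs @ [z]) ! Suc k) = zs ! k
          \<and> ne (zs ! k) \<in> L \<and> ed (ne (zs ! k)) = {zs ! k, (zs @ [z]) ! Suc k}"
    and ne_ne: "\<And>k. Suc k < ?n \<Longrightarrow> ne (zs ! k) \<noteq> ne (zs ! Suc k)"
    and first: "zs \<noteq> [] \<Longrightarrow> zs ! 0 = z0"
    and frame: "\<And>y. y \<notin> set zs \<Longrightarrow> nx y = nx0 y \<and> ne y = ne0 y"
      "\<And>y. y \<notin> set (tl (zs @ [z])) \<Longrightarrow> pv y = pv0 y"
    using inv unfolding path_inv_def by blast+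
  have Lm: "L \<subseteq> {..<m}" using core by (simp add: core_def)
  have zzs: "z \<in> set zs" using cidz cid cid0z by (cases "z \<in> set zs") auto
  then have ne: "zs \<noteq> []" and z: "z = zs ! 0" using ztl by (cases zs; auto)+
  have n0: "0 < ?n" using ne by simp
  have next_eq: "(zs @ [z]) ! Suc k = zs ! (Suc k mod ?n)" if "k < ?n" for k
    using that z by (cases "Suc k = ?n") (auto simp: nth_append)
  show "z0 \<in> set zs" using zzs z first ne by auto
  have edk: "ne (zs ! k) \<in> L" "ne (zs ! k) < m" "ed (ne (zs ! k)) = {zs ! k, zs ! (Suc k mod ?n)}" if "k < ?n" for k
    using adj[OF that] next_eq[OF that] Lm by auto
  have n1: "?n \<noteq> 1"
  proof
    assume "?n = 1"
    then show False using edk[of 0] card_ed[of "ne (zs ! 0)"] by auto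
  qed
  have n2: "?n \<noteq> 2"
  proof
    assume n2: "?n = 2"
    then have "ed (ne (zs ! 0)) = ed (ne (zs ! Suc 0))"
      using edk(3)[of 0] edk(3)[of "Suc 0"] by (simp add: insert_commute One_nat_def)
    then show False using ne_ne[of 0] ed_cong[of "ne (zs ! 0)" "ne (zs ! Suc 0)"] edk(2) n2 by simp
  qed
  have n3: "3 \<le> ?n" using n0 n1 n2 by linarith
  show "cycle_list nx pv ne zs"
    unfolding cycle_list_def using dist n3 edk adj next_eq by auto
  show "y \<in> set zs" if e: "e \<in> L" "x \<in> ed e" "y \<in> ed e" "x \<in> set zs" for e x y
  proof -
    obtain i where i: "i < ?n" "x = zs ! i" using e(4) by (metis in_set_conv_nth)
    define i' where "i' = (if i = 0 then ?n - 1 else i - 1)"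
    have i': "i' < ?n" "Suc i' mod ?n = i" using i n3 by (auto simp: i'_def)
    \<comment> \<open>\<open>ne_ne\<close> covers only consecutive positions; at the start of the
      cycle the closing edge and the first edge are told apart by their ends.\<close>
    have ne': "ne (zs ! i') \<noteq> ne (zs ! i)"
    proof (cases "i = 0")
      case True
      have "ed (ne (zs ! i')) \<noteq> ed (ne (zs ! i))"
      proof
        assume "ed (ne (zs ! i')) = ed (ne (zs ! i))"
        then have "zs ! i' \<in> {zs ! i, zs ! (Suc i mod ?n)}" using edk(3)[OF i(1)] edk(3)[OF i'(1)] by auto
        moreover have "Suc i mod ?n = 1" using True n3 by simp
        ultimately have "i' = i \<or> i' = 1"
          using dist i i' n3 by (auto simp: nth_eq_iff_index_eq)
        then show False using True n3 by (auto simp: i'_def)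
      qed
      then show ?thesis by auto
    next
      case False
      then show ?thesis using ne_ne[of i'] i i'_def by simp
    qed
    have "x \<in> verts L" using e(1,2) by (auto simp: verts_def)
    moreover have "ne (zs ! i') \<in> inc L x" "ne (zs ! i) \<in> inc L x"
      using edk[OF i(1)] edk[OF i'(1)] i i' by (auto simp: inc_def)
    ultimately have "inc L x = {ne (zs ! i'), ne (zs ! i)}"
      using core_inc[OF core] card_2_eq ne' by metis
    moreover have "e \<in> inc L x" using e by (auto simp: inc_def)
    ultimately have "y \<in> ed (ne (zs ! i')) \<or> y \<in> ed (ne (zs ! i))" using e(3) by auto
    moreover have "Suc i mod ?n < ?n" using n0 by simp
    ultimately show ?thesis using edk(3)[OF i(1)] edk(3)[OF i'(1)] i' i by auto
  qed
  show "nx y = nx0 y \<and> pv y = pv0 y \<and> ne y = ne0 y" if "y \<notin> set zs" for y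
  proof -
    have "y \<notin> set (tl (zs @ [z]))" using that zzs by (cases zs) auto
    then show ?thesis using frame that by auto
  qed
qed

text \<open>Earlier cycles survive because the walk changes the arrays only at vertices that had no
  number, and the number \<open>C + 1\<close> is new because all others are at most
  \<open>C\<close>.\<close>

lemma traverse_new_cycle:
  assumes core: "core L" and inv: "traverse_inv L j C nx0 pv0 ne0 cid0 se" and j: "j \<in> L"
    and path: "path_inv L (C + 1) (U j) nx0 pv0 ne0 cid0 zs z e nx pv ne cid" and cidz: "cid z \<noteq> 0"
  shows "traverse_inv L (j + 1) (C + 1) nx pv ne cid (se(C + 1 := j))"
proof -
  have cid0: "\<And>z. cid0 z \<le> C" "\<And>z. cid0 z \<noteq> 0 \<Longrightarrow> z \<in> verts L"
    and cyc: "\<And>i. 1 \<le> i \<Longrightarrow> i \<le> C \<Longrightarrow> se i < m \<and>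
       (\<exists>zs. cycle_list nx0 pv0 ne0 zs \<and> set zs = {z. cid0 z = i} \<and> U (se i) \<in> set zs)"
    and closed: "\<And>e x y. e \<in> L \<Longrightarrow> x \<in> ed e \<Longrightarrow> y \<in> ed e \<Longrightarrow> cid0 x \<noteq> 0 \<Longrightarrow> cid0 y \<noteq> 0"
    and seen: "\<And>i. i \<in> L \<Longrightarrow> i < j \<Longrightarrow> cid0 (U i) \<noteq> 0"
    using inv unfolding traverse_inv_def by blast+
  have cid: "cid = (\<lambda>y. if y \<in> set zs then C + 1 else cid0 y)"
    and old: "\<And>x. x \<in> set zs \<Longrightarrow> cid0 x = 0 \<and> x \<in> verts L"
    using path unfolding path_inv_def by blast+
  note cl = path_closed[OF core _ path cidz, simplified]
  have jm: "j < m" using core j by (auto simp: core_def)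
  have "se' i < m \<and> (\<exists>zs. cycle_list nx pv ne zs \<and> set zs = {z. cid z = i} \<and> U (se' i) \<in> set zs)"
    if i: "1 \<le> i" "i \<le> C + 1" and se': "se' = se(C + 1 := j)" for i se'
  proof (cases "i = C + 1")
    case True
    have "\<And>y. cid0 y \<noteq> C + 1" using cid0(1) by (metis add_leD2 not_one_le_zero le_add_same_cancel1 le_antisym not_less_eq_eq Suc_eq_plus1)
    then have "set zs = {z. cid z = i}" using True cid by auto
    then show ?thesis using True cl(1,2) jm se' by auto
  next
    case False
    then have iC: "1 \<le> i" "i \<le> C" using i by auto
    obtain ys where ys: "cycle_list nx0 pv0 ne0 ys" "set ys = {z. cid0 z = i}" "U (se i) \<in> set ys"
      using cyc[OF iC] by blast
    have "set ys \<inter> set zs = {}" using ys(2) old iC by fastforce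
    moreover have "Suc k mod length ys < length ys" if "k < length ys" for k
      using that by (intro mod_less_divisor) linarith
    ultimately have "ys ! k \<notin> set zs" "ys ! (Suc k mod length ys) \<notin> set zs" if "k < length ys" for k
      using that by (meson disjoint_iff nth_mem)+
    then have "cycle_list nx pv ne ys"
      using ys(1) cl(4) unfolding cycle_list_def by auto
    moreover have "{z. cid z = i} = {z. cid0 z = i}"
      using cid old iC False by auto
    ultimately show ?thesis using ys cyc[OF iC] False se' by auto
  qed
  moreover have "cid y \<noteq> 0" if "e \<in> L" "x \<in> ed e" "y \<in> ed e" "cid x \<noteq> 0" for e x y
    using that closed[of e x y] cl(3)[of e x y] cid by (auto split: if_splits)
  moreover have "cid (U i) \<noteq> 0" if "i \<in> L" "i < j + 1" for i
    using that seen[of i] cl(2) cid by (auto simp: less_plus_1_iff)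
  moreover have "cid z \<le> C + 1" for z using cid0(1)[of z] cid by auto
  moreover have "z \<in> verts L" if "cid z \<noteq> 0" for z using that cid cid0(2) old by (auto split: if_splits)
  ultimately show ?thesis unfolding traverse_inv_def by blast
qed

end

section \<open>The traversal program and its amortised cost\<close>

definition walk_loop :: com where
  "walk_loop = While (Equal (Arr acid (Reg rz)) (Const 0)) (block [
     Set_Reg rw other_end,
     Set_Arr anx (Reg rz) (Reg rw),
     Set_Arr apv (Reg rw) (Reg rz),
     Set_Arr ane (Reg rz) (Reg re),
     Set_Arr acid (Reg rz) (Reg rC),
     Set_Reg re (Sub (Arr asum (Reg rw)) (Reg re)),
     Set_Reg rz (Reg rw)])"

definition traverse :: com where
  "traverse = block [
     Set_Reg rj (Const 0),
     Set_Reg rC (Const 0),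
     While (Less (Reg rj) (Reg rm)) (block [
       If (Conj (Equal (Arr apeel (Reg rj)) (Const 0)) (Equal (Arr acid (Arr aU (Reg rj))) (Const 0)))
         (block [
           Set_Reg rC (Add (Reg rC) (Const 1)),
           Set_Arr ase (Reg rC) (Reg rj),
           Set_Reg rz (Arr aU (Reg rj)),
           Set_Reg re (Reg rj),
           walk_loop])
         Skip,
       Set_Reg rj (Add (Reg rj) (Const 1))])]"

lemma (in machine) vc_walk_loop: "vc walk_loop Q s = wp walk_loop Q s"
  by (simp add: walk_loop_def)

context machine_graph
begin

definition unvisited :: "nat set \<Rightarrow> (nat \<Rightarrow> nat) \<Rightarrow> nat" where
  "unvisited L cid = card {z \<in> verts L. cid z = 0}"

lemma finite_verts: "L \<subseteq> {..<m} \<Longrightarrow> finite (verts L)"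
  unfolding verts_def using finite_subset[of L "{..<m}"] by (auto simp: ed_def)

lemma card_verts_le: "L \<subseteq> {..<m} \<Longrightarrow> card (verts L) \<le> 2 * m"
proof -
  assume L: "L \<subseteq> {..<m}"
  have "card (verts L) \<le> (\<Sum>j\<in>L. card (ed j))"
    unfolding verts_def using L finite_subset by (intro card_UN_le) auto
  also have "\<dots> = (\<Sum>j\<in>L. 2)" using L card_ed by (intro sum.cong) auto
  also have "\<dots> \<le> 2 * m" using card_mono[OF _ L] by simp
  finally show ?thesis .
qed

lemma unvisited_upd:
  assumes "L \<subseteq> {..<m}" "z \<in> verts L" "cid z = 0" "C \<noteq> 0"
  shows "unvisited L cid = unvisited L (cid(z := C)) + 1"
proof -
  have "{y \<in> verts L. cid y = 0} = insert z {y \<in> verts L. (cid(z := C)) y = 0}"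
    using assms by auto
  then show ?thesis using finite_verts[OF assms(1)] assms(4) by (simp add: unvisited_def)
qed

abbreviation (input) "traverse_arrays \<equiv> {anx, apv, ane, acid, ase}"

definition traverse_mem :: "nat set \<Rightarrow> state \<Rightarrow> state \<Rightarrow> bool" where
  "traverse_mem L s0 s \<longleftrightarrow> same_arrays traverse_arrays s0 s \<and> reg s rm = m \<and> arr s aU = U \<and> arr s aV = V
     \<and> arr s asum = (\<lambda>z. \<Sum>(inc L z)) \<and> L = {j. j < m \<and> arr s apeel j = 0}"

lemma wp_walk_loop:
  assumes core: "core L"
    and closed: "\<forall>e\<in>L. \<forall>x\<in>ed e. \<forall>y\<in>ed e. cid0 x \<noteq> 0 \<longrightarrow> cid0 y \<noteq> 0"
    and mem: "traverse_mem L s0 s" and C: "reg s rC = C" "C \<noteq> 0"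
    and start: "path_inv L C z0 nx0 pv0 ne0 cid0 [] (reg s rz) (reg s re) (arr s anx) (arr s apv) (arr s ane) (arr s acid)"
    and post: "\<And>t s' zs. traverse_mem L s0 s' \<Longrightarrow> reg s' rj = reg s rj \<Longrightarrow> reg s' rC = C \<Longrightarrow> arr s' ase = arr s ase \<Longrightarrow>
      path_inv L C z0 nx0 pv0 ne0 cid0 zs (reg s' rz) (reg s' re) (arr s' anx) (arr s' apv) (arr s' ane) (arr s' acid)
      \<Longrightarrow> arr s' acid (reg s' rz) \<noteq> 0 \<Longrightarrow>
      t + 50 * unvisited L (arr s' acid) \<le> 50 * unvisited L (arr s acid) + 10 \<Longrightarrow> Q t s'"
  shows "wp walk_loop Q s"
proof -
  let ?I = "\<lambda>s'. traverse_mem L s0 s' \<and> reg s' rj = reg s rj \<and> reg s' rC = C \<and> arr s' ase = arr s ase \<and>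
    (\<exists>zs. path_inv L C z0 nx0 pv0 ne0 cid0 zs (reg s' rz) (reg s' re) (arr s' anx) (arr s' apv) (arr s' ane) (arr s' acid))"
  let ?\<mu> = "\<lambda>s'. 50 * unvisited L (arr s' acid)"
  show ?thesis
    unfolding walk_loop_def
  proof (rule wp_While[where I = ?I and \<mu> = ?\<mu>])
    fix s1 assume I: "?I s1" and cond: "cond_val s1 (Equal (Arr acid (Reg rz)) (Const 0))"
    then obtain zs where path: "path_inv L C z0 nx0 pv0 ne0 cid0 zs (reg s1 rz) (reg s1 re)
      (arr s1 anx) (arr s1 apv) (arr s1 ane) (arr s1 acid)" by blast
    have c0: "arr s1 acid (reg s1 rz) = 0" using cond by simp
    note step = path_step[OF core closed path c0 C(2)]
    have Lm: "L \<subseteq> {..<m}" using core by (simp add: core_def)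
    note un = unvisited_upd[where cid = "arr s1 acid", OF Lm step(2) c0 C(2)]
    have s1: "arr s1 aU = U" "arr s1 aV = V" "reg s1 rC = C" "arr s1 asum = (\<lambda>z. \<Sum>(inc L z))"
      using I by (auto simp: traverse_mem_def)
    show "wp (block [
     Set_Reg rw other_end,
     Set_Arr anx (Reg rz) (Reg rw),
     Set_Arr apv (Reg rw) (Reg rz),
     Set_Arr ane (Reg rz) (Reg re),
     Set_Arr acid (Reg rz) (Reg rC),
     Set_Reg re (Sub (Arr asum (Reg rw)) (Reg re)),
     Set_Reg rz (Reg rw)])
      (\<lambda>t s'. ?I s' \<and> t + cond_time (Equal (Arr acid (Reg rz)) (Const 0)) + 1 + ?\<mu> s' \<le> ?\<mu> s1) s1"
      apply (rule vc_wp)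
      using I step(1) un
      apply (simp add: small_def s1 sum_ends_le)
      apply (intro conjI)
      subgoal by (auto simp: traverse_mem_def same_arrays_def)
      subgoal by blast
      done
  qed (use mem C start post in \<open>auto simp: small_def\<close>)
qed

lemma wp_traverse:
  assumes core: "core L" and mem: "traverse_mem L s s"
    and zero: "arr s acid = (\<lambda>_. 0)"
    and post: "\<And>t s'. traverse_mem L s s' \<Longrightarrow> reg s' rC \<le> m \<Longrightarrow>
      traverse_inv L m (reg s' rC) (arr s' anx) (arr s' apv) (arr s' ane) (arr s' acid) (arr s' ase) \<Longrightarrow>
      t \<le> 300 * m + 50 \<Longrightarrow> Q t s'"
  shows "wp traverse Q s"
proof -
  let ?I = "\<lambda>s1. traverse_mem L s s1 \<and> reg s1 rj \<le> m \<and> reg s1 rC \<le> reg s1 rj \<and>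
    traverse_inv L (reg s1 rj) (reg s1 rC) (arr s1 anx) (arr s1 apv) (arr s1 ane) (arr s1 acid) (arr s1 ase)"
  \<comment> \<open>Every step of a walk numbers a new vertex, so all walks together take at most
    one step per vertex.\<close>
  let ?\<mu> = "\<lambda>s1. 100 * (m - reg s1 rj) + 50 * unvisited L (arr s1 acid)"
  have Lm: "L \<subseteq> {..<m}" using core by (simp add: core_def)
  have mem_set: "traverse_mem L s (setr x v s1)" if "traverse_mem L s s1" "x \<ge> 3" for x v s1
    using that by (auto simp: traverse_mem_def same_arrays_def)
  have mem_seta: "traverse_mem L s (seta a i v s1)" if "traverse_mem L s s1" "a \<in> traverse_arrays" for a i v s1
    using that by (auto simp: traverse_mem_def same_arrays_def)
  have body: "wp (block [
       If (Conj (Equal (Arr apeel (Reg rj)) (Const 0)) (Equal (Arr acid (Arr aU (Reg rj))) (Const 0)))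
         (block [
           Set_Reg rC (Add (Reg rC) (Const 1)),
           Set_Arr ase (Reg rC) (Reg rj),
           Set_Reg rz (Arr aU (Reg rj)),
           Set_Reg re (Reg rj),
           walk_loop])
         Skip,
       Set_Reg rj (Add (Reg rj) (Const 1))])
     (\<lambda>t s'. ?I s' \<and> t + cond_time (Less (Reg rj) (Reg rm)) + 1 + ?\<mu> s' \<le> ?\<mu> s1) s1"
    if I: "?I s1" and cond: "cond_val s1 (Less (Reg rj) (Reg rm))" for s1
  proof -
    define j where "j = reg s1 rj"
    define C where "C = reg s1 rC"
    have m1: "reg s1 rm = m" "arr s1 aU = U" "arr s1 aV = V" and L: "L = {j. j < m \<and> arr s1 apeel j = 0}"
      using I by (auto simp: traverse_mem_def)
    have j: "j < m" "C \<le> j" using cond m1 I by (auto simp: j_def C_def)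
    have inv: "traverse_inv L j C (arr s1 anx) (arr s1 apv) (arr s1 ane) (arr s1 acid) (arr s1 ase)"
      using I by (simp add: j_def C_def)
    have closed: "\<forall>e\<in>L. \<forall>x\<in>ed e. \<forall>y\<in>ed e. arr s1 acid x \<noteq> 0 \<longrightarrow> arr s1 acid y \<noteq> 0"
      using inv unfolding traverse_inv_def by blast
    have skip: "traverse_inv L (j + 1) C (arr s1 anx) (arr s1 apv) (arr s1 ane) (arr s1 acid) (arr s1 ase)"
      if "\<not> (arr s1 apeel j = 0 \<and> arr s1 acid (U j) = 0)"
      using inv that L unfolding traverse_inv_def by (auto simp: less_plus_1_iff)
    show ?thesis
      apply (rule vc_wp)
      apply (simp add: small_def m1 j_def[symmetric] C_def[symmetric] vc_walk_loop)
      apply (intro conjI impI)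
      subgoal using j m_le by simp
      subgoal premises p
      proof -
        have jL: "j \<in> L" using p j L by simp
        show ?thesis
          apply (rule wp_walk_loop[OF core closed, where ?s0.0 = s and C = "C + 1" and ?z0.0 = "U j"
                and ?nx0.0 = "arr s1 anx" and ?pv0.0 = "arr s1 apv" and ?ne0.0 = "arr s1 ane"])
          subgoal using I by (intro mem_set mem_seta) auto
          subgoal by simp
          subgoal by simp
          subgoal using jL p by (auto simp: path_inv_def ed_def)
          subgoal premises q for t s2 zs
          proof -
            have "traverse_inv L (j + 1) (C + 1) (arr s2 anx) (arr s2 apv) (arr s2 ane) (arr s2 acid) (arr s2 ase)"
              using traverse_new_cycle[OF core inv jL q(5,6)] q(4) by simp
            then show ?thesis using q j m_le mem_set[OF q(1), of rj "j + 1"]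
              by (simp add: small_def j_def[symmetric])
          qed
          done
      qed
      apply (use j m_le I mem_set[of s1 rj "j + 1"] skip in \<open>auto simp: j_def[symmetric] C_def[symmetric]\<close>)
      done
  qed
  show ?thesis
    unfolding traverse_def
    apply (rule vc_wp)
    apply (simp add: small_def)
    apply (rule wp_While[where I = ?I and \<mu> = ?\<mu>, OF _ _ body[unfolded block.simps]])
    subgoal using mem_set[OF mem_set[OF mem]] zero by (auto simp: traverse_inv_def)
    subgoal by (simp add: small_def)
    subgoal by simp
    subgoal by simp
    subgoal premises prems for t s1
    proof -
      have "reg s1 rj = m" using prems by (auto simp: traverse_mem_def)
      moreover have "unvisited L (arr s acid) \<le> 2 * m"
        using zero card_verts_le[OF Lm] by (simp add: unvisited_def)
      ultimately show ?thesis using prems by (auto intro!: post)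
    qed
    done
qed

end

section \<open>Forests made of paths, and edges between components\<close>

definition tip :: "(nat \<Rightarrow> nat) \<Rightarrow> nat \<Rightarrow> nat" where
  "tip mt x = (if mt x = 0 then x else mt x)"

text \<open>
  The components of \<open>X\<close> are paths, \<open>I\<close> contains their inner vertices, and \<open>tip mt\<close> exchanges the two
  ends of each path; isolated vertices are stored as \<open>mt x = 0\<close>.
\<close>

definition path_forest :: "nat set set \<Rightarrow> nat set \<Rightarrow> (nat \<Rightarrow> nat) \<Rightarrow> bool" where
  "path_forest X I mt \<longleftrightarrow> forest X
     \<and> (\<forall>u v. u \<notin> I \<and> v \<notin> I \<and> (u, v) \<in> conn X \<longrightarrow> v = u \<or> v = tip mt u)
     \<and> (\<forall>u. u \<notin> I \<longrightarrow> tip mt u \<notin> I \<and> (u, tip mt u) \<in> conn X \<and> tip mt (tip mt u) = u)"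

lemma forest_empty [simp]: "forest {}"
proof -
  have "cycle_edges xs \<noteq> {}" if "3 \<le> length xs" for xs :: "'a list"
    using that nth_cycle_edges[of 0 xs] by force
  then show ?thesis by (auto simp: forest_def is_cycle_def)
qed

lemma conn_empty [simp]: "(u, v) \<in> conn {} \<longleftrightarrow> u = v"
  by (auto simp: conn_def)

lemma path_forest_empty: "path_forest {} {} (\<lambda>_. 0)"
  by (simp add: path_forest_def tip_def)

text \<open>The far ends of the two joined paths become partners. An isolated \<open>a\<close> is
  its own tip and remains an end; otherwise \<open>a\<close> turns into an inner vertex, and its
  stale entry in \<open>mt\<close> no longer matters. The same holds for \<open>b\<close>.\<close>

lemma path_forest_join:
  assumes pf: "path_forest X I mt" and ab: "a \<notin> I" "b \<notin> I" "a \<noteq> b" "tip mt a \<noteq> b" "a \<noteq> 0" "b \<noteq> 0"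
  shows "path_forest (insert {a, b} X) (I \<union> ({a, b} - {tip mt a, tip mt b}))
    (mt(tip mt a := tip mt b, tip mt b := tip mt a))"
proof -
  define ea where "ea = tip mt a"
  define eb where "eb = tip mt b"
  define mt' where "mt' = mt(ea := eb, eb := ea)"
  define I' where "I' = I \<union> ({a, b} - {ea, eb})"
  have fX: "forest X"
    and ends: "\<And>u v. u \<notin> I \<Longrightarrow> v \<notin> I \<Longrightarrow> (u, v) \<in> conn X \<Longrightarrow> v = u \<or> v = tip mt u"
    and tip: "\<And>u. u \<notin> I \<Longrightarrow> tip mt u \<notin> I \<and> (u, tip mt u) \<in> conn X \<and> tip mt (tip mt u) = u"
    using pf unfolding path_forest_def by blast+
  have ea: "ea \<notin> I" "tip mt ea = a" "(a, ea) \<in> conn X" using tip[OF ab(1)] by (auto simp: ea_def)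
  have eb: "eb \<notin> I" "tip mt eb = b" "(b, eb) \<in> conn X" using tip[OF ab(2)] by (auto simp: eb_def)
  have ne: "ea \<noteq> eb" "ea \<noteq> b" "eb \<noteq> a" using ea eb ab by (auto simp: ea_def)
  have pos: "ea \<noteq> 0" "eb \<noteq> 0" using ab by (auto simp: ea_def eb_def tip_def)
  have tip': "tip mt' u = (if u = ea then eb else if u = eb then ea else tip mt u)" for u
    using pos ne by (auto simp: mt'_def tip_def)
  have "(a, b) \<notin> conn X" using ends[OF ab(1,2)] ab(3,4) by blast
  then have "forest (insert {a, b} X)" by (intro forest_insert fX)
  moreover have "v = u \<or> v = tip mt' u"
    if uv: "u \<notin> I'" "v \<notin> I'" "(u, v) \<in> conn (insert {a, b} X)" for u v
  proof -
    have I: "u \<notin> I" "v \<notin> I" using uv by (auto simp: I'_def)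
    have end_a: "w = ea" if "w \<notin> I'" "(w, a) \<in> conn X" for w
      using ends[of a w] ab(1) conn_sym[OF that(2)] that(1) ne by (auto simp: I'_def ea_def)
    have end_b: "w = eb" if "w \<notin> I'" "(b, w) \<in> conn X" for w
      using ends[of b w] ab(2) that ne by (auto simp: I'_def eb_def)
    from conn_insert[OF uv(3)] consider "(u, v) \<in> conn X" | "(u, a) \<in> conn X" "(b, v) \<in> conn X"
      | "(u, b) \<in> conn X" "(a, v) \<in> conn X" by blast
    then show ?thesis
    proof cases
      case 1
      then have "v = u \<or> v = tip mt u" using ends I by blast
      moreover have "tip mt u = u" if "u = ea" "v = tip mt u"
        using that uv(2) ea(2) ne by (auto simp: I'_def)
      moreover have "tip mt u = u" if "u = eb" "v = tip mt u"
        using that uv(2) eb(2) ne by (auto simp: I'_def)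
      ultimately show ?thesis by (auto simp: tip')
    next
      case 2
      then show ?thesis using end_a[of u] end_b[of v] uv by (simp add: tip')
    next
      case 3
      then show ?thesis using end_a[of v] end_b[of u] uv conn_sym by (metis tip' ne(1))
    qed
  qed
  moreover have "tip mt' u \<notin> I' \<and> (u, tip mt' u) \<in> conn (insert {a, b} X) \<and> tip mt' (tip mt' u) = u"
    if u: "u \<notin> I'" for u
  proof -
    have mono: "\<And>x y. (x, y) \<in> conn X \<Longrightarrow> (x, y) \<in> conn (insert {a, b} X)"
      using conn_mono[of X "insert {a, b} X"] by blast
    have ab': "(a, b) \<in> conn (insert {a, b} X)" by (intro conn_edge) auto
    have path: "(ea, eb) \<in> conn (insert {a, b} X)"
      using mono[OF ea(3)] mono[OF eb(3)] ab' conn_sym conn_trans by metis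
    have I': "ea \<notin> I'" "eb \<notin> I'" using ea eb by (auto simp: I'_def)
    show ?thesis
    proof (cases "u = ea \<or> u = eb")
      case True
      then show ?thesis using path I' ne conn_sym by (auto simp: tip')
    next
      case False
      have uI: "u \<notin> I" using u by (auto simp: I'_def)
      have "tip mt u \<noteq> ea" "tip mt u \<noteq> eb"
        using tip[OF uI] u False ea(2) eb(2) by (auto simp: I'_def)
      moreover have "tip mt u \<noteq> a" "tip mt u \<noteq> b"
        using tip[OF uI] False by (auto simp: ea_def eb_def)
      ultimately show ?thesis using tip[OF uI] mono False by (auto simp: tip' I'_def)
    qed
  qed
  ultimately show ?thesis
    unfolding path_forest_def I'_def[symmetric] mt'_def[symmetric] ea_def[symmetric] eb_def[symmetric]
    by blast
qed

text \<open>The quantifier over all forests \<open>F\<close> is needed because the edges that will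
  finally be deleted from \<open>E\<close> are not yet known when an edge is moved.\<close>

definition safe :: "'a set set \<Rightarrow> 'a set set \<Rightarrow> bool" where
  "safe E M \<longleftrightarrow> (\<forall>F \<subseteq> E. forest F \<longrightarrow> forest (F \<union> M))"

lemma safe_empty [simp]: "safe E {}"
  by (simp add: safe_def)

text \<open>No earlier edge of \<open>M\<close> touches the component of \<open>y\<close> in
  \<open>E\<close>. So the component of \<open>y\<close> in \<open>F\<close> together with
  \<open>M\<close> stays inside it, and \<open>x\<close> lies outside.\<close>

lemma safe_insert:
  assumes safe: "safe E M" and xy: "(x, y) \<notin> conn E"
    and fresh: "\<And>e v. e \<in> M \<Longrightarrow> v \<in> e \<Longrightarrow> (v, y) \<notin> conn E"
  shows "safe E (insert {x, y} M)"
  unfolding safe_def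
proof (intro allI impI)
  fix F assume F: "F \<subseteq> E" "forest F"
  let ?S = "{v. (v, y) \<in> conn E}"
  have "(x, y) \<notin> conn (F \<union> M)"
  proof
    assume "(x, y) \<in> conn (F \<union> M)"
    then have "(y, x) \<in> conn (F \<union> M)" by (rule conn_sym)
    then have "x \<in> ?S"
    proof (rule conn_closed)
      fix u v assume uv: "{u, v} \<in> F \<union> M" "u \<in> ?S"
      then have "{u, v} \<in> F" using fresh[of "{u, v}" u] by auto
      then have "(v, u) \<in> conn E" using F conn_edge[of v u E] by (auto simp: insert_commute)
      then show "v \<in> ?S" using uv conn_trans[of v u E y] by simp
    qed simp
    then show False using xy by simp
  qed
  then have "forest (insert {x, y} (F \<union> M))"
    using safe F by (intro forest_insert) (auto simp: safe_def)
  then show "forest (F \<union> insert {x, y} M)" by simp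
qed


section \<open>The cycles of an edge set with at most one cycle per component\<close>

locale cycle_structure = indexed_graph m U V
  for m :: nat and U V :: "nat \<Rightarrow> nat" +
  fixes L :: "nat set" and C :: nat and nx pv ne cid se :: "nat \<Rightarrow> nat"
  assumes core: "core L" and traversed: "traverse_inv L m C nx pv ne cid se"
begin

definition orbit :: "nat \<Rightarrow> nat set" where
  "orbit z = {y. cid y = cid z}"

lemma cid_le: "cid z \<le> C"
  using traversed by (auto simp: traverse_inv_def)

lemma orbit_list:
  assumes "cid z \<noteq> 0"
  obtains zs where "cycle_list nx pv ne zs" "set zs = orbit z"
  using traversed assms cid_le[of z] unfolding traverse_inv_def orbit_def
  by (metis One_nat_def Suc_leI bot_nat_0.not_eq_extremum)

lemma se_orbit:
  assumes "1 \<le> i" "i \<le> C"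
  shows "se i < m" "cid (U (se i)) = i"
  using traversed assms unfolding traverse_inv_def by blast+

lemma orbit_nth:
  assumes "cid z \<noteq> 0"
  obtains zs k where "cycle_list nx pv ne zs" "set zs = orbit z" "k < length zs" "z = zs ! k"
proof -
  obtain zs where zs: "cycle_list nx pv ne zs" "set zs = orbit z" using orbit_list[OF assms] .
  moreover have "z \<in> set zs" using zs by (simp add: orbit_def)
  ultimately show ?thesis using that by (metis in_set_conv_nth)
qed

lemma cycle_listD:
  assumes "cycle_list nx pv ne zs" "k < length zs"
  shows "nx (zs ! k) = zs ! (Suc k mod length zs)" "pv (zs ! (Suc k mod length zs)) = zs ! k"
    "ne (zs ! k) < m" "ed (ne (zs ! k)) = {zs ! k, zs ! (Suc k mod length zs)}"
    "distinct zs" "3 \<le> length zs"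
  using assms unfolding cycle_list_def by blast+

lemma funpow_nx:
  assumes zs: "cycle_list nx pv ne zs" and k: "k < length zs"
  shows "(nx ^^ i) (zs ! k) = zs ! ((k + i) mod length zs)"
proof (induction i)
  case (Suc i)
  have "(k + i) mod length zs < length zs" using k by (intro mod_less_divisor) linarith
  then show ?case using Suc cycle_listD(1)[OF zs, of "(k + i) mod length zs"]
    by (simp add: mod_Suc_eq)
qed (use k in simp)

lemma nx_facts:
  assumes "cid z \<noteq> 0"
  shows "cid (nx z) = cid z" "pv (nx z) = z" "nx z \<noteq> z" "nx (nx z) \<noteq> z" "ne z < m" "ed (ne z) = {z, nx z}"
proof -
  obtain zs k where zs: "cycle_list nx pv ne zs" "set zs = orbit z" and k: "k < length zs" "z = zs ! k"
    using orbit_nth[OF assms] .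
  note cl = cycle_listD[OF zs(1)]
  have n: "3 \<le> length zs" using cl(6)[OF k(1)] .
  have k': "Suc k mod length zs < length zs" using n by (intro mod_less_divisor) linarith
  have nx: "nx z = zs ! (Suc k mod length zs)" using cl(1)[OF k(1)] k by simp
  then have "nx z \<in> orbit z" using zs(2) k' nth_mem by metis
  then show "cid (nx z) = cid z" by (simp add: orbit_def)
  show "pv (nx z) = z" using nx cl(2)[OF k(1)] k by simp
  show "ne z < m" "ed (ne z) = {z, nx z}" using cl(3,4)[OF k(1)] k nx by auto
  have nxnx: "nx (nx z) = zs ! (Suc (Suc k mod length zs) mod length zs)"
    using nx cl(1)[OF k'] by simp
  have k'': "Suc (Suc k mod length zs) mod length zs < length zs"
    using n by (intro mod_less_divisor) linarith
  have "Suc k mod length zs \<noteq> k" "Suc (Suc k mod length zs) mod length zs \<noteq> k"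
    using k(1) n by (auto simp: mod_Suc)
  then show "nx z \<noteq> z" "nx (nx z) \<noteq> z"
    using nx nxnx k k' k'' nth_eq_iff_index_eq[OF cl(5)[OF k(1)]] by metis+
qed

lemma pv_facts:
  assumes "cid z \<noteq> 0"
  shows "cid (pv z) = cid z" "nx (pv z) = z"
proof -
  obtain zs k where zs: "cycle_list nx pv ne zs" "set zs = orbit z" and k: "k < length zs" "z = zs ! k"
    using orbit_nth[OF assms] .
  note cl = cycle_listD[OF zs(1)]
  define k' where "k' = (if k = 0 then length zs - 1 else k - 1)"
  have n: "3 \<le> length zs" using cl(6)[OF k(1)] .
  have k': "k' < length zs" "Suc k' mod length zs = k" using n k by (auto simp: k'_def)
  then have "pv z = zs ! k'" using cl(2)[OF k'(1)] k by simp
  moreover have "zs ! k' \<in> orbit z" using zs(2) k'(1) nth_mem by blast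
  ultimately show "cid (pv z) = cid z" "nx (pv z) = z"
    using cl(1)[OF k'(1)] k' k by (auto simp: orbit_def)
qed

lemma pv_ne_nx: "cid z \<noteq> 0 \<Longrightarrow> pv z \<noteq> nx z"
  using nx_facts(4)[of "pv z"] pv_facts[of z] by auto

lemma pv_ne: "cid z \<noteq> 0 \<Longrightarrow> pv z \<noteq> z"
  using nx_facts(3)[of "pv z"] pv_facts[of z] by auto

text \<open>Otherwise \<open>z\<close> and \<open>w\<close> would be successors of each other on a
  cycle of length 2.\<close>

lemma ne_inj: "cid z \<noteq> 0 \<Longrightarrow> cid w \<noteq> 0 \<Longrightarrow> ne z = ne w \<Longrightarrow> z = w"
  using nx_facts(4,6)[of z] nx_facts(6)[of w] by (auto simp: doubleton_eq_iff)

lemma nx_inj: "cid z \<noteq> 0 \<Longrightarrow> cid w \<noteq> 0 \<Longrightarrow> nx z = nx w \<Longrightarrow> z = w"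
  using nx_facts(2) by metis

lemma orbit_cycle:
  assumes "cid z \<noteq> 0"
  shows "(nx ^^ card (orbit z)) z = z" "3 \<le> card (orbit z)" "finite (orbit z)"
    "\<And>i. 0 < i \<Longrightarrow> i < card (orbit z) \<Longrightarrow> (nx ^^ i) z \<noteq> z"
    "\<And>y. cid y = cid z \<Longrightarrow> \<exists>i < card (orbit z). y = (nx ^^ i) z"
proof -
  obtain zs k where zs: "cycle_list nx pv ne zs" "set zs = orbit z" and k: "k < length zs" "z = zs ! k"
    using orbit_nth[OF assms] .
  let ?n = "length zs"
  note cl = cycle_listD[OF zs(1) k(1)]
  have n: "card (orbit z) = ?n" using cl zs(2) distinct_card by metis
  have pow: "(nx ^^ i) z = zs ! ((k + i) mod ?n)" for i using funpow_nx[OF zs(1) k(1)] k by simp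
  show "(nx ^^ card (orbit z)) z = z" using pow n k by simp
  show "3 \<le> card (orbit z)" using n cl by simp
  show "finite (orbit z)" using zs(2) by (metis finite_set)
  show "(nx ^^ i) z \<noteq> z" if "0 < i" "i < card (orbit z)" for i
  proof -
    have "(k + i) mod ?n \<noteq> k"
    proof (cases "k + i < ?n")
      case False
      then have "(k + i) mod ?n = k + i - ?n" using that n k by (simp add: le_mod_geq)
      then show ?thesis using that n k False by linarith
    qed (use that in simp)
    moreover have "(k + i) mod ?n < ?n" using k by (intro mod_less_divisor) linarith
    ultimately show ?thesis using pow k nth_eq_iff_index_eq[OF cl(5)] by metis
  qed
  show "\<exists>i < card (orbit z). y = (nx ^^ i) z" if "cid y = cid z" for y
  proof -
    have "y \<in> set zs" using that zs(2) by (simp add: orbit_def)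
    then obtain l where l: "l < ?n" "y = zs ! l" by (metis in_set_conv_nth)
    define i where "i = (if k \<le> l then l - k else l + ?n - k)"
    have "i < ?n" "(k + i) mod ?n = l" using l k by (auto simp: i_def)
    then show ?thesis using pow l n by auto
  qed
qed

lemma cid_funpow: "cid z \<noteq> 0 \<Longrightarrow> cid ((nx ^^ i) z) = cid z"
  by (induction i) (simp_all add: nx_facts)

lemma orbit_is_cycle:
  assumes zs: "cycle_list nx pv ne zs"
  shows "is_cycle all_edges (cycle_edges zs)"
  unfolding is_cycle_def
proof (intro exI conjI)
  have n: "0 < length zs" "distinct zs" "3 \<le> length zs" using zs by (auto simp: cycle_list_def)
  then show "distinct zs" "3 \<le> length zs" by auto
  show "cycle_edges zs \<subseteq> all_edges"
  proof
    fix e assume "e \<in> cycle_edges zs"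
    then obtain k where "k < length zs" "e = {zs ! k, zs ! (Suc k mod length zs)}"
      by (auto simp: cycle_edges_def)
    then have "e = ed (ne (zs ! k))" "ne (zs ! k) < m" using cycle_listD[OF zs] by auto
    then show "e \<in> all_edges" by (auto simp: all_edges_def)
  qed
qed simp

text \<open>A component has only one cycle. In contrapositive form, vertices on different cycles lie
  in different components, which is what makes moving edges possible.\<close>

lemma conn_imp_same_cid:
  assumes "cid z \<noteq> 0" "cid w \<noteq> 0" "(z, w) \<in> conn all_edges"
  shows "cid z = cid w"
proof -
  obtain zs where zs: "cycle_list nx pv ne zs" "set zs = orbit z" using orbit_list[OF assms(1)] .
  obtain ws where ws: "cycle_list nx pv ne ws" "set ws = orbit w" using orbit_list[OF assms(2)] .
  have "cycle_edges zs = cycle_edges ws"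
    using unicyclicD[OF unicyclic_all_edges orbit_is_cycle[OF zs(1)] orbit_is_cycle[OF ws(1)] _ _ assms(3)]
      zs(2) ws(2) by (auto simp: Union_cycle_edges orbit_def)
  then have "orbit z = orbit w" using zs ws Union_cycle_edges by metis
  then show ?thesis by (auto simp: orbit_def)
qed

text \<open>Peeling destroys no cycle, and every remaining edge meets a traversed cycle. By
  uniqueness, each cycle of the graph is therefore one of the traversed ones.\<close>

lemma forest_missing_edges:
  assumes F: "F \<subseteq> all_edges"
    and miss: "\<And>z. cid z \<noteq> 0 \<Longrightarrow> \<exists>y. cid y = cid z \<and> ed (ne y) \<notin> F"
  shows "forest F"
  unfolding forest_def
proof
  assume "\<exists>D. is_cycle F D"
  then obtain D where D: "is_cycle F D" by blast
  have D': "is_cycle all_edges D" using is_cycle_mono[OF D F] .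
  obtain e where e: "e \<in> D" "e \<in> F" using is_cycle_edge_exists[OF D] .
  have "D \<subseteq> ed ` L" using core D' by (auto simp: core_def)
  then obtain j where j: "j \<in> L" "e = ed j" using e by auto
  have z: "cid (U j) \<noteq> 0"
    using traversed core j unfolding traverse_inv_def core_def by blast
  obtain zs where zs: "cycle_list nx pv ne zs" "set zs = orbit (U j)" using orbit_list[OF z] .
  have "D = cycle_edges zs"
    using unicyclicD[OF unicyclic_all_edges D' orbit_is_cycle[OF zs(1)], of "U j" "U j"] zs(2) e j
    by (auto simp: Union_cycle_edges orbit_def ed_def)
  moreover obtain y where y: "cid y = cid (U j)" "ed (ne y) \<notin> F" using miss[OF z] by blast
  moreover have "ed (ne y) \<in> cycle_edges zs"
  proof -
    have "y \<in> set zs" using y zs(2) by (simp add: orbit_def)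
    then obtain k where "k < length zs" "y = zs ! k" by (metis in_set_conv_nth)
    then show ?thesis using cycle_listD(4)[OF zs(1)] nth_cycle_edges[of k zs] by auto
  qed
  ultimately show False using D by (auto simp: is_cycle_def)
qed

end

section \<open>Breaking all cycles of two pseudoforests\<close>

text \<open>
  \<open>z\<close> ranges over the vertices of all pseudoforests, colours 0, 1, 2 number the three pseudoforests of
  a triple, \<open>xv\<close> maps the copies of a vertex in one triple to a common name, and \<open>opp\<close> exchanges the
  copies of colours 0 and 1.
\<close>

locale triple_structure = cycle_structure m U V L C nx pv ne cid se
  for m U V L C nx pv ne cid se +
  fixes opp xv col :: "nat \<Rightarrow> nat"
  assumes cid_0: "cid 0 = 0"
    and opp: "cid z \<noteq> 0 \<Longrightarrow> col z < 2 \<Longrightarrow> cid (opp z) \<noteq> 0 \<Longrightarrow>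
        col (opp z) < 2 \<and> opp (opp z) = z \<and> xv (opp z) = xv z \<and> cid (opp z) \<noteq> cid z"
    and xv_eq: "cid z \<noteq> 0 \<Longrightarrow> cid w \<noteq> 0 \<Longrightarrow> col z < 2 \<Longrightarrow> col w < 2 \<Longrightarrow> xv z = xv w \<Longrightarrow> w = z \<or> w = opp z"
    and xv_pos: "cid z \<noteq> 0 \<Longrightarrow> xv z \<noteq> 0"
    and col_cid: "cid z \<noteq> 0 \<Longrightarrow> cid z = cid w \<Longrightarrow> col z = col w"
    and opp_nx: "cid z \<noteq> 0 \<Longrightarrow> col z < 2 \<Longrightarrow> cid (opp z) \<noteq> 0 \<Longrightarrow> cid (opp (nx z)) \<noteq> 0 \<Longrightarrow>
        opp (nx z) \<noteq> nx (opp z) \<and> opp (nx z) \<noteq> pv (opp z)"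
    and xv_eq2: "cid z \<noteq> 0 \<Longrightarrow> cid w \<noteq> 0 \<Longrightarrow> \<not> col z < 2 \<Longrightarrow> \<not> col w < 2 \<Longrightarrow> xv z = xv w \<Longrightarrow> w = z"
begin

definition main :: "nat \<Rightarrow> bool" where
  "main z \<longleftrightarrow> cid z \<noteq> 0 \<and> col z < 2"

definition fin :: "(nat \<Rightarrow> nat) \<Rightarrow> nat \<Rightarrow> bool" where
  "fin dn z \<longleftrightarrow> dn (cid z) \<noteq> 0"

definition xedges :: "nat set \<Rightarrow> nat set set" where
  "xedges S = (\<lambda>j. {xv (U j), xv (V j)}) ` S"

definition moved :: "nat set \<Rightarrow> nat set set" where
  "moved S = (\<lambda>j. {opp (U j), opp (V j)}) ` S"

lemma edge_image: "ed j = {w, w'} \<Longrightarrow> {g (U j), g (V j)} = {g w, g w'}"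
  by (auto simp: ed_def doubleton_eq_iff)

text \<open>\<open>SX\<close> are the edges put into the extra forests and \<open>SM\<close> those
  moved between colours 0 and 1. Number 0, which stands for no cycle, counts as broken, so that
  \<open>fin\<close> needs no case distinction.\<close>

definition static_inv :: "(nat \<Rightarrow> nat) \<Rightarrow> (nat \<Rightarrow> nat) \<Rightarrow> nat set \<Rightarrow> nat set \<Rightarrow> nat set \<Rightarrow> bool" where
  "static_inv dn mt I SX SM \<longleftrightarrow> dn 0 \<noteq> 0
     \<and> (\<forall>j \<in> SX \<union> SM. \<exists>y. j = ne y \<and> cid y \<noteq> 0 \<and> fin dn y)
     \<and> (\<forall>j \<in> SM. cid (opp (U j)) \<noteq> 0 \<and> cid (opp (V j)) \<noteq> 0 \<and> (\<exists>y. j = ne y \<and> main y))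
     \<and> (\<forall>y. cid y \<noteq> 0 \<and> fin dn y \<longrightarrow> (\<exists>y'. cid y' = cid y \<and> ne y' \<in> SX \<union> SM))
     \<and> path_forest (xedges SX) I mt \<and> safe all_edges (moved SM)"

lemma fin_upd: "fin (dn(cid y := 1)) x \<longleftrightarrow> fin dn x \<or> cid x = cid y"
  by (simp add: fin_def)

lemma main_cid: "main z \<Longrightarrow> cid w = cid z \<Longrightarrow> main w"
  using col_cid[of z w] unfolding main_def by metis

lemma main_opp: "main z \<Longrightarrow> cid (opp z) \<noteq> 0 \<Longrightarrow> main (opp z)"
  using opp by (auto simp: main_def)

lemma opp_opp: "main z \<Longrightarrow> cid (opp z) \<noteq> 0 \<Longrightarrow> opp (opp z) = z"
  using opp by (auto simp: main_def)

lemma xv_opp: "main z \<Longrightarrow> cid (opp z) \<noteq> 0 \<Longrightarrow> xv (opp z) = xv z"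
  using opp by (auto simp: main_def)

lemma cid_opp_ne: "main z \<Longrightarrow> cid (opp z) \<noteq> cid z"
  using opp[of z] unfolding main_def by metis

lemma xv_mainD: "main z \<Longrightarrow> main w \<Longrightarrow> xv z = xv w \<Longrightarrow> w = z \<or> w = opp z"
  using xv_eq by (auto simp: main_def)

lemma xv_ne: "main w \<Longrightarrow> cid w' = cid w \<Longrightarrow> w \<noteq> w' \<Longrightarrow> xv w \<noteq> xv w'"
  using xv_mainD[of w w'] main_cid[of w w'] cid_opp_ne[of w] by auto

lemma static_inv_select:
  assumes inv: "static_inv dn mt I SX SM"
    and y: "cid y \<noteq> 0" and e: "ed (ne y) = {w, w'}"
    and w: "xv w \<notin> I" "xv w' \<notin> I" "xv w \<noteq> xv w'" "tip mt (xv w) \<noteq> xv w'" "xv w \<noteq> 0" "xv w' \<noteq> 0"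
  shows "static_inv (dn(cid y := 1)) (mt(tip mt (xv w) := tip mt (xv w'), tip mt (xv w') := tip mt (xv w)))
    (I \<union> ({xv w, xv w'} - {tip mt (xv w), tip mt (xv w')})) (insert (ne y) SX) SM"
proof -
  have "xedges (insert (ne y) SX) = insert {xv w, xv w'} (xedges SX)"
    using edge_image[OF e, of xv] by (simp add: xedges_def)
  moreover have "path_forest (xedges SX) I mt" using inv by (simp add: static_inv_def)
  ultimately have "path_forest (xedges (insert (ne y) SX)) (I \<union> ({xv w, xv w'} - {tip mt (xv w), tip mt (xv w')}))
      (mt(tip mt (xv w) := tip mt (xv w'), tip mt (xv w') := tip mt (xv w)))"
    using path_forest_join w by simp
  then show ?thesis
    using inv y unfolding static_inv_def fin_upd by auto
qed

lemma static_inv_move: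
  assumes inv: "static_inv dn mt I SX SM"
    and y: "main y" "\<not> fin dn y" and e: "ed (ne y) = {p, q}"
    and cid: "cid (opp p) \<noteq> 0" "cid (opp q) \<noteq> 0" "cid (opp p) \<noteq> cid (opp q)"
    and fresh: "\<And>j v. j \<in> SM \<Longrightarrow> v = opp (U j) \<or> v = opp (V j) \<Longrightarrow> cid v \<noteq> cid (opp q)"
  shows "static_inv (dn(cid y := 1)) mt I SX (insert (ne y) SM)"
proof -
  have mv: "moved (insert (ne y) SM) = insert {opp p, opp q} (moved SM)"
    using edge_image[OF e, of opp] by (simp add: moved_def)
  have ends: "{opp (U (ne y)), opp (V (ne y))} = {opp p, opp q}"
    using edge_image[OF e, of opp] .
  have safe: "safe all_edges (moved SM)" using inv by (simp add: static_inv_def)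
  have SM: "\<And>j. j \<in> SM \<Longrightarrow> cid (opp (U j)) \<noteq> 0 \<and> cid (opp (V j)) \<noteq> 0"
    using inv by (auto simp: static_inv_def)
  have "safe all_edges (moved (insert (ne y) SM))"
    unfolding mv
  proof (rule safe_insert[OF safe])
    show "(opp p, opp q) \<notin> conn all_edges" using conn_imp_same_cid cid by blast
    show "(v, opp q) \<notin> conn all_edges" if v: "e \<in> moved SM" "v \<in> e" for e v
    proof -
      obtain j where j: "j \<in> SM" "v = opp (U j) \<or> v = opp (V j)" using v by (auto simp: moved_def)
      then have "cid v \<noteq> 0" using SM by auto
      then show ?thesis using conn_imp_same_cid cid(2) fresh[OF j] by blast
    qed
  qed
  moreover have "cid (opp (U (ne y))) \<noteq> 0 \<and> cid (opp (V (ne y))) \<noteq> 0"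
    using ends cid by (metis doubleton_eq_iff)
  moreover have "cid y \<noteq> 0" using y by (simp add: main_def)
  ultimately show ?thesis
    using inv y unfolding static_inv_def fin_upd by auto
qed

text \<open>
  \<open>fin dn y\<close> holds if the cycle of \<open>y\<close> is broken or if there is no such cycle (\<open>cid y = 0\<close>).
  The vertex \<open>z\<close> lies on the cycle to be broken next. If \<open>cm = 1\<close>, it is the only vertex on an
  unbroken cycle that is covered by an edge of the extra forest; its other copy lies on a broken
  cycle. An unbroken cycle contains ends of moved edges only if it contains \<open>pd\<close>, or \<open>z\<close> with
  \<open>cm = 0\<close>; \<open>pd\<close> is uncovered and its other copy lies on a broken cycle.
\<close>

definition chain_inv :: "(nat \<Rightarrow> nat) \<Rightarrow> (nat \<Rightarrow> nat) \<Rightarrow> nat set \<Rightarrow> nat \<Rightarrow> nat \<Rightarrow> nat \<Rightarrow> bool" where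
  "chain_inv dn mt SM z cm pd \<longleftrightarrow> cm < 2
     \<and> (\<forall>y. main y \<and> \<not> fin dn y \<longrightarrow> mt (xv y) = 0 \<or> cm = 1 \<and> y = z)
     \<and> (\<not> fin dn z \<longrightarrow> main z \<and> (cm = 1 \<longrightarrow> cid (opp z) \<noteq> 0 \<and> fin dn (opp z) \<and> mt (xv z) \<noteq> 0)
          \<and> (cm = 0 \<longrightarrow> fin dn (opp z) \<or> fin dn pd))
     \<and> (\<not> fin dn pd \<longrightarrow> main pd \<and> cid (opp pd) \<noteq> 0 \<and> fin dn (opp pd) \<and> mt (xv pd) = 0)
     \<and> (\<forall>j \<in> SM. \<forall>v. v = opp (U j) \<or> v = opp (V j) \<longrightarrow>
          fin dn v \<or> cid v = cid pd \<or> cm = 0 \<and> cid v = cid z)"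

text \<open>At the end of a chain the pending cycle comes next. Its vertex \<open>pd\<close> is
  uncovered and has its other copy on a broken cycle, as \<open>cm = 0\<close> demands; that ends of
  moved edges may lie on this cycle is allowed too.\<close>

lemma chain_inv_restart:
  assumes "chain_inv dn mt SM z cm pd" "fin dn z"
  shows "chain_inv dn mt SM pd 0 pd"
proof -
  have cover: "mt (xv y) = 0" if "main y" "\<not> fin dn y" for y
    using assms that unfolding chain_inv_def by blast
  have ends: "fin dn v \<or> cid v = cid pd" if "j \<in> SM" "v = opp (U j) \<or> v = opp (V j)" for j v
    using assms that unfolding chain_inv_def fin_def by metis
  have pend: "\<not> fin dn pd \<longrightarrow> main pd \<and> cid (opp pd) \<noteq> 0 \<and> fin dn (opp pd) \<and> mt (xv pd) = 0"
    using assms unfolding chain_inv_def by blast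
  show ?thesis
    unfolding chain_inv_def using cover ends pend by (intro conjI) (blast | simp)+
qed

text \<open>With nothing pending, all ends of moved edges and all covered vertices are on broken
  cycles or on none, so a chain may start anywhere in colours 0 and 1.\<close>

lemma chain_inv_start:
  assumes "chain_inv dn mt SM z cm pd" "fin dn z" "fin dn pd" "col z' < 2" "dn 0 \<noteq> 0"
  shows "chain_inv dn mt SM z' 0 pd"
proof -
  have "main z'" if "\<not> fin dn z'"
    using that assms(4,5) by (auto simp: fin_def main_def) (metis gr0I)
  moreover have cover: "mt (xv y) = 0" if "main y" "\<not> fin dn y" for y
    using assms that unfolding chain_inv_def by blast
  moreover have ends: "fin dn v" if "j \<in> SM" "v = opp (U j) \<or> v = opp (V j)" for j v
    using assms that unfolding chain_inv_def fin_def by metis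
  ultimately show ?thesis
    unfolding chain_inv_def using assms(3) by (intro conjI) (blast | simp)+
qed

section \<open>Breaking the next cycle: selecting an edge, moving an edge, breaking two
  cycles\<close>

lemma not_fin_cid: "static_inv dn mt I SX SM \<Longrightarrow> \<not> fin dn z \<Longrightarrow> cid z \<noteq> 0"
  unfolding static_inv_def fin_def by metis

lemma fin_cid: "cid y = cid z \<Longrightarrow> fin dn y = fin dn z"
  by (simp add: fin_def)

text \<open>Covering \<open>w\<close> does no harm, because its other copy lies on no unbroken
  cycle. Only \<open>opp w'\<close> can become a covered vertex of an unbroken cycle, so it
  continues the chain. Both ends were uncovered, so the extra forest stays a matching and has no
  inner vertices.\<close>

lemma select_step:
  assumes st: "static_inv dn mt {} SX SM" and ch: "chain_inv dn mt SM z cm pd" and z: "\<not> fin dn z"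
    and w: "cid w = cid z" "cid w' = cid z" "w \<noteq> w'" and y: "cid y = cid z" "ed (ne y) = {w, w'}"
    and free: "fin dn (opp w)" and unc: "cm = 1 \<Longrightarrow> w \<noteq> z" "cm = 1 \<Longrightarrow> w' \<noteq> z"
  defines "dn' \<equiv> dn(cid z := 1)" and "mt' \<equiv> mt(xv w := xv w', xv w' := xv w)"
  shows "static_inv dn' mt' {} (insert (ne y) SX) SM" "chain_inv dn' mt' SM (opp w') 1 pd"
proof -
  have cm: "cm < 2"
    and cover: "\<And>y. main y \<Longrightarrow> \<not> fin dn y \<Longrightarrow> mt (xv y) = 0 \<or> cm = 1 \<and> y = z"
    and pend: "\<not> fin dn pd \<Longrightarrow> main pd \<and> cid (opp pd) \<noteq> 0 \<and> fin dn (opp pd) \<and> mt (xv pd) = 0"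
    and ends: "\<And>j v. j \<in> SM \<Longrightarrow> v = opp (U j) \<or> v = opp (V j) \<Longrightarrow>
          fin dn v \<or> cid v = cid pd \<or> cm = 0 \<and> cid v = cid z"
    and mz: "main z"
    using ch z unfolding chain_inv_def by blast+
  have mw: "main w" "main w'" using mz w main_cid by blast+
  have nw: "\<not> fin dn w" "\<not> fin dn w'" using z w fin_cid by blast+
  have un: "mt (xv w) = 0" "mt (xv w') = 0" using cover mw nw unc by blast+
  have tip: "tip mt (xv w) = xv w" "tip mt (xv w') = xv w'" using un by (simp_all add: tip_def)
  have xne: "xv w \<noteq> xv w'" using xv_ne mw w by metis
  have pos: "xv w \<noteq> 0" "xv w' \<noteq> 0" using xv_pos mw by (auto simp: main_def)
  have cy: "cid y \<noteq> 0" "\<not> fin dn y" using mz y(1) z fin_cid[of y z dn] by (simp_all add: main_def)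
  show "static_inv dn' mt' {} (insert (ne y) SX) SM"
    using static_inv_select[OF st cy(1) y(2), unfolded tip] xne pos y(1) by (simp add: dn'_def mt'_def)
  have fin': "fin dn' x \<longleftrightarrow> fin dn x \<or> cid x = cid z" for x
    by (simp add: dn'_def fin_upd)
  have cov': "x = opp w' \<or> mt (xv x) = mt' (xv x)" if x: "main x" "\<not> fin dn' x" for x
  proof (cases "xv x = xv w \<or> xv x = xv w'")
    case True
    then have "x = w \<or> x = opp w \<or> x = w' \<or> x = opp w'" using xv_mainD mw x(1) by metis
    then show ?thesis using x(2) w free by (auto simp: fin')
  qed (simp add: mt'_def)
  show "chain_inv dn' mt' SM (opp w') 1 pd"
    unfolding chain_inv_def
  proof (intro conjI allI impI ballI; (elim conjE)?)
    fix x assume x: "main x" "\<not> fin dn' x"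
    show "mt' (xv x) = 0 \<or> 1 = (1 :: nat) \<and> x = opp w'"
      using cov'[OF x] cover[OF x(1)] x(2) by (auto simp: fin')
  next
    assume nf: "\<not> fin dn' (opp w')"
    have c: "cid (opp w') \<noteq> 0" using nf st by (metis fin' not_fin_cid)
    show "main (opp w')" using main_opp[OF mw(2) c] .
    show "cid (opp (opp w')) \<noteq> 0" using opp_opp[OF mw(2) c] mw by (simp add: main_def)
    show "fin dn' (opp (opp w'))" using opp_opp[OF mw(2) c] w by (simp add: fin')
    show "mt' (xv (opp w')) \<noteq> 0" using xv_opp[OF mw(2) c] pos by (simp add: mt'_def)
  next
    assume nf: "\<not> fin dn' pd"
    then have p: "main pd" "cid (opp pd) \<noteq> 0" "fin dn (opp pd)" "mt (xv pd) = 0"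
      using pend by (auto simp: fin')
    then show "main pd" "cid (opp pd) \<noteq> 0" "fin dn' (opp pd)" by (auto simp: fin')
    \<comment> \<open>The other copy of \<open>pd\<close> lies on a broken cycle, while that of
      \<open>opp w'\<close> is \<open>w'\<close>, whose cycle was unbroken until now; so
      \<open>pd\<close> stays uncovered.\<close>
    have "pd \<noteq> opp w'"
    proof
      assume eq: "pd = opp w'"
      then have "cid (opp w') \<noteq> 0" using p(1) by (simp add: main_def)
      then show False using opp_opp[OF mw(2)] eq p(3) nw by simp
    qed
    then show "mt' (xv pd) = 0" using cov'[OF p(1) nf] p(4) by auto
  next
    fix j v assume "j \<in> SM" "v = opp (U j) \<or> v = opp (V j)"
    then show "fin dn' v \<or> cid v = cid pd \<or> 1 = (0 :: nat) \<and> cid v = cid (opp w')"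
      using ends by (auto simp: fin')
  qed simp_all
qed

text \<open>The fresh end is \<open>opp q\<close>: its cycle is unbroken, is not the pending one,
  and is not that of \<open>z\<close>, since two copies never share a cycle. The end
  \<open>opp p\<close> may lie on the pending cycle or on a broken one, where ends of moved edges
  are allowed. If \<open>cm = 0\<close>, nothing was pending and \<open>opp z\<close> takes that
  place.\<close>

lemma move_step:
  assumes st: "static_inv dn mt I SX SM" and ch: "chain_inv dn mt SM z cm pd" and z: "\<not> fin dn z"
    and pd': "cm = 1 \<Longrightarrow> pd' = pd" "cm = 0 \<Longrightarrow> fin dn pd \<and> \<not> fin dn (opp z) \<and> pd' = opp z"
    and p: "cid p = cid z" "q = nx p" "cid (opp p) \<noteq> 0" "fin dn (opp p) \<or> cid (opp p) = cid pd'"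
    and q: "\<not> fin dn (opp q)" "cid (opp q) \<noteq> cid pd'"
  shows "static_inv (dn(cid z := 1)) mt I SX (insert (ne p) SM)"
    "chain_inv (dn(cid z := 1)) mt (insert (ne p) SM) (opp q) 0 pd'"
proof -
  have cm: "cm = 0 \<or> cm = 1"
    and cover: "\<And>y. main y \<Longrightarrow> \<not> fin dn y \<Longrightarrow> mt (xv y) = 0 \<or> cm = 1 \<and> y = z"
    and pend: "\<not> fin dn pd \<Longrightarrow> main pd \<and> cid (opp pd) \<noteq> 0 \<and> fin dn (opp pd) \<and> mt (xv pd) = 0"
    and ends: "\<And>j v. j \<in> SM \<Longrightarrow> v = opp (U j) \<or> v = opp (V j) \<Longrightarrow>
          fin dn v \<or> cid v = cid pd \<or> cm = 0 \<and> cid v = cid z"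
    and mz: "main z"
    using ch z unfolding chain_inv_def by (auto simp: less_2_cases_iff)
  have mp: "main p" using mz p main_cid by blast
  have cp: "cid p \<noteq> 0" using mp by (simp add: main_def)
  have cq: "cid q = cid z" using nx_facts(1)[OF cp] p by simp
  have mq: "main q" using mz cq main_cid by blast
  have coq: "cid (opp q) \<noteq> 0" using not_fin_cid[OF st q(1)] .
  have ed: "ed (ne p) = {p, q}" using nx_facts(6)[OF cp] p(2) by simp
  have pf: "\<not> fin dn p" using z p fin_cid by blast
  have fin_ne: "cid v \<noteq> cid (opp q)" if "fin dn v" for v
    using that q(1) fin_cid by metis
  have oq_ne: "cid (opp q) \<noteq> cid z" using cid_opp_ne[OF mq] cq by simp
  have fresh: "cid v \<noteq> cid (opp q)" if "j \<in> SM" "v = opp (U j) \<or> v = opp (V j)" for j v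
    using ends[OF that] cm fin_ne oq_ne q pd' by metis
  have "cid (opp p) \<noteq> cid (opp q)" using p(4) fin_ne q(2) by metis
  then show "static_inv (dn(cid z := 1)) mt I SX (insert (ne p) SM)"
    using static_inv_move[OF st mp pf ed p(3) coq _ fresh] p(1) by simp
  have fin': "fin (dn(cid z := 1)) x \<longleftrightarrow> fin dn x \<or> cid x = cid z" for x
    by (simp add: fin_upd)
  have eqs: "{opp (U (ne p)), opp (V (ne p))} = {opp p, opp q}" using edge_image[OF ed] .
  show "chain_inv (dn(cid z := 1)) mt (insert (ne p) SM) (opp q) 0 pd'"
    unfolding chain_inv_def fin'
  proof (intro conjI allI impI ballI; (elim conjE)?)
    fix x assume "main x" "\<not> (fin dn x \<or> cid x = cid z)"
    then show "mt (xv x) = 0 \<or> 0 = (1 :: nat) \<and> x = opp q" using cover by blast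
  next
    show "main (opp q)" using main_opp mq coq by blast
    have "cid (opp (opp q)) = cid z" using opp_opp[OF mq coq] cq by simp
    then show "(fin dn (opp (opp q)) \<or> cid (opp (opp q)) = cid z) \<or> fin dn pd' \<or> cid pd' = cid z" by blast
  next
    assume nf: "\<not> (fin dn pd' \<or> cid pd' = cid z)"
    have "main pd' \<and> cid (opp pd') \<noteq> 0 \<and> (fin dn (opp pd') \<or> cid (opp pd') = cid z) \<and> mt (xv pd') = 0"
    proof (cases "cm = 1")
      case True
      then show ?thesis using pend nf pd'(1) by auto
    next
      case False
      then have eq: "pd' = opp z" "\<not> fin dn (opp z)" using cm pd'(2) by auto
      then have c: "cid (opp z) \<noteq> 0" using not_fin_cid[OF st] by blast
      then show ?thesis
        using eq main_opp[OF mz c] opp_opp[OF mz c] cover[of "opp z"] mz False by (auto simp: main_def)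
    qed
    then show "main pd'" "cid (opp pd') \<noteq> 0" "fin dn (opp pd') \<or> cid (opp pd') = cid z" "mt (xv pd') = 0"
      by blast+
  next
    fix j v assume j: "j \<in> insert (ne p) SM" and v: "v = opp (U j) \<or> v = opp (V j)"
    show "(fin dn v \<or> cid v = cid z) \<or> cid v = cid pd' \<or> 0 = (0 :: nat) \<and> cid v = cid (opp q)"
    proof (cases "j \<in> SM")
      case True
      then show ?thesis using ends[OF True v] cm pd' fin_cid by metis
    next
      case False
      then have "v \<in> {opp p, opp q}" using j v eqs by auto
      then show ?thesis using p(4) by auto
    qed
  qed simp_all
qed

text \<open>
  Here all vertices of the cycle of \<open>z\<close> except possibly \<open>z\<close> also lie on the cycle of \<open>pd'\<close>. Both
  cycles are broken at once.
\<close>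

lemma trapped_step:
  assumes st: "static_inv dn mt {} SX SM" and ch: "chain_inv dn mt SM z cm pd" and z: "\<not> fin dn z"
    and pd': "cm = 1 \<Longrightarrow> pd' = pd" "cm = 0 \<Longrightarrow> fin dn pd \<and> \<not> fin dn (opp z) \<and> pd' = opp z"
    and w: "w = nx z" "w' = nx w" "cid (opp w) = cid pd'" "cid (opp w') = cid pd'" "\<not> fin dn pd'"
    and d: "d = (if nx pd' = opp w \<or> nx pd' = opp w' then pv pd' else nx pd')"
    and y: "y = (if nx pd' = opp w \<or> nx pd' = opp w' then pv pd' else pd')"
  defines "dn' \<equiv> dn(cid z := 1, cid pd' := 1)"
    and "mt' \<equiv> mt(xv w := xv w', xv w' := xv w)"
  shows "d = opp w \<or> d = opp w' \<Longrightarrow> static_inv dn' mt' {} (insert (ne w) SX) (insert (ne y) SM)"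
    "d = opp w \<or> d = opp w' \<Longrightarrow> chain_inv dn' mt' (insert (ne y) SM) (opp d) 1 pd'"
    "\<not> (d = opp w \<or> d = opp w') \<Longrightarrow>
      static_inv dn' (mt'(xv pd' := xv d, xv d := xv pd')) {} (insert (ne y) (insert (ne w) SX)) SM"
    "\<not> (d = opp w \<or> d = opp w') \<Longrightarrow>
      chain_inv dn' (mt'(xv pd' := xv d, xv d := xv pd')) SM (opp d) 1 pd'"
    and "ne y \<notin> insert (ne w) SX"
proof -
  have cm: "cm = 0 \<or> cm = 1"
    and cover: "\<And>y. main y \<Longrightarrow> \<not> fin dn y \<Longrightarrow> mt (xv y) = 0 \<or> cm = 1 \<and> y = z"
    and pend: "\<not> fin dn pd \<Longrightarrow> main pd \<and> cid (opp pd) \<noteq> 0 \<and> fin dn (opp pd) \<and> mt (xv pd) = 0"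
    and ends: "\<And>j v. j \<in> SM \<Longrightarrow> v = opp (U j) \<or> v = opp (V j) \<Longrightarrow>
          fin dn v \<or> cid v = cid pd \<or> cm = 0 \<and> cid v = cid z"
    and mz: "main z"
    using ch z unfolding chain_inv_def by (auto simp: less_2_cases_iff)
  have cz: "cid z \<noteq> 0" using mz by (simp add: main_def)
  have cw: "cid w = cid z" "cid w' = cid z" "w \<noteq> z" "w' \<noteq> z" "w' \<noteq> w"
    using w nx_facts[OF cz] nx_facts(1,3)[of w] cz by auto
  have mw: "main w" "main w'" using mz cw main_cid by blast+
  have cp: "cid pd' \<noteq> 0" using not_fin_cid[OF st w(5)] .
  have cow: "cid (opp w) \<noteq> 0" "cid (opp w') \<noteq> 0" using w cp by auto
  have czp: "cid pd' \<noteq> cid z" using cid_opp_ne[OF mw(1)] w(3) cw by simp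
  have nw: "\<not> fin dn w" "\<not> fin dn w'" using z cw fin_cid by blast+
  have un: "mt (xv w) = 0" "mt (xv w') = 0" using cover mw nw cw by blast+
  \<comment> \<open>For \<open>cm = 1\<close> the vertex was pending before. For
    \<open>cm = 0\<close> it is the copy of \<open>z\<close>, so its own other copy lies on the
    cycle being broken now.\<close>
  have a: "main pd'" "cid (opp pd') \<noteq> 0" "fin dn (opp pd') \<or> opp pd' = z" "mt (xv pd') = 0"
  proof -
    have "main pd' \<and> cid (opp pd') \<noteq> 0 \<and> (fin dn (opp pd') \<or> opp pd' = z) \<and> mt (xv pd') = 0"
    proof (cases "cm = 1")
      case True
      then show ?thesis using pend w(5) pd'(1) by auto
    next
      case False
      then have eq: "pd' = opp z" "\<not> fin dn (opp z)" using cm pd'(2) by auto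
      then have c: "cid (opp z) \<noteq> 0" using not_fin_cid[OF st] by blast
      then show ?thesis
        using eq main_opp[OF mz c] opp_opp[OF mz c] cover[of "opp z"] mz False by (auto simp: main_def)
    qed
    then show "main pd'" "cid (opp pd') \<noteq> 0" "fin dn (opp pd') \<or> opp pd' = z" "mt (xv pd') = 0"
      by blast+
  qed
  have cd: "cid d = cid pd'" "d \<noteq> pd'"
    using d nx_facts(1,3)[OF cp] pv_facts(1)[OF cp] pv_ne[OF cp] by auto
  have cy: "cid y = cid pd'" using y pv_facts(1)[OF cp] by auto
  have edy: "ed (ne y) = {pd', d}"
    using d y nx_facts(6)[OF cp] nx_facts(6)[of "pv pd'"] pv_facts[OF cp] cp by auto
  have md: "main d" using a(1) cd main_cid by blast
  have my: "main y" using a(1) cy main_cid by blast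
  have tip: "tip mt (xv w) = xv w" "tip mt (xv w') = xv w'" using un by (simp_all add: tip_def)
  have xw: "xv w \<noteq> xv w'" "xv w \<noteq> 0" "xv w' \<noteq> 0"
    using xv_ne[OF mw(1)] cw xv_pos mw by (auto simp: main_def)
  have cw0: "cid w \<noteq> 0" using mw by (simp add: main_def)
  have edw: "ed (ne w) = {w, w'}" using nx_facts(6)[OF cw0] w(2) by simp
  define dn1 where "dn1 = dn(cid z := 1)"
  have fin1: "fin dn1 x \<longleftrightarrow> fin dn x \<or> cid x = cid z" for x
    by (simp add: dn1_def fin_upd)
  have fin': "fin dn' x \<longleftrightarrow> fin dn x \<or> cid x = cid z \<or> cid x = cid pd'" for x
    by (simp add: dn'_def fin_def)
  have st1: "static_inv dn1 mt' {} (insert (ne w) SX) SM"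
    using static_inv_select[OF st cw0 edw, unfolded tip] xw cw by (simp add: dn1_def mt'_def)
  have yf: "\<not> fin dn1 y" using w(5) czp cy fin_cid[of y pd'] by (simp add: fin1)
  show "ne y \<notin> insert (ne w) SX"
  proof
    assume "ne y \<in> insert (ne w) SX"
    then obtain y' where "ne y = ne y'" "cid y' \<noteq> 0" "fin dn1 y'"
      using st1 unfolding static_inv_def by blast
    then show False using ne_inj[of y y'] cy cp yf by auto
  qed
  have dn': "dn' = dn1(cid y := 1)" using cy by (simp add: dn'_def dn1_def)
  have a_ne: "pd' \<noteq> opp w" "pd' \<noteq> opp w'"
    using a(3) opp_opp[OF mw(1) cow(1)] opp_opp[OF mw(2) cow(2)] nw cw(3,4) by metis+
  have cov1: "mt (xv x) = mt' (xv x)" if "main x" "\<not> fin dn1 x" "x \<noteq> opp w" "x \<noteq> opp w'" for x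
  proof (cases "xv x = xv w \<or> xv x = xv w'")
    case True
    then have "x = w \<or> x = opp w \<or> x = w' \<or> x = opp w'" using xv_mainD mw that(1) by metis
    then show ?thesis using that cw by (auto simp: fin1)
  qed (simp add: mt'_def)
  have pd_fin: "fin dn v \<or> cid v = cid pd'" if "cid v = cid pd" for v
    using that cm pd' fin_cid by metis
  have opp_a: "fin dn' (opp pd')" using a(3) by (auto simp: fin')
  {
    assume mv: "d = opp w \<or> d = opp w'"
    \<comment> \<open>For \<open>cm = 0\<close> the vertex \<open>pd'\<close> is
      \<open>opp z\<close>. By \<open>opp_nx\<close>, which reflects that parts share no edge,
      \<open>opp w\<close> is not one of its neighbours on the cycle. So at most one neighbour is
      \<open>opp w'\<close>, and \<open>d\<close> would be the other one.\<close>
    have "cm \<noteq> 0"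
    proof
      assume "cm = 0"
      then have eq: "pd' = opp z" using pd' by simp
      have "opp w \<noteq> nx pd' \<and> opp w \<noteq> pv pd'"
        using opp_nx[of z] cz mz cp cow(1) w(1) eq by (auto simp: main_def)
      moreover have "pv pd' \<noteq> nx pd'" using pv_ne_nx[OF cp] .
      ultimately show False using mv d by (auto split: if_splits)
    qed
    then have cm1: "cm = 1" "pd' = pd" using cm pd' by auto
    have opp_d: "opp d \<in> {w, w'}" using mv opp_opp[OF mw(1) cow(1)] opp_opp[OF mw(2) cow(2)] by auto
    then have cod: "cid (opp d) = cid z" using cw by auto
    have fa: "fin dn (opp pd')"
      using a(3) pend w(5) cm1 by blast
    \<comment> \<open>Both neighbours of \<open>pd'\<close> are copies of \<open>w\<close> and
      \<open>w'\<close>, so its edge is moved into the colour of \<open>z\<close>. The cycle of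
      \<open>z\<close> serves as the fresh component: for \<open>cm = 1\<close> no moved edge ends
      there.\<close>
    have "cid v \<noteq> cid (opp d)" if "j \<in> SM" "v = opp (U j) \<or> v = opp (V j)" for j v
      using ends[OF that] cm1 czp cod z fin_cid[of v z] by auto
    moreover have "cid (opp pd') \<noteq> cid (opp d)" using fa z cod fin_cid by metis
    ultimately have "static_inv (dn1(cid y := 1)) mt' {} (insert (ne w) SX) (insert (ne y) SM)"
      using static_inv_move[OF st1 my yf edy a(2)] cod cz by auto
    then show "static_inv dn' mt' {} (insert (ne w) SX) (insert (ne y) SM)" using dn' by simp
    have eqs: "{opp (U (ne y)), opp (V (ne y))} = {opp pd', opp d}" using edge_image[OF edy] .
    show "chain_inv dn' mt' (insert (ne y) SM) (opp d) 1 pd'"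
      unfolding chain_inv_def
    proof (intro conjI allI impI ballI; (elim conjE)?)
      fix x assume x: "main x" "\<not> fin dn' x"
      then have "x \<noteq> opp w" "x \<noteq> opp w'" "\<not> fin dn1 x" using w by (auto simp: fin' fin1)
      then show "mt' (xv x) = 0 \<or> 1 = (1 :: nat) \<and> x = opp d"
        using cov1[OF x(1)] cover[OF x(1)] x(2) by (auto simp: fin')
    next
      fix j v assume j: "j \<in> insert (ne y) SM" and v: "v = opp (U j) \<or> v = opp (V j)"
      show "fin dn' v \<or> cid v = cid pd' \<or> 1 = (0 :: nat) \<and> cid v = cid (opp d)"
      proof (cases "j \<in> SM")
        case True
        then show ?thesis using ends[OF True v] pd_fin by (auto simp: fin')
      next
        case False
        then have "v \<in> {opp pd', opp d}" using j v eqs by auto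
        then show ?thesis using opp_a cod by (auto simp: fin')
      qed
    qed (use cod in \<open>auto simp: fin'\<close>)
  next
    \<comment> \<open>Here \<open>pd'\<close> and \<open>d\<close> are both uncovered even after
      \<open>w\<close> and \<open>w'\<close> have been joined, so their edge can be selected as
      well.\<close>
    assume nmv: "\<not> (d = opp w \<or> d = opp w')"
    define mt2 where "mt2 = mt'(xv pd' := xv d, xv d := xv pd')"
    have pdf: "\<not> fin dn1 pd'" "\<not> fin dn1 d"
      using yf cy cd fin_cid[of y pd' dn1] fin_cid[of d pd' dn1] by auto
    have dz: "d \<noteq> z" using cd czp by auto
    have "mt (xv d) = 0" using cover[OF md] pdf(2) dz by (auto simp: fin1)
    then have un1: "mt' (xv pd') = 0" "mt' (xv d) = 0"
      using cov1[OF a(1) pdf(1) a_ne] cov1[OF md pdf(2)] nmv a(4) by auto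
    then have tip1: "tip mt' (xv pd') = xv pd'" "tip mt' (xv d) = xv d" by (simp_all add: tip_def)
    have xd: "xv pd' \<noteq> xv d" "xv pd' \<noteq> 0" "xv d \<noteq> 0"
      using xv_ne[OF a(1) cd(1)] cd(2) xv_pos a(1) md by (auto simp: main_def)
    have cy0: "cid y \<noteq> 0" using cy cp by simp
    show "static_inv dn' mt2 {} (insert (ne y) (insert (ne w) SX)) SM"
      using static_inv_select[OF st1 cy0 edy, unfolded tip1] xd dn' by (simp add: mt2_def)
    have cov2: "x = opp d \<or> mt (xv x) = mt2 (xv x)" if x: "main x" "\<not> fin dn' x" for x
    proof (cases "xv x = xv pd' \<or> xv x = xv d")
      case True
      then have "x = pd' \<or> x = opp pd' \<or> x = d \<or> x = opp d" using xv_mainD a(1) md x(1) by metis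
      then show ?thesis using x(2) cd opp_a by (auto simp: fin')
    next
      case False
      have "x \<noteq> opp w" "x \<noteq> opp w'" "\<not> fin dn1 x" using x w by (auto simp: fin' fin1)
      then show ?thesis using False cov1[OF x(1)] by (simp add: mt2_def)
    qed
    show "chain_inv dn' mt2 SM (opp d) 1 pd'"
      unfolding chain_inv_def
    proof (intro conjI allI impI ballI; (elim conjE)?)
      fix x assume x: "main x" "\<not> fin dn' x"
      show "mt2 (xv x) = 0 \<or> 1 = (1 :: nat) \<and> x = opp d"
        using cov2[OF x] cover[OF x(1)] x(2) by (auto simp: fin')
    next
      assume nf: "\<not> fin dn' (opp d)"
      have c: "cid (opp d) \<noteq> 0" using nf st by (metis fin' not_fin_cid)
      show "main (opp d)" using main_opp[OF md c] .
      show "cid (opp (opp d)) \<noteq> 0" using opp_opp[OF md c] md by (simp add: main_def)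
      show "fin dn' (opp (opp d))" using opp_opp[OF md c] cd by (simp add: fin')
      show "mt2 (xv (opp d)) \<noteq> 0" using xv_opp[OF md c] xd by (simp add: mt2_def)
    next
      fix j v assume "j \<in> SM" "v = opp (U j) \<or> v = opp (V j)"
      from ends[OF this] pd_fin[of v]
      show "fin dn' v \<or> cid v = cid pd' \<or> 1 = (0 :: nat) \<and> cid v = cid (opp d)"
        by (auto simp: fin')
    qed (auto simp: fin')
  }
qed

end

section \<open>Programs that choose the edges\<close>

abbreviation (input) "rcm \<equiv> 12 :: nat"
abbreviation (input) "rpd \<equiv> 13 :: nat"
abbreviation (input) "rv \<equiv> 14 :: nat"
abbreviation (input) "rp \<equiv> 15 :: nat"
abbreviation (input) "rq \<equiv> 16 :: nat"
abbreviation (input) "rd \<equiv> 17 :: nat"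

abbreviation (input) "acol \<equiv> 9 :: nat"
abbreviation (input) "ax4 \<equiv> 10 :: nat"
abbreviation (input) "aalt \<equiv> 11 :: nat"
abbreviation (input) "aopp \<equiv> 14 :: nat"
abbreviation (input) "axv \<equiv> 15 :: nat"
abbreviation (input) "adn \<equiv> 22 :: nat"
abbreviation (input) "amt \<equiv> 23 :: nat"

lemma funpow_one [simp]: "(f ^^ 1) x = f x" for f :: "'a \<Rightarrow> 'a"
  by (simp add: One_nat_def)

lemma funpow_plus_one [simp]: "(f ^^ (i + 1)) x = f ((f ^^ i) x)" for f :: "'a \<Rightarrow> 'a"
  by (simp flip: Suc_eq_plus1)

lemma setr_setr [simp]: "setr x v (setr x u s) = setr x v s"
  by (simp add: setr_def)

lemma setr_same: "reg s x = v \<Longrightarrow> setr x v s = s"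
  by (cases s) (auto simp: setr_def)

lemma setr_commute: "x \<noteq> y \<Longrightarrow> setr x v (setr y u s) = setr y u (setr x v s)"
  by (simp add: setr_def fun_upd_twist)

abbreviation (input) "unfin e \<equiv> Equal (Arr adn (Arr acid e)) (Const 0)"

definition scan_free :: com where
  "scan_free = While (Conj (Neg (Equal (Reg rw) (Reg rz))) (unfin (Arr aopp (Reg rw))))
     (Set_Reg rw (Arr anx (Reg rw)))"

definition scan_crossing :: com where
  "scan_crossing = While (Conj (Neg (Equal (Reg rq) (Reg rz)))
       (Equal (Arr acid (Arr aopp (Reg rq))) (Arr acid (Reg rpd))))
     (block [Set_Reg rp (Reg rq), Set_Reg rq (Arr anx (Reg rq))])"

text \<open>The neighbour \<open>z\<close> is avoided because it may be the covered vertex of the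
  cycle; on a cycle of length at least 3 the predecessor of \<open>w\<close> is then another
  vertex.\<close>

definition select_edge :: com where
  "select_edge = block [
     Set_Reg rv (Arr anx (Reg rw)),
     Set_Reg re (Arr ane (Reg rw)),
     If (Equal (Reg rv) (Reg rz)) (block [
       Set_Reg rv (Arr apv (Reg rw)),
       Set_Reg re (Arr ane (Reg rv))]) Skip,
     Set_Arr aout (Reg re) (Arr ax4 (Reg re)),
     Set_Arr amt (Arr axv (Reg rw)) (Arr axv (Reg rv)),
     Set_Arr amt (Arr axv (Reg rv)) (Arr axv (Reg rw)),
     Set_Arr adn (Arr acid (Reg rz)) (Const 1),
     Set_Reg rz (Arr aopp (Reg rv)),
     Set_Reg rcm (Const 1)]"

definition move_edge :: com where
  "move_edge = block [
     Set_Reg re (Arr ane (Reg rp)),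
     Set_Arr aout (Reg re) (Arr aalt (Reg re)),
     Set_Arr adn (Arr acid (Reg rz)) (Const 1),
     Set_Reg rz (Arr aopp (Reg rq)),
     Set_Reg rcm (Const 0)]"

definition break_two :: com where
  "break_two = block [
     Set_Reg rw (Arr anx (Reg rz)),
     Set_Reg rv (Arr anx (Reg rw)),
     Set_Reg re (Arr ane (Reg rw)),
     Set_Arr aout (Reg re) (Arr ax4 (Reg re)),
     Set_Arr amt (Arr axv (Reg rw)) (Arr axv (Reg rv)),
     Set_Arr amt (Arr axv (Reg rv)) (Arr axv (Reg rw)),
     Set_Arr adn (Arr acid (Reg rz)) (Const 1),
     Set_Arr adn (Arr acid (Reg rpd)) (Const 1),
     Set_Reg rd (Arr anx (Reg rpd)),
     Set_Reg re (Arr ane (Reg rpd)),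
     If (Conj (Neg (Equal (Reg rd) (Arr aopp (Reg rw)))) (Neg (Equal (Reg rd) (Arr aopp (Reg rv))))) Skip
       (block [
         Set_Reg rd (Arr apv (Reg rpd)),
         Set_Reg re (Arr ane (Reg rd))]),
     If (Conj (Neg (Equal (Reg rd) (Arr aopp (Reg rw)))) (Neg (Equal (Reg rd) (Arr aopp (Reg rv)))))
       (block [
         Set_Arr aout (Reg re) (Arr ax4 (Reg re)),
         Set_Arr amt (Arr axv (Reg rpd)) (Arr axv (Reg rd)),
         Set_Arr amt (Arr axv (Reg rd)) (Arr axv (Reg rpd))])
       (Set_Arr aout (Reg re) (Arr aalt (Reg re))),
     Set_Reg rz (Arr aopp (Reg rd)),
     Set_Reg rcm (Const 1)]"

text \<open>If \<open>rcm\<close> is 0 here, the copy of \<open>z\<close> lies on an unbroken cycle,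
  and then nothing else is pending: the register is free to hold that copy.\<close>

definition blocked_step :: com where
  "blocked_step = block [
     If (Equal (Reg rcm) (Const 0)) (Set_Reg rpd (Arr aopp (Reg rz))) Skip,
     Set_Reg rp (Reg rz),
     Set_Reg rq (Arr anx (Reg rz)),
     scan_crossing,
     If (Equal (Reg rq) (Reg rz)) break_two move_edge]"

text \<open>The scan does not test \<open>z\<close> itself. If it comes back to \<open>z\<close>,
  that vertex may still serve as the free end, but only if it is uncovered, that is if
  \<open>rcm\<close> is 0.\<close>

definition choose_step :: com where
  "choose_step = block [
     Set_Reg rw (Arr anx (Reg rz)),
     scan_free,
     If (Conj (Equal (Reg rw) (Reg rz))
         (Neg (Conj (Equal (Reg rcm) (Const 0)) (Neg (unfin (Arr aopp (Reg rz)))))))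
       blocked_step select_edge,
     If (unfin (Reg rz)) Skip (block [Set_Reg rz (Reg rpd), Set_Reg rcm (Const 0)])]"

definition choose_loop :: com where
  "choose_loop = While (unfin (Reg rz)) choose_step"

definition choose_all :: com where
  "choose_all = block [
     Set_Reg rj (Const 0),
     Set_Reg rz (Const 0),
     Set_Reg rcm (Const 0),
     Set_Reg rpd (Const 0),
     Set_Arr adn (Const 0) (Const 1),
     While (Less (Reg rj) (Reg rC)) (block [
       Set_Reg rj (Add (Reg rj) (Const 1)),
       If (Less (Arr acol (Arr ase (Reg rj))) (Const 2)) (block [
         Set_Reg rz (Arr aU (Arr ase (Reg rj))),
         Set_Reg rcm (Const 0),
         choose_loop]) Skip])]"

abbreviation (input) "tip_of r x \<equiv> [
  Set_Reg r (Arr amt (Arr axv (Reg x))),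
  If (Equal (Reg r) (Const 0)) (Set_Reg r (Arr axv (Reg x))) Skip]"

definition link_step :: com where
  "link_step = block ([
     Set_Reg rz (Arr aU (Arr ase (Reg rj))),
     Set_Reg rw (Arr anx (Reg rz))] @ tip_of rp rz @ [
     If (Equal (Reg rp) (Arr axv (Reg rw)))
       (block [Set_Reg rz (Reg rw), Set_Reg rw (Arr anx (Reg rw))]) Skip] @ tip_of rp rz @ tip_of rq rw @ [
     Set_Reg re (Arr ane (Reg rz)),
     Set_Arr aout (Reg re) (Arr ax4 (Reg re)),
     Set_Arr amt (Reg rp) (Reg rq),
     Set_Arr amt (Reg rq) (Reg rp),
     Set_Arr adn (Reg rj) (Const 1)])"

definition link_all :: com where
  "link_all = block [
     Set_Reg rj (Const 0),
     While (Less (Reg rj) (Reg rC)) (block [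
       Set_Reg rj (Add (Reg rj) (Const 1)),
       If (Less (Arr acol (Arr ase (Reg rj))) (Const 2)) Skip link_step])]"

lemma (in machine) vc_opaque:
  "vc scan_free Q s = wp scan_free Q s" "vc scan_crossing Q s = wp scan_crossing Q s"
  "vc choose_loop Q s = wp choose_loop Q s"
  by (simp_all add: scan_free_def scan_crossing_def choose_loop_def)

section \<open>Correctness and cost of breaking colours 0 and 1\<close>

locale triple_machine = machine_graph W B m U V + triple_structure m U V L C nx pv ne cid se opp xv col
  for W B m U V L C nx pv ne cid se opp xv col +
  fixes x4 alt df :: "nat \<Rightarrow> nat"
  assumes C_le: "C \<le> m"
begin

definition pick_mem :: "state \<Rightarrow> state \<Rightarrow> bool" where
  "pick_mem s0 s \<longleftrightarrow> same_arrays {aout, adn, amt} s0 s \<and> arr s0 aU = U \<and> arr s0 anx = nx \<and> arr s0 apv = pv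
     \<and> arr s0 ane = ne \<and> arr s0 acid = cid \<and> arr s0 ase = se \<and> arr s0 aopp = opp \<and> arr s0 axv = xv
     \<and> arr s0 ax4 = x4 \<and> arr s0 aalt = alt \<and> (\<forall>i. 1 \<le> i \<longrightarrow> i \<le> C \<longrightarrow> arr s0 acol (se i) = col (U (se i)))"

lemma pick_memD:
  assumes "pick_mem s0 s"
  shows "arr s aU = U" "arr s anx = nx" "arr s apv = pv" "arr s ane = ne" "arr s acid = cid"
    "arr s ase = se" "arr s aopp = opp" "arr s axv = xv" "arr s ax4 = x4" "arr s aalt = alt"
    "1 \<le> i \<Longrightarrow> i \<le> C \<Longrightarrow> arr s acol (se i) = col (U (se i))"
  using assms by (auto simp: pick_mem_def same_arrays_def)

lemma pick_mem_set:
  "pick_mem s0 s \<Longrightarrow> 3 \<le> x \<Longrightarrow> pick_mem s0 (setr x v s)"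
  "pick_mem s0 s \<Longrightarrow> a \<in> {aout, adn, amt} \<Longrightarrow> pick_mem s0 (seta a i v s)"
  by (auto simp: pick_mem_def same_arrays_def)

text \<open>\<open>x4\<close>, \<open>alt\<close> and \<open>df\<close> are the numbers of the
  forest that an edge joins when it is selected, moved or left alone.\<close>

definition out_fun :: "nat set \<Rightarrow> nat set \<Rightarrow> nat \<Rightarrow> nat" where
  "out_fun SX SM j = (if j \<in> SX then x4 j else if j \<in> SM then alt j else df j)"

lemma out_fun_select: "(out_fun SX SM)(e := x4 e) = out_fun (insert e SX) SM"
  by (auto simp: out_fun_def)

lemma out_fun_move: "e \<notin> SX \<Longrightarrow> (out_fun SX SM)(e := alt e) = out_fun SX (insert e SM)"
  by (auto simp: out_fun_def)

definition choose_inv :: "state \<Rightarrow> state \<Rightarrow> bool" where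
  "choose_inv s0 s \<longleftrightarrow> pick_mem s0 s \<and> (\<exists>SX SM. arr s aout = out_fun SX SM
     \<and> static_inv (arr s adn) (arr s amt) {} SX SM
     \<and> chain_inv (arr s adn) (arr s amt) SM (reg s rz) (reg s rcm) (reg s rpd))"

text \<open>Breaking a cycle lowers this number by the length of the cycle, which pays for the scans
  around it.\<close>

definition pot :: "(nat \<Rightarrow> nat) \<Rightarrow> nat" where
  "pot dn = card {y. cid y \<noteq> 0 \<and> \<not> fin dn y}"

lemma finite_core: "finite {y. cid y \<noteq> 0}" and card_core_le: "card {y. cid y \<noteq> 0} \<le> 2 * m"
proof -
  have L: "L \<subseteq> {..<m}" using core by (simp add: core_def)
  have "{y. cid y \<noteq> 0} \<subseteq> verts L" using traversed by (auto simp: traverse_inv_def)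
  then show "finite {y. cid y \<noteq> 0}" "card {y. cid y \<noteq> 0} \<le> 2 * m"
    using finite_verts[OF L] card_verts_le[OF L] finite_subset card_mono le_trans by metis+
qed

lemma pot_le: "pot dn \<le> 2 * m"
proof -
  have "pot dn \<le> card {y. cid y \<noteq> 0}"
    unfolding pot_def using finite_core by (intro card_mono) auto
  then show ?thesis using card_core_le by linarith
qed

lemma pot_upd:
  assumes "cid z \<noteq> 0" "\<not> fin dn z"
  shows "pot dn = pot (dn(cid z := 1)) + card (orbit z)"
proof -
  have "{y. cid y \<noteq> 0 \<and> \<not> fin dn y} = {y. cid y \<noteq> 0 \<and> \<not> fin (dn(cid z := 1)) y} \<union> orbit z"
    using assms by (auto simp: fin_upd orbit_def fin_def)
  moreover have "{y. cid y \<noteq> 0 \<and> \<not> fin (dn(cid z := 1)) y} \<inter> orbit z = {}"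
    by (auto simp: fin_upd orbit_def)
  moreover have "finite {y. cid y \<noteq> 0 \<and> \<not> fin (dn(cid z := 1)) y}"
    by (rule finite_subset[OF _ finite_core]) auto
  ultimately show ?thesis
    unfolding pot_def using orbit_cycle(3)[OF assms(1)] card_Un_disjoint by metis
qed

lemma pot_upd_le: "pot (dn(i := 1)) \<le> pot dn"
  unfolding pot_def
  by (rule card_mono, rule finite_subset[OF _ finite_core]) (auto simp: fin_def)

lemma unused_edge:
  assumes "static_inv dn mt I SX SM" "cid y \<noteq> 0" "\<not> fin dn y"
  shows "ne y \<notin> SX"
proof
  assume "ne y \<in> SX"
  then obtain y' where "ne y = ne y'" "cid y' \<noteq> 0" "fin dn y'"
    using assms(1) unfolding static_inv_def by blast
  then show False using ne_inj[of y y'] assms(2,3) by auto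
qed

text \<open>The progress of a scan. Counting starts at 1, so that arriving back at \<open>z\<close>
  counts as the full length of the cycle rather than 0.\<close>

definition steps :: "nat \<Rightarrow> nat \<Rightarrow> nat" where
  "steps z w = (LEAST i. 0 < i \<and> (nx ^^ i) z = w)"

lemma nx_funpow_inj:
  assumes "cid z \<noteq> 0" "(nx ^^ (i + l)) z = (nx ^^ i) z" shows "(nx ^^ l) z = z"
  using assms(2)
proof (induction i)
  case (Suc i)
  then have "nx ((nx ^^ (i + l)) z) = nx ((nx ^^ i) z)" by simp
  then have "(nx ^^ (i + l)) z = (nx ^^ i) z"
    using nx_inj cid_funpow assms(1) by metis
  then show ?case by (rule Suc.IH)
qed simp

lemma steps_funpow:
  assumes "cid z \<noteq> 0" "0 < i" "i \<le> card (orbit z)"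
  shows "steps z ((nx ^^ i) z) = i"
  unfolding steps_def
proof (rule Least_equality)
  fix l assume l: "0 < l \<and> (nx ^^ l) z = (nx ^^ i) z"
  show "i \<le> l"
  proof (rule ccontr)
    assume "\<not> i \<le> l"
    then have "(nx ^^ (l + (i - l))) z = (nx ^^ l) z" "0 < i - l" "i - l < card (orbit z)"
      using l assms by auto
    then show False using nx_funpow_inj[OF assms(1)] orbit_cycle(4)[OF assms(1)] by blast
  qed
qed (use assms in simp)

lemma wp_scan_free:
  assumes mem: "arr s anx = nx" "arr s acid = cid" "arr s aopp = opp" "arr s adn = dn"
    and z: "reg s rz = z" "cid z \<noteq> 0" and w: "reg s rw = nx z"
    and post: "\<And>t i. 0 < i \<Longrightarrow> i \<le> card (orbit z) \<Longrightarrow>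
      (\<And>l. 0 < l \<Longrightarrow> l < i \<Longrightarrow> \<not> fin dn (opp ((nx ^^ l) z))) \<Longrightarrow>
      (i < card (orbit z) \<Longrightarrow> fin dn (opp ((nx ^^ i) z))) \<Longrightarrow>
      t \<le> 20 * card (orbit z) + 20 \<Longrightarrow> Q t (setr rw ((nx ^^ i) z) s)"
  shows "wp scan_free Q s"
  unfolding scan_free_def
proof (rule wp_While[where \<mu> = "\<lambda>s'. 20 * (card (orbit z) - steps z (reg s' rw))"
    and I = "\<lambda>s'. \<exists>i. 0 < i \<and> i \<le> card (orbit z) \<and> s' = setr rw ((nx ^^ i) z) s
      \<and> (\<forall>l. 0 < l \<and> l < i \<longrightarrow> \<not> fin dn (opp ((nx ^^ l) z)))"])
  show "\<exists>i. 0 < i \<and> i \<le> card (orbit z) \<and> s = setr rw ((nx ^^ i) z) s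
      \<and> (\<forall>l. 0 < l \<and> l < i \<longrightarrow> \<not> fin dn (opp ((nx ^^ l) z)))"
    using w orbit_cycle(2)[OF z(2)] by (intro exI[of _ 1]) (simp add: setr_same)
next
  show "small_cond (Conj (Neg (Equal (Reg rw) (Reg rz))) (unfin (Arr aopp (Reg rw))))"
    by (simp add: small_def)
next
  fix s1
  assume "\<exists>i. 0 < i \<and> i \<le> card (orbit z) \<and> s1 = setr rw ((nx ^^ i) z) s
      \<and> (\<forall>l. 0 < l \<and> l < i \<longrightarrow> \<not> fin dn (opp ((nx ^^ l) z)))"
    and cond: "cond_val s1 (Conj (Neg (Equal (Reg rw) (Reg rz))) (unfin (Arr aopp (Reg rw))))"
  then obtain i where i: "0 < i" "i \<le> card (orbit z)" "s1 = setr rw ((nx ^^ i) z) s"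
    "\<And>l. 0 < l \<Longrightarrow> l < i \<Longrightarrow> \<not> fin dn (opp ((nx ^^ l) z))" by blast
  have c: "(nx ^^ i) z \<noteq> z" "\<not> fin dn (opp ((nx ^^ i) z))"
    using cond i(3) mem z by (auto simp: fin_def)
  have i_less: "i < card (orbit z)" using c(1) i(2) orbit_cycle(1)[OF z(2)] by (cases "i = card (orbit z)") auto
  have st: "steps z ((nx ^^ i) z) = i" "steps z ((nx ^^ (i + 1)) z) = i + 1"
    using steps_funpow[OF z(2), of i] steps_funpow[OF z(2), of "i + 1"] i i_less by simp_all
  have "\<not> fin dn (opp ((nx ^^ l) z))" if "0 < l" "l < i + 1" for l
    using that i(4) c(2) by (auto simp: less_plus_1_iff)
  then show "wp (Set_Reg rw (Arr anx (Reg rw)))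
     (\<lambda>t s'. (\<exists>i. 0 < i \<and> i \<le> card (orbit z) \<and> s' = setr rw ((nx ^^ i) z) s
      \<and> (\<forall>l. 0 < l \<and> l < i \<longrightarrow> \<not> fin dn (opp ((nx ^^ l) z)))) \<and>
      t + cond_time (Conj (Neg (Equal (Reg rw) (Reg rz))) (unfin (Arr aopp (Reg rw)))) + 1
        + 20 * (card (orbit z) - steps z (reg s' rw)) \<le> 20 * (card (orbit z) - steps z (reg s1 rw))) s1"
    using i i_less mem st
    by (intro vc_wp) (auto simp: small_def intro!: exI[of _ "i + 1"])
next
  fix t s1
  assume "\<exists>i. 0 < i \<and> i \<le> card (orbit z) \<and> s1 = setr rw ((nx ^^ i) z) s
      \<and> (\<forall>l. 0 < l \<and> l < i \<longrightarrow> \<not> fin dn (opp ((nx ^^ l) z)))"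
    and cond: "\<not> cond_val s1 (Conj (Neg (Equal (Reg rw) (Reg rz))) (unfin (Arr aopp (Reg rw))))"
    and t: "t + 20 * (card (orbit z) - steps z (reg s1 rw)) \<le> 20 * (card (orbit z) - steps z (reg s rw))
       + cond_time (Conj (Neg (Equal (Reg rw) (Reg rz))) (unfin (Arr aopp (Reg rw)))) + 1"
  then obtain i where i: "0 < i" "i \<le> card (orbit z)" "s1 = setr rw ((nx ^^ i) z) s"
    "\<And>l. 0 < l \<Longrightarrow> l < i \<Longrightarrow> \<not> fin dn (opp ((nx ^^ l) z))" by blast
  have "fin dn (opp ((nx ^^ i) z))" if "i < card (orbit z)"
    using cond i(1,3) mem z orbit_cycle(4)[OF z(2) i(1) that] by (auto simp: fin_def)
  then show "Q t s1" unfolding i(3) using i(1,2,4) t by (intro post) auto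
qed

lemma wp_scan_crossing:
  assumes mem: "arr s anx = nx" "arr s acid = cid" "arr s aopp = opp"
    and z: "reg s rz = z" "cid z \<noteq> 0" and p: "reg s rp = z" and q: "reg s rq = nx z"
    and post: "\<And>t i. i < card (orbit z) \<Longrightarrow>
      (\<And>l. 0 < l \<Longrightarrow> l < i + 1 \<Longrightarrow> cid (opp ((nx ^^ l) z)) = cid (reg s rpd)) \<Longrightarrow>
      (i + 1 < card (orbit z) \<Longrightarrow> cid (opp ((nx ^^ (i + 1)) z)) \<noteq> cid (reg s rpd)) \<Longrightarrow>
      t \<le> 20 * card (orbit z) + 20 \<Longrightarrow> Q t (setr rq ((nx ^^ (i + 1)) z) (setr rp ((nx ^^ i) z) s))"
  shows "wp scan_crossing Q s"
proof -
  let ?I = "\<lambda>s'. \<exists>i. i < card (orbit z) \<and> s' = setr rq ((nx ^^ (i + 1)) z) (setr rp ((nx ^^ i) z) s)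
      \<and> (\<forall>l. 0 < l \<and> l < i + 1 \<longrightarrow> cid (opp ((nx ^^ l) z)) = cid (reg s rpd))"
  let ?c = "Conj (Neg (Equal (Reg rq) (Reg rz)))
       (Equal (Arr acid (Arr aopp (Reg rq))) (Arr acid (Reg rpd)))"
  let ?\<mu> = "\<lambda>s'. 20 * (card (orbit z) - steps z (reg s' rq))"
  show ?thesis
    unfolding scan_crossing_def
  proof (rule wp_While[where \<mu> = ?\<mu> and I = ?I])
    show "?I s"
      using p q orbit_cycle(2)[OF z(2)] by (intro exI[of _ 0]) (simp add: setr_same)
    show "small_cond ?c" by (simp add: small_def)
  next
    fix s1 assume "?I s1" and cond: "cond_val s1 ?c"
    then obtain i where i: "i < card (orbit z)" "s1 = setr rq ((nx ^^ (i + 1)) z) (setr rp ((nx ^^ i) z) s)"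
      "\<And>l. 0 < l \<Longrightarrow> l < i + 1 \<Longrightarrow> cid (opp ((nx ^^ l) z)) = cid (reg s rpd)" by blast
    have c: "(nx ^^ (i + 1)) z \<noteq> z" "cid (opp ((nx ^^ (i + 1)) z)) = cid (reg s rpd)"
      using cond i(2) mem z by auto
    have i_less: "i + 1 < card (orbit z)"
      using c(1) i(1) orbit_cycle(1)[OF z(2)] by (cases "i + 1 = card (orbit z)") auto
    have st: "steps z ((nx ^^ (i + 1)) z) = i + 1" "steps z ((nx ^^ (i + 1 + 1)) z) = i + 1 + 1"
      using steps_funpow[OF z(2), of "i + 1"] steps_funpow[OF z(2), of "i + 1 + 1"] i i_less by simp_all
    have "cid (opp ((nx ^^ l) z)) = cid (reg s rpd)" if "0 < l" "l < i + 1 + 1" for l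
      using that i(3) c(2) less_plus_1_iff[of l "i + 1"] by auto
    then show "wp (block [Set_Reg rp (Reg rq), Set_Reg rq (Arr anx (Reg rq))])
      (\<lambda>t s'. ?I s' \<and> t + cond_time ?c + 1 + ?\<mu> s' \<le> ?\<mu> s1) s1"
      using i i_less mem st
      by (intro vc_wp) (auto simp: small_def setr_commute[of rp rq] intro!: exI[of _ "i + 1"])
  next
    fix t s1 assume "?I s1" and cond: "\<not> cond_val s1 ?c" and t: "t + ?\<mu> s1 \<le> ?\<mu> s + cond_time ?c + 1"
    then obtain i where i: "i < card (orbit z)" "s1 = setr rq ((nx ^^ (i + 1)) z) (setr rp ((nx ^^ i) z) s)"
      "\<And>l. 0 < l \<Longrightarrow> l < i + 1 \<Longrightarrow> cid (opp ((nx ^^ l) z)) = cid (reg s rpd)" by blast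
    have "cid (opp ((nx ^^ (i + 1)) z)) \<noteq> cid (reg s rpd)" if "i + 1 < card (orbit z)"
      using cond i(2) mem z orbit_cycle(4)[OF z(2) _ that] by auto
    then show "Q t s1" unfolding i(2) using i(1,3) t by (intro post) auto
  qed
qed

text \<open>A step has a budget of 300 per vertex of the cycle it breaks. The branches of a step
  reserve a part of it, such as \<open>200 * card (orbit z)\<close>, for the scans that precede
  them.\<close>

definition step_post :: "state \<Rightarrow> state \<Rightarrow> nat \<Rightarrow> state \<Rightarrow> bool" where
  "step_post s0 s t s' \<longleftrightarrow> choose_inv s0 s' \<and> reg s' rj = reg s rj \<and> reg s' rC = reg s rC
     \<and> (\<forall>i. arr s adn i \<noteq> 0 \<longrightarrow> arr s' adn i \<noteq> 0) \<and> fin (arr s' adn) (reg s rz) \<and> t + 300 * pot (arr s' adn) \<le> 300 * pot (arr s adn)"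

lemma wp_select_edge:
  assumes inv: "choose_inv s0 s" and z: "reg s rz = z" "\<not> fin (arr s adn) z"
    and w: "reg s rw = w" "cid w = cid z" "fin (arr s adn) (opp w)" "reg s rcm = 1 \<Longrightarrow> w \<noteq> z"
    and post: "\<And>t s'. step_post s0 s (t + 200 * card (orbit z)) s' \<Longrightarrow> Q t s'"
  shows "wp select_edge Q s"
proof -
  obtain SX SM where mem: "pick_mem s0 s" and out: "arr s aout = out_fun SX SM"
    and st: "static_inv (arr s adn) (arr s amt) {} SX SM"
    and ch: "chain_inv (arr s adn) (arr s amt) SM z (reg s rcm) (reg s rpd)"
    using inv z(1) unfolding choose_inv_def by blast
  have cz: "cid z \<noteq> 0" using not_fin_cid[OF st z(2)] .
  have cw: "cid w \<noteq> 0" using cz w by simp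
  note md = pick_memD[OF mem]
  note pu = pot_upd[OF cz z(2)]
  have n: "3 \<le> card (orbit z)" using orbit_cycle(2)[OF cz] .
  define w' where "w' = (if nx w = z then pv w else nx w)"
  define y where "y = (if nx w = z then pv w else w)"
  have w': "cid w' = cid z" "w \<noteq> w'" "w' \<noteq> z"
    using w(2) nx_facts(1,3)[OF cw] pv_facts(1)[OF cw] pv_ne[OF cw] pv_ne_nx[OF cw] by (auto simp: w'_def)
  have y: "cid y = cid z" "ed (ne y) = {w, w'}"
    using w(2) nx_facts(6)[OF cw] nx_facts(6)[of "pv w"] pv_facts[OF cw] cw by (auto simp: y_def w'_def)
  note step = select_step[OF st ch z(2) w(2) w'(1,2) y w(3,4) w'(3)]
  have fin: "step_post s0 s (t + 200 * card (orbit z)) s'"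
    if "pick_mem s0 s'" "reg s' rj = reg s rj" "reg s' rC = reg s rC" "reg s' rz = opp w'" "reg s' rcm = 1"
      "reg s' rpd = reg s rpd" "arr s' aout = (arr s aout)(ne y := x4 (ne y))"
      "arr s' amt = (arr s amt)(xv w := xv w', xv w' := xv w)" "arr s' adn = (arr s adn)(cid z := 1)" "t \<le> 100"
    for t s'
  proof -
    have "choose_inv s0 s'"
      unfolding choose_inv_def
      using that step out_fun_select[of SX SM "ne y"] out by (intro conjI exI[of _ "insert (ne y) SX"] exI[of _ SM]) auto
    then show ?thesis using that pu n z(1) by (auto simp: step_post_def fin_def)
  qed
  show ?thesis
  proof (cases "nx w = z")
    case True
    then have eq: "pv w = w'" "ne w' = ne y" by (auto simp: w'_def y_def)
    show ?thesis
      unfolding select_edge_def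
      by (rule vc_wp, simp add: small_def md z(1) w(1) True eq)
        (intro post fin pick_mem_set mem; simp add: True z(1) w(1) md eq)
  next
    case False
    then have eq: "nx w = w'" "ne w = ne y" and nz: "w' \<noteq> z" by (auto simp: w'_def y_def)
    show ?thesis
      unfolding select_edge_def
      by (rule vc_wp, simp add: small_def md z(1) w(1) eq nz)
        (intro post fin pick_mem_set mem; simp add: z(1) w(1) md eq)
  qed
qed


lemma wp_move_edge:
  assumes mem: "pick_mem s0 s" and out: "arr s aout = out_fun SX SM"
    and st: "static_inv (arr s adn) (arr s amt) {} SX SM"
    and ch: "chain_inv (arr s adn) (arr s amt) SM z cm pd"
    and z: "reg s rz = z" "\<not> fin (arr s adn) z"
    and pd': "cm = 1 \<Longrightarrow> reg s rpd = pd"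
      "cm = 0 \<Longrightarrow> fin (arr s adn) pd \<and> \<not> fin (arr s adn) (opp z) \<and> reg s rpd = opp z"
    and p: "reg s rp = p" "reg s rq = nx p" "cid p = cid z" "cid (opp p) \<noteq> 0"
      "fin (arr s adn) (opp p) \<or> cid (opp p) = cid (reg s rpd)"
    and q: "\<not> fin (arr s adn) (opp (nx p))" "cid (opp (nx p)) \<noteq> cid (reg s rpd)"
    and post: "\<And>t s'. step_post s0 s (t + 200 * card (orbit z)) s' \<Longrightarrow> Q t s'"
  shows "wp move_edge Q s"
proof -
  note md = pick_memD[OF mem]
  have cz: "cid z \<noteq> 0" using not_fin_cid[OF st z(2)] .
  note pu = pot_upd[OF cz z(2)]
  have n: "3 \<le> card (orbit z)" using orbit_cycle(2)[OF cz] .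
  note step = move_step[OF st ch z(2) pd' p(3) refl p(4,5) q]
  \<comment> \<open>The output gives priority to \<open>SX\<close>, so the move would be lost on an
    edge selected earlier; but such an edge would belong to a broken cycle.\<close>
  have "ne p \<notin> SX" using unused_edge[OF st] p(3) cz z(2) fin_cid[of p z] by auto
  note out' = out_fun_move[OF this, of SM]
  have fin: "step_post s0 s (t + 200 * card (orbit z)) s'"
    if "pick_mem s0 s'" "reg s' rj = reg s rj" "reg s' rC = reg s rC" "reg s' rz = opp (nx p)" "reg s' rcm = 0"
      "reg s' rpd = reg s rpd" "arr s' aout = (arr s aout)(ne p := alt (ne p))"
      "arr s' amt = arr s amt" "arr s' adn = (arr s adn)(cid z := 1)" "t \<le> 100"
    for t s'
  proof -
    have "choose_inv s0 s'"
      unfolding choose_inv_def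
      using that step out' out by (intro conjI exI[of _ SX] exI[of _ "insert (ne p) SM"]) auto
    then show ?thesis using that pu n z(1) by (auto simp: step_post_def fin_def)
  qed
  show ?thesis
    unfolding move_edge_def
    by (rule vc_wp, simp add: small_def md z(1) p(1,2))
      (intro post fin pick_mem_set mem; simp add: z(1) p(1,2) md)
qed

lemma wp_break_two:
  assumes mem: "pick_mem s0 s" and out: "arr s aout = out_fun SX SM"
    and st: "static_inv (arr s adn) (arr s amt) {} SX SM"
    and ch: "chain_inv (arr s adn) (arr s amt) SM z cm pd"
    and z: "reg s rz = z" "\<not> fin (arr s adn) z"
    and pd': "cm = 1 \<Longrightarrow> reg s rpd = pd"
      "cm = 0 \<Longrightarrow> fin (arr s adn) pd \<and> \<not> fin (arr s adn) (opp z) \<and> reg s rpd = opp z"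
    and w: "w = nx z" "w' = nx w" "cid (opp w) = cid (reg s rpd)" "cid (opp w') = cid (reg s rpd)"
      "\<not> fin (arr s adn) (reg s rpd)"
    and post: "\<And>t s'. step_post s0 s (t + 200 * card (orbit z)) s' \<Longrightarrow> Q t s'"
  shows "wp break_two Q s"
proof -
  note md = pick_memD[OF mem]
  have cz: "cid z \<noteq> 0" using not_fin_cid[OF st z(2)] .
  note pu = pot_upd[OF cz z(2)]
  have n: "3 \<le> card (orbit z)" using orbit_cycle(2)[OF cz] .
  define a where "a = reg s rpd"
  define d where "d = (if nx a = opp w \<or> nx a = opp w' then pv a else nx a)"
  define y where "y = (if nx a = opp w \<or> nx a = opp w' then pv a else a)"
  define dn' where "dn' = (arr s adn)(cid z := 1, cid a := 1)"
  define mt' where "mt' = (arr s amt)(xv w := xv w', xv w' := xv w)"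
  define ou' where "ou' = (arr s aout)(ne w := x4 (ne w))"
  define mv where "mv \<longleftrightarrow> d = opp w \<or> d = opp w'"
  have pd'': "cm = 1 \<Longrightarrow> a = pd"
      "cm = 0 \<Longrightarrow> fin (arr s adn) pd \<and> \<not> fin (arr s adn) (opp z) \<and> a = opp z"
    using pd' by (auto simp: a_def)
  note step = trapped_step[OF st ch z(2) pd'' w[folded a_def] d_def y_def,
      folded dn'_def mt'_def mv_def]
  have out1: "ou' = out_fun (insert (ne w) SX) SM"
    using out_fun_select[of SX SM "ne w"] out by (simp add: ou'_def)
  have fin: "step_post s0 s (t + 200 * card (orbit z)) s'"
    if "pick_mem s0 s'" "reg s' rj = reg s rj" "reg s' rC = reg s rC" "reg s' rz = opp d" "reg s' rcm = 1"
      "reg s' rpd = a" "arr s' aout = ou'(ne y := (if mv then alt (ne y) else x4 (ne y)))"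
      "arr s' amt = (if mv then mt' else mt'(xv a := xv d, xv d := xv a))" "arr s' adn = dn'" "t \<le> 150"
    for t s'
  proof -
    have "choose_inv s0 s'"
    proof (cases mv)
      case True
      then show ?thesis
        unfolding choose_inv_def
        using that step(1,2) out_fun_move[OF step(5), of SM] out1
        by (intro conjI exI[of _ "insert (ne w) SX"] exI[of _ "insert (ne y) SM"]) auto
    next
      case False
      then show ?thesis
        unfolding choose_inv_def
        using that step(3,4) out_fun_select[of "insert (ne w) SX" SM "ne y"] out1
        by (intro conjI exI[of _ "insert (ne y) (insert (ne w) SX)"] exI[of _ SM]) auto
    qed
    moreover have "pot dn' \<le> pot ((arr s adn)(cid z := 1))" unfolding dn'_def by (rule pot_upd_le)
    moreover have "arr s adn i \<noteq> 0 \<longrightarrow> dn' i \<noteq> 0" "fin dn' z" for i by (simp_all add: dn'_def fin_def)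
    ultimately show ?thesis using that pu n z(1) by (auto simp: step_post_def)
  qed
  note vals = small_def md z(1) a_def[symmetric] w(1,2)[symmetric]
  have ne_iff: "(d \<noteq> opp w \<and> d \<noteq> opp w') = (\<not> mv)" by (auto simp: mv_def)
  show ?thesis
  proof (cases "nx a = opp w \<or> nx a = opp w'")
    case True
    then have c: "(nx a \<noteq> opp w \<and> nx a \<noteq> opp w') = False" by auto
    have eq: "pv a = d" "ne d = ne y" using True by (auto simp: d_def y_def)
    show ?thesis
      unfolding break_two_def
      apply (rule vc_wp)
      apply (simp add: vals c True eq ne_iff)
      apply (intro conjI impI; intro post fin pick_mem_set mem;
          simp add: vals eq True mt'_def ou'_def dn'_def)
      done
  next
    case False
    then have c: "(nx a \<noteq> opp w \<and> nx a \<noteq> opp w') = True" by auto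
    have eq: "nx a = d" "ne a = ne y" "\<not> mv" using False by (auto simp: d_def y_def mv_def)
    show ?thesis
      unfolding break_two_def
      by (rule vc_wp, simp add: vals c[unfolded eq(1)] eq)
        (intro conjI impI post fin pick_mem_set mem;
          simp add: mt'_def ou'_def dn'_def vals eq)
  qed
qed

lemma wp_blocked_step:
  assumes inv: "choose_inv s0 s" and z: "reg s rz = z" "\<not> fin (arr s adn) z"
    and cm: "reg s rcm = 0 \<Longrightarrow> \<not> fin (arr s adn) (opp z)"
    and blocked: "\<And>l. 0 < l \<Longrightarrow> l < card (orbit z) \<Longrightarrow> \<not> fin (arr s adn) (opp ((nx ^^ l) z))"
    and post: "\<And>t s'. step_post s0 s (t + 100 * card (orbit z)) s' \<Longrightarrow> Q t s'"
  shows "wp blocked_step Q s"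
proof -
  obtain SX SM where mem: "pick_mem s0 s" and out: "arr s aout = out_fun SX SM"
    and st: "static_inv (arr s adn) (arr s amt) {} SX SM"
    and ch: "chain_inv (arr s adn) (arr s amt) SM z (reg s rcm) (reg s rpd)"
    using inv z(1) unfolding choose_inv_def by blast
  note md = pick_memD[OF mem]
  have cz: "cid z \<noteq> 0" using not_fin_cid[OF st z(2)] .
  have n: "3 \<le> card (orbit z)" using orbit_cycle(2)[OF cz] .
  define a where "a = (if reg s rcm = 0 then opp z else reg s rpd)"
  define s1 where "s1 = setr rq (nx z) (setr rp z (setr rpd a s))"
  have s1: "arr s1 = arr s" "reg s1 rz = z" "reg s1 rpd = a" "reg s1 rp = z" "reg s1 rq = nx z"
    "reg s1 rj = reg s rj" "reg s1 rC = reg s rC"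
    using z by (simp_all add: s1_def)
  have mem1: "pick_mem s0 s1" unfolding s1_def by (intro pick_mem_set mem) auto
  have pd: "reg s rcm = 1 \<Longrightarrow> a = reg s rpd"
    "reg s rcm = 0 \<Longrightarrow> fin (arr s adn) (reg s rpd) \<and> \<not> fin (arr s adn) (opp z) \<and> a = opp z"
    using cm ch z(2) unfolding chain_inv_def a_def by auto
  have opp_z: "cid (opp z) \<noteq> 0" "fin (arr s adn) (opp z) \<or> cid (opp z) = cid a"
  proof -
    have "cid (opp z) \<noteq> 0 \<and> (fin (arr s adn) (opp z) \<or> cid (opp z) = cid a)"
    proof (cases "reg s rcm = 0")
      case True
      then show ?thesis using pd(2) not_fin_cid[OF st] by auto
    next
      case False
      then have "reg s rcm = 1" using ch unfolding chain_inv_def by auto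
      then show ?thesis using ch z(2) unfolding chain_inv_def by blast
    qed
    then show "cid (opp z) \<noteq> 0" "fin (arr s adn) (opp z) \<or> cid (opp z) = cid a" by auto
  qed
  have finish: "step_post s0 s (t + 100 * card (orbit z)) s'"
    if "step_post s0 s2 (u + 200 * card (orbit z)) s'" "arr s2 = arr s" "reg s2 rj = reg s rj" "reg s2 rC = reg s rC" "reg s2 rz = z"
      "t \<le> u + 20 * card (orbit z) + 60" for t u s' s2
    using that n z(1) by (auto simp: step_post_def)
  \<comment> \<open>The slack of 20 stands for the surrounding commands, whose exact times need not
    be tracked.\<close>
  have cross: "wp scan_crossing (\<lambda>t. wp (If (Equal (Reg rq) (Reg rz)) break_two move_edge) (\<lambda>u s'.
      \<forall>t'. t' \<le> t + u + 20 \<longrightarrow> Q t' s')) s1"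
  proof (rule wp_scan_crossing[OF _ _ _ s1(2) cz s1(4,5)])
    fix t i
    assume i: "i < card (orbit z)"
      "\<And>l. 0 < l \<Longrightarrow> l < i + 1 \<Longrightarrow> cid (opp ((nx ^^ l) z)) = cid (reg s1 rpd)"
      "i + 1 < card (orbit z) \<Longrightarrow> cid (opp ((nx ^^ (i + 1)) z)) \<noteq> cid (reg s1 rpd)"
      and t: "t \<le> 20 * card (orbit z) + 20"
    let ?s2 = "setr rq ((nx ^^ (i + 1)) z) (setr rp ((nx ^^ i) z) s1)"
    have mem2: "pick_mem s0 ?s2" by (intro pick_mem_set mem1) auto
    have s2: "arr ?s2 = arr s" "reg ?s2 rz = z" "reg ?s2 rpd = a" "reg ?s2 rp = (nx ^^ i) z"
      "reg ?s2 rq = nx ((nx ^^ i) z)" "reg ?s2 rj = reg s rj" "reg ?s2 rC = reg s rC"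
      using s1 by simp_all
    show "wp (If (Equal (Reg rq) (Reg rz)) break_two move_edge) (\<lambda>u s'. \<forall>t'. t' \<le> t + u + 20 \<longrightarrow> Q t' s') ?s2"
    proof (rule wp_If)
      show "small_cond (Equal (Reg rq) (Reg rz))" by (simp add: small_def)
    next
      assume "cond_val ?s2 (Equal (Reg rq) (Reg rz))"
      then have "(nx ^^ (i + 1)) z = z" using s2 by simp
      \<comment> \<open>Back at \<open>z\<close> without a crossing: the copies of all other
        vertices lie on the cycle of \<open>a\<close>, so both cycles have to be broken at
        once.\<close>
      then have last: "i + 1 = card (orbit z)"
        using orbit_cycle(4)[OF cz, of "i + 1"] i(1) by (cases "i + 1 < card (orbit z)") auto
      have w: "cid (opp (nx z)) = cid a" "cid (opp (nx (nx z))) = cid a"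
        using i(2)[of 1] i(2)[of 2] last n s1(3) by (simp_all add: numeral_2_eq_2 One_nat_def)
      have "\<not> fin (arr s adn) (opp (nx z))" using blocked[of 1] n by simp
      then have nfa: "\<not> fin (arr s adn) a" using w(1) fin_cid by metis
      show "wp break_two (\<lambda>u s'. \<forall>t'. t' \<le> t + (cond_time (Equal (Reg rq) (Reg rz)) + u + 1) + 20 \<longrightarrow> Q t' s') ?s2"
      proof (rule wp_break_two[where ?s0.0 = s0 and z = z and SX = SX and SM = SM
            and cm = "reg s rcm" and pd = "reg s rpd" and w = "nx z" and w' = "nx (nx z)"])
        fix u s' assume p: "step_post s0 ?s2 (u + 200 * card (orbit z)) s'"
        show "\<forall>t'. t' \<le> t + (cond_time (Equal (Reg rq) (Reg rz)) + u + 1) + 20 \<longrightarrow> Q t' s'"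
          using t by (intro allI impI post finish[OF p s2(1,6,7,2)]) simp
      qed (use mem2 out st ch z pd w nfa s1 in auto)
    next
      assume "\<not> cond_val ?s2 (Equal (Reg rq) (Reg rz))"
      then have "(nx ^^ (i + 1)) z \<noteq> z" using s2 by simp
      then have less: "i + 1 < card (orbit z)"
        using orbit_cycle(1)[OF cz] i(1) by (cases "i + 1 = card (orbit z)") auto
      \<comment> \<open>For \<open>i = 0\<close> this is \<open>z\<close> itself, whose copy is on a
        broken cycle or on that of \<open>a\<close>. Every later vertex was passed by the scan, so
        its copy lies on the cycle of \<open>a\<close>.\<close>
      have p: "cid (opp ((nx ^^ i) z)) \<noteq> 0 \<and> (fin (arr s adn) (opp ((nx ^^ i) z)) \<or> cid (opp ((nx ^^ i) z)) = cid a)"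
      proof (cases "i = 0")
        case True
        then show ?thesis using opp_z by simp
      next
        case False
        then have "cid (opp ((nx ^^ i) z)) = cid a" using i(2)[of i] s1(3) by simp
        moreover have "\<not> fin (arr s adn) (opp ((nx ^^ i) z))" using blocked[of i] False i(1) by simp
        ultimately show ?thesis using not_fin_cid[OF st] by metis
      qed
      have q: "\<not> fin (arr s adn) (opp (nx ((nx ^^ i) z)))" "cid (opp (nx ((nx ^^ i) z))) \<noteq> cid a"
        using blocked[of "i + 1"] i(3) less s1(3) by simp_all
      show "wp move_edge (\<lambda>u s'. \<forall>t'. t' \<le> t + (cond_time (Equal (Reg rq) (Reg rz)) + u + 1) + 20 \<longrightarrow> Q t' s') ?s2"
      proof (rule wp_move_edge[where ?s0.0 = s0 and z = z and SX = SX and SM = SM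
            and cm = "reg s rcm" and pd = "reg s rpd" and p = "(nx ^^ i) z"])
        fix u s' assume p: "step_post s0 ?s2 (u + 200 * card (orbit z)) s'"
        show "\<forall>t'. t' \<le> t + (cond_time (Equal (Reg rq) (Reg rz)) + u + 1) + 20 \<longrightarrow> Q t' s'"
          using t by (intro allI impI post finish[OF p s2(1,6,7,2)]) simp
      qed (use mem2 out st ch z pd p q s1 cid_funpow[OF cz] in auto)
    qed
  qed (use md s1 in auto)
  have h1: "wp (If (Equal (Reg rcm) (Const 0)) (Set_Reg rpd (Arr aopp (Reg rz))) Skip)
    (\<lambda>t s'. t \<le> 8 \<and> setr rq (nx z) (setr rp z s') = s1) s"
    using z md by (intro vc_wp) (auto simp: small_def s1_def a_def setr_same)
  have h2: "wp (Seq (Set_Reg rp (Reg rz)) (Seq (Set_Reg rq (Arr anx (Reg rz)))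
      (Seq scan_crossing (Seq (If (Equal (Reg rq) (Reg rz)) break_two move_edge) Skip)))) (\<lambda>u. Q (t0 + u)) s'"
    if t0: "t0 \<le> 8" and s': "setr rq (nx z) (setr rp z s') = s1" for t0 s'
  proof -
    have "reg s' rz = z" using s1(2) unfolding s'[symmetric] by simp
    moreover have "arr s' = arr s" using s1(1) unfolding s'[symmetric] by simp
    ultimately have r: "setr rq (arr s' anx (reg s' rz)) (setr rp (reg s' rz) s') = s1"
      using s' md by simp
    show ?thesis
      apply (rule wp_Seq, rule wp_Set_Reg; (simp add: small_def)?)
      apply (rule wp_Seq, rule wp_Set_Reg; (simp add: small_def r)?)
      apply (rule wp_Seq, rule wp_mono[OF cross])
      apply (rule wp_Seq, erule wp_mono)
      apply (rule vc_wp)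
      using t0 by simp
  qed
  show ?thesis
    unfolding blocked_step_def block.simps
    by (rule wp_Seq, rule wp_mono[OF h1], rule h2) auto
qed

text \<open>At the end of a chain \<open>z\<close> is replaced by the pending vertex. Hence the
  guard of the loop also tests the pending cycle, and the loop stops only when nothing is
  pending.\<close>

lemma wp_choose_step:
  assumes inv: "choose_inv s0 s" and z: "\<not> fin (arr s adn) (reg s rz)"
  shows "wp choose_step (\<lambda>t s'. step_post s0 s (t + 20) s' \<and>
    (fin (arr s' adn) (reg s' rz) \<longrightarrow> fin (arr s' adn) (reg s' rpd))) s"
proof -
  define z where "z = reg s rz"
  have nf: "\<not> fin (arr s adn) z" using z by (simp add: z_def)
  obtain SX SM where mem: "pick_mem s0 s"
    and st: "static_inv (arr s adn) (arr s amt) {} SX SM"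
    and ch: "chain_inv (arr s adn) (arr s amt) SM z (reg s rcm) (reg s rpd)"
    using inv unfolding choose_inv_def z_def by blast
  note md = pick_memD[OF mem]
  have cz: "cid z \<noteq> 0" using not_fin_cid[OF st nf] .
  have n: "3 \<le> card (orbit z)" using orbit_cycle(2)[OF cz] .
  have cm2: "reg s rcm < 2" using ch by (simp add: chain_inv_def)
  let ?R = "\<lambda>t s'. step_post s0 s (t + 20) s' \<and>
    (fin (arr s' adn) (reg s' rz) \<longrightarrow> fin (arr s' adn) (reg s' rpd))"
  have last: "wp (Seq (If (unfin (Reg rz)) Skip (block [Set_Reg rz (Reg rpd), Set_Reg rcm (Const 0)])) Skip)
      (\<lambda>u. ?R (t + u)) s'" if p: "step_post s0 s (t + 40) s'" for t s'
  proof -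
    obtain SX SM where mem: "pick_mem s0 s'" and o: "arr s' aout = out_fun SX SM"
      and st: "static_inv (arr s' adn) (arr s' amt) {} SX SM"
      and ch: "chain_inv (arr s' adn) (arr s' amt) SM (reg s' rz) (reg s' rcm) (reg s' rpd)"
      using p unfolding step_post_def choose_inv_def by blast
    note md = pick_memD[OF mem]
    show ?thesis
    proof (cases "fin (arr s' adn) (reg s' rz)")
      case True
      have "choose_inv s0 (setr rcm 0 (setr rz (reg s' rpd) s'))"
        unfolding choose_inv_def using o st chain_inv_restart[OF ch True]
        by (intro conjI exI[of _ SX] exI[of _ SM] pick_mem_set mem) auto
      then show ?thesis
        using p True by (intro vc_wp) (auto simp: small_def md fin_def step_post_def)
    next
      case False
      then show ?thesis
        using p by (intro vc_wp) (auto simp: small_def md fin_def step_post_def)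
    qed
  qed
  have "wp (Seq scan_free (Seq (If (Conj (Equal (Reg rw) (Reg rz))
         (Neg (Conj (Equal (Reg rcm) (Const 0)) (Neg (unfin (Arr aopp (Reg rz)))))))
       blocked_step select_edge)
     (Seq (If (unfin (Reg rz)) Skip (block [Set_Reg rz (Reg rpd), Set_Reg rcm (Const 0)])) Skip)))
     (\<lambda>t. ?R (3 + t)) (setr rw (nx z) s)"
  proof (rule wp_Seq, rule wp_scan_free[where z = z, OF _ _ _ refl])
    fix t i
    assume i: "0 < i" "i \<le> card (orbit z)"
      "\<And>l. 0 < l \<Longrightarrow> l < i \<Longrightarrow> \<not> fin (arr (setr rw (nx z) s) adn) (opp ((nx ^^ l) z))"
      "i < card (orbit z) \<Longrightarrow> fin (arr (setr rw (nx z) s) adn) (opp ((nx ^^ i) z))"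
      and t: "t \<le> 20 * card (orbit z) + 20"
    define s2 where "s2 = setr rw ((nx ^^ i) z) s"
    have s2: "setr rw ((nx ^^ i) z) (setr rw (nx z) s) = s2" "arr s2 = arr s" "reg s2 rw = (nx ^^ i) z"
      "reg s2 rz = z" "reg s2 rcm = reg s rcm" "reg s2 rj = reg s rj" "reg s2 rC = reg s rC"
      by (simp_all add: s2_def z_def)
    have inv2: "choose_inv s0 s2"
      using inv unfolding choose_inv_def s2_def by (auto intro!: pick_mem_set)
    have finish: "step_post s0 s (u' + 40) s'"
      if "step_post s0 s2 (u + 100 * card (orbit z)) s'" "u' \<le> u + 20 * card (orbit z) + 60" for u u' s'
      using that n s2 z_def by (auto simp: step_post_def)
    let ?c = "Conj (Equal (Reg rw) (Reg rz)) (Neg (Conj (Equal (Reg rcm) (Const 0)) (Neg (unfin (Arr aopp (Reg rz))))))"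
    have c: "cond_val s2 ?c \<longleftrightarrow> (nx ^^ i) z = z \<and> \<not> (reg s rcm = 0 \<and> fin (arr s adn) (opp z))"
      using s2 md by (auto simp: fin_def)
    show "wp (Seq (If ?c blocked_step select_edge)
       (Seq (If (unfin (Reg rz)) Skip (block [Set_Reg rz (Reg rpd), Set_Reg rcm (Const 0)])) Skip))
       (\<lambda>u. ?R (3 + (t + u))) (setr rw ((nx ^^ i) z) (setr rw (nx z) s))"
      unfolding s2(1)
    proof (rule wp_Seq, rule wp_If)
      show "small_cond ?c" by (simp add: small_def)
    next
      assume "cond_val s2 ?c"
      then have "(nx ^^ i) z = z" and cm: "\<not> (reg s rcm = 0 \<and> fin (arr s adn) (opp z))" using c by auto
      then have ieq: "i = card (orbit z)"
        using orbit_cycle(4)[OF cz i(1)] i(2) by (cases "i < card (orbit z)") auto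
      show "wp blocked_step (\<lambda>u s'. wp (Seq (If (unfin (Reg rz)) Skip (block [Set_Reg rz (Reg rpd), Set_Reg rcm (Const 0)])) Skip)
         (\<lambda>v. ?R (3 + (t + (cond_time ?c + u + 1 + v)))) s') s2"
      proof (rule wp_blocked_step[OF inv2 s2(4)])
        fix u s' assume "step_post s0 s2 (u + 100 * card (orbit z)) s'"
        from finish[OF this, of "3 + (t + (cond_time ?c + u + 1))"]
        have "step_post s0 s (3 + (t + (cond_time ?c + u + 1)) + 40) s'" using t by simp
        from last[OF this]
        show "wp (Seq (If (unfin (Reg rz)) Skip (block [Set_Reg rz (Reg rpd), Set_Reg rcm (Const 0)])) Skip)
         (\<lambda>v. ?R (3 + (t + (cond_time ?c + u + 1 + v)))) s'"
          by (simp add: ac_simps)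
      qed (use nf cm s2 i ieq in auto)
    next
      assume nc: "\<not> cond_val s2 ?c"
      \<comment> \<open>Either the scan stopped early at a free vertex, or it returned to
        \<open>z\<close>, which is then free and uncovered itself.\<close>
      have "fin (arr s adn) (opp ((nx ^^ i) z)) \<and> (reg s rcm = 1 \<longrightarrow> (nx ^^ i) z \<noteq> z)"
      proof (cases "i < card (orbit z)")
        case True
        then show ?thesis using i(4) orbit_cycle(4)[OF cz i(1)] by simp
      next
        case False
        then have "(nx ^^ i) z = z" using i(2) orbit_cycle(1)[OF cz] by simp
        moreover from this have "reg s rcm = 0 \<and> fin (arr s adn) (opp z)" using nc unfolding c by blast
        ultimately show ?thesis by simp
      qed
      then have w: "fin (arr s adn) (opp ((nx ^^ i) z))" "reg s rcm = 1 \<Longrightarrow> (nx ^^ i) z \<noteq> z" by auto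
      show "wp select_edge (\<lambda>u s'. wp (Seq (If (unfin (Reg rz)) Skip (block [Set_Reg rz (Reg rpd), Set_Reg rcm (Const 0)])) Skip)
         (\<lambda>v. ?R (3 + (t + (cond_time ?c + u + 1 + v)))) s') s2"
      proof (rule wp_select_edge[OF inv2 s2(4) _ s2(3)])
        fix u s' assume "step_post s0 s2 (u + 200 * card (orbit z)) s'"
        then have "step_post s0 s2 (u + 100 * card (orbit z)) s'" by (simp add: step_post_def)
        from finish[OF this, of "3 + (t + (cond_time ?c + u + 1))"]
        have "step_post s0 s (3 + (t + (cond_time ?c + u + 1)) + 40) s'" using t by simp
        from last[OF this]
        show "wp (Seq (If (unfin (Reg rz)) Skip (block [Set_Reg rz (Reg rpd), Set_Reg rcm (Const 0)])) Skip)
         (\<lambda>v. ?R (3 + (t + (cond_time ?c + u + 1 + v)))) s'"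
          by (simp add: ac_simps)
      qed (use nf w s2 cid_funpow[OF cz] in auto)
    qed
  qed (use md cz z_def in auto)
  then show ?thesis
    unfolding choose_step_def block.simps
    by (intro wp_Seq[of "Set_Reg rw (Arr anx (Reg rz))"] wp_Set_Reg)
      (simp_all add: small_def md z_def)
qed


lemma wp_choose_loop:
  assumes inv: "choose_inv s0 s" and pd: "fin (arr s adn) (reg s rz) \<longrightarrow> fin (arr s adn) (reg s rpd)"
    and post: "\<And>t s'. step_post s0 s (t - 20) s' \<Longrightarrow> t \<le> 300 * pot (arr s adn) + 20 - 300 * pot (arr s' adn)
      \<Longrightarrow> fin (arr s' adn) (reg s' rz) \<Longrightarrow> fin (arr s' adn) (reg s' rpd) \<Longrightarrow> Q t s'"
  shows "wp choose_loop Q s"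
proof -
  \<comment> \<open>The last but one conjunct guarantees that the cycle on which the loop was
    started is broken in the end, whichever cycle comes last.\<close>
  let ?I = "\<lambda>s'. choose_inv s0 s' \<and> reg s' rj = reg s rj \<and> reg s' rC = reg s rC
    \<and> (\<forall>i. arr s adn i \<noteq> 0 \<longrightarrow> arr s' adn i \<noteq> 0) \<and> pot (arr s' adn) \<le> pot (arr s adn)
    \<and> (reg s' rz = reg s rz \<or> fin (arr s' adn) (reg s rz))
    \<and> (fin (arr s' adn) (reg s' rz) \<longrightarrow> fin (arr s' adn) (reg s' rpd))"
  let ?\<mu> = "\<lambda>s'. 300 * pot (arr s' adn)"
  show ?thesis
    unfolding choose_loop_def
  proof (rule wp_While[where I = ?I and \<mu> = ?\<mu>])
    show "?I s" using inv pd by auto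
    show "small_cond (unfin (Reg rz))" by (simp add: small_def)
  next
    fix s1 assume I: "?I s1" and cond: "cond_val s1 (unfin (Reg rz))"
    have ci: "choose_inv s0 s1" using I by simp
    then have "pick_mem s0 s1" by (simp add: choose_inv_def)
    then have "\<not> fin (arr s1 adn) (reg s1 rz)" using cond pick_memD(5) by (auto simp: fin_def)
    from wp_choose_step[OF ci this]
    show "wp choose_step (\<lambda>t s'. ?I s' \<and> t + cond_time (unfin (Reg rz)) + 1 + ?\<mu> s' \<le> ?\<mu> s1) s1"
    proof (rule wp_mono, goal_cases)
      case (1 t s')
      then have "fin (arr s' adn) (reg s rz)" using I by (auto simp: step_post_def fin_def)
      then show ?case using 1 I by (auto simp: step_post_def)
    qed
  next
    fix t s1 assume I: "?I s1" and cond: "\<not> cond_val s1 (unfin (Reg rz))"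
      and t: "t + ?\<mu> s1 \<le> ?\<mu> s + cond_time (unfin (Reg rz)) + 1"
    have "pick_mem s0 s1" using I by (simp add: choose_inv_def)
    then have fz: "fin (arr s1 adn) (reg s1 rz)" using cond pick_memD(5) by (auto simp: fin_def)
    have "pot (arr s1 adn) \<le> pot (arr s adn)" using I by simp
    moreover have "t + 300 * pot (arr s1 adn) \<le> 300 * pot (arr s adn) + 6" using t by simp
    ultimately have "t - 20 + 300 * pot (arr s1 adn) \<le> 300 * pot (arr s adn)" by linarith
    with fz show "Q t s1" using I t by (intro post) (auto simp: step_post_def)
  qed
qed

lemma wp_choose_all:
  assumes mem: "pick_mem s s" and zero: "arr s adn = (\<lambda>_. 0)" "arr s amt = (\<lambda>_. 0)"
    and out: "arr s aout = df" and C: "reg s rC = C"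
    and post: "\<And>t s' SX SM. pick_mem s s' \<Longrightarrow> arr s' aout = out_fun SX SM \<Longrightarrow>
      static_inv (arr s' adn) (arr s' amt) {} SX SM \<Longrightarrow> reg s' rC = C \<Longrightarrow>
      (\<And>i. 1 \<le> i \<Longrightarrow> i \<le> C \<Longrightarrow> col (U (se i)) < 2 \<Longrightarrow> arr s' adn i \<noteq> 0) \<Longrightarrow>
      t \<le> 1000 * m + 100 \<Longrightarrow> Q t s'"
  shows "wp choose_all Q s"
proof -
  let ?I = "\<lambda>s1. choose_inv s s1 \<and> reg s1 rC = C \<and> reg s1 rj \<le> C
    \<and> fin (arr s1 adn) (reg s1 rz) \<and> fin (arr s1 adn) (reg s1 rpd)
    \<and> (\<forall>i. 1 \<le> i \<longrightarrow> i \<le> reg s1 rj \<longrightarrow> col (U (se i)) < 2 \<longrightarrow> arr s1 adn i \<noteq> 0)"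
  \<comment> \<open>All chains draw on the same \<open>pot\<close>, so their total cost is linear
    although a single chain may break many cycles.\<close>
  let ?\<mu> = "\<lambda>s1. 100 * (C - reg s1 rj) + 300 * pot (arr s1 adn)"
  have body: "wp (block [
       Set_Reg rj (Add (Reg rj) (Const 1)),
       If (Less (Arr acol (Arr ase (Reg rj))) (Const 2)) (block [
         Set_Reg rz (Arr aU (Arr ase (Reg rj))),
         Set_Reg rcm (Const 0),
         choose_loop]) Skip])
    (\<lambda>t s'. ?I s' \<and> t + cond_time (Less (Reg rj) (Reg rC)) + 1 + ?\<mu> s' \<le> ?\<mu> s1) s1"
    if I: "?I s1" and cond: "cond_val s1 (Less (Reg rj) (Reg rC))" for s1
  proof -
    define i where "i = reg s1 rj + 1"
    have i: "1 \<le> i" "i \<le> C" "reg s1 rj + 1 \<le> B" "reg s1 rj = i - 1" using I cond C_le m_le by (auto simp: i_def)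
    obtain SX SM where mem1: "pick_mem s s1" and o1: "arr s1 aout = out_fun SX SM"
      and st: "static_inv (arr s1 adn) (arr s1 amt) {} SX SM"
      and ch: "chain_inv (arr s1 adn) (arr s1 amt) SM (reg s1 rz) (reg s1 rcm) (reg s1 rpd)"
      using I unfolding choose_inv_def by blast
    have iB: "i \<le> B" using i(3) by (simp add: i_def)
    note md = pick_memD[OF mem1]
    have ids: "cid (U (se i)) = i" using se_orbit(2) i by simp
    show ?thesis
    proof (cases "col (U (se i)) < 2")
      case True
      let ?s2 = "setr rcm 0 (setr rz (U (se i)) (setr rj i s1))"
      have dn0: "arr s1 adn 0 \<noteq> 0" using st by (simp add: static_inv_def)
      have inv2: "choose_inv s ?s2"
        unfolding choose_inv_def
        using o1 st chain_inv_start[OF ch _ _ True dn0] I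
        by (intro conjI exI[of _ SX] exI[of _ SM] pick_mem_set mem1) auto
      show ?thesis
        apply (rule vc_wp)
        apply (simp add: small_def iB i_def[symmetric] vc_opaque md md(11)[OF i(1,2)] True)
        apply (rule wp_choose_loop[OF inv2])
        subgoal using I by simp
        subgoal premises p for t s'
        proof -
          have s': "reg s' rj = i" "reg s' rC = C" "choose_inv s s'"
            and mono: "\<And>k. arr s1 adn k \<noteq> 0 \<Longrightarrow> arr s' adn k \<noteq> 0"
            and t: "t - 20 + 300 * pot (arr s' adn) \<le> 300 * pot (arr s1 adn)"
            using p(1) I by (auto simp: step_post_def)
          have "arr s' adn i \<noteq> 0" using p(1) ids by (simp add: step_post_def fin_def)
          then have "arr s' adn k \<noteq> 0" if "1 \<le> k" "k \<le> i" "col (U (se k)) < 2" for k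
            using that I mono[of k] i(4) by (cases "k = i") auto
          then show ?thesis using s' p i t I by auto
        qed
        done
    next
      case False
      have "choose_inv s (setr rj i s1)"
        unfolding choose_inv_def using o1 st ch pick_mem_set(1)[OF mem1, of rj i]
        by (intro conjI exI[of _ SX] exI[of _ SM]) simp_all
      moreover have "arr s1 adn k \<noteq> 0" if "1 \<le> k" "k \<le> i" "col (U (se k)) < 2" for k
      proof -
        have "k \<noteq> i" using that(3) False by auto
        then show ?thesis using that I i(4) by auto
      qed
      moreover have "20 + 100 * (C - i) \<le> 100 * (C - reg s1 rj)" using i by simp
      ultimately show ?thesis
        using I i(2)
        by (intro vc_wp) (simp add: small_def iB i_def[symmetric] md md(11)[OF i(1,2)] False)
    qed
  qed
  have L: "L \<subseteq> {..<m}" using core by (simp add: core_def)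
  define s1 where "s1 = seta adn 0 1 (setr rpd 0 (setr rcm 0 (setr rz 0 (setr rj 0 s))))"
  have dn1: "arr s1 adn = (\<lambda>i. if i = 0 then 1 else 0)" using zero by (auto simp: s1_def)
  have "static_inv (arr s1 adn) (arr s1 amt) {} {} {}"
    unfolding static_inv_def dn1 using zero path_forest_empty by (auto simp: s1_def fin_def xedges_def moved_def)
  moreover have "chain_inv (arr s1 adn) (arr s1 amt) {} (reg s1 rz) (reg s1 rcm) (reg s1 rpd)"
    using zero cid_0 by (auto simp: chain_inv_def s1_def fin_def)
  moreover have "pick_mem s s1" unfolding s1_def by (intro pick_mem_set mem) auto
  moreover have o1: "arr s1 aout = out_fun {} {}" using out by (simp add: s1_def out_fun_def fun_eq_iff)
  ultimately have I1: "?I s1"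
    using C cid_0 o1 unfolding choose_inv_def
    by (intro conjI exI[of _ "{}"]) (simp_all add: s1_def fin_def)
  show ?thesis
    unfolding choose_all_def
    apply (rule vc_wp)
    apply (simp add: small_def s1_def[symmetric])
    apply (rule wp_While[where I = ?I and \<mu> = ?\<mu>, OF I1 _ body[unfolded block.simps]])
    subgoal by (simp add: small_def)
    subgoal by simp
    subgoal by simp
    subgoal premises p for t s2
    proof -
      obtain SX SM where mem2: "pick_mem s s2" and o2: "arr s2 aout = out_fun SX SM"
        and st: "static_inv (arr s2 adn) (arr s2 amt) {} SX SM"
        using p(1) unfolding choose_inv_def by blast
      have rj: "reg s2 rj = C" "reg s2 rC = C" using p(1,2) by auto
      have t: "t \<le> 300 * pot (arr s1 adn) + 100 * (C - reg s1 rj) + 10" using p(3) by simp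
      also have "\<dots> \<le> 600 * m + 100 * m + 10" using pot_le[of "arr s1 adn"] C_le by simp
      finally have t: "t \<le> 700 * m + 10" by simp
      have dn: "arr s2 adn i \<noteq> 0" if "1 \<le> i" "i \<le> C" "col (U (se i)) < 2" for i
        using p(1) that rj by simp
      show ?thesis
        by simp (rule post[OF mem2 o2 st rj(2) dn], use t in simp_all)
    qed
    done
qed

section \<open>Breaking the cycles of colour 2\<close>

definition link_inv :: "state \<Rightarrow> nat \<Rightarrow> state \<Rightarrow> bool" where
  "link_inv s0 r s \<longleftrightarrow> pick_mem s0 s \<and> reg s rC = C
     \<and> (\<exists>I SX SM. arr s aout = out_fun SX SM \<and> static_inv (arr s adn) (arr s amt) I SX SM
          \<and> I \<subseteq> xv ` {y. cid y \<noteq> 0 \<and> \<not> col y < 2 \<and> cid y \<le> r})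
     \<and> (\<forall>i. 1 \<le> i \<longrightarrow> i \<le> C \<longrightarrow> col (U (se i)) < 2 \<or> i \<le> r \<longrightarrow> arr s adn i \<noteq> 0)"

lemma wp_link_step:
  assumes inv: "link_inv s0 (i - 1) s" and i: "1 \<le> i" "i \<le> C" "reg s rj = i" and col: "\<not> col (U (se i)) < 2"
    and post: "\<And>t s'. link_inv s0 i s' \<Longrightarrow> reg s' rj = i \<Longrightarrow> t \<le> 80 \<Longrightarrow> Q t s'"
  shows "wp link_step Q s"
proof -
  obtain I SX SM where mem: "pick_mem s0 s" and C: "reg s rC = C" and out: "arr s aout = out_fun SX SM"
    and st: "static_inv (arr s adn) (arr s amt) I SX SM"
    and I: "I \<subseteq> xv ` {y. cid y \<noteq> 0 \<and> \<not> col y < 2 \<and> cid y \<le> i - 1}"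
    and dn: "\<And>k. 1 \<le> k \<Longrightarrow> k \<le> C \<Longrightarrow> col (U (se k)) < 2 \<or> k \<le> i - 1 \<Longrightarrow> arr s adn k \<noteq> 0"
    using inv unfolding link_inv_def by blast
  note md = pick_memD[OF mem]
  define mt where "mt = arr s amt"
  define a0 where "a0 = U (se i)"
  have a0: "cid a0 = i" using se_orbit(2) i by (simp add: a0_def)
  have ca0: "cid a0 \<noteq> 0" using a0 i by simp
  define b0 where "b0 = nx a0"
  define a where "a = (if tip mt (xv a0) = xv b0 then b0 else a0)"
  define b where "b = nx a"
  have cb0: "cid b0 = i" "cid b0 \<noteq> 0" using nx_facts(1)[OF ca0] a0 i by (auto simp: b0_def)
  have ca: "cid a = i" "cid a \<noteq> 0" using a0 ca0 cb0 by (auto simp: a_def)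
  have cb: "cid b = i" "cid b \<noteq> 0" using nx_facts(1)[OF ca(2)] ca by (auto simp: b_def)
  have colz: "\<not> col z < 2" if "cid z = i" for z
    using col_cid[of a0 z] that a0 ca0 col by (simp add: a0_def)
  \<comment> \<open>Inner vertices arise only on cycles of colour 2 treated before, and within a
    triple these share no vertex with the current cycle. So all vertices of this cycle are ends of
    paths.\<close>
  have notI: "xv z \<notin> I" if "cid z = i" for z
  proof
    assume "xv z \<in> I"
    then obtain y where y: "xv z = xv y" "cid y \<noteq> 0" "\<not> col y < 2" "cid y \<le> i - 1" using I by blast
    then have "y = z" using xv_eq2[of z y] colz[OF that] that i by auto
    then show False using y that i by simp
  qed
  have xne: "xv z \<noteq> xv (nx z)" if "cid z = i" for z
    using xv_eq2[of z "nx z"] colz[OF that] colz[of "nx z"] nx_facts(1,3)[of z] that i by auto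
  have tipne: "tip mt (xv a) \<noteq> xv b"
  proof (cases "tip mt (xv a0) = xv b0")
    case True
    \<comment> \<open>As \<open>tip mt\<close> is an involution on ends, \<open>b0\<close> shares
      its path with \<open>a0\<close> and hence not with the third vertex
      \<open>nx b0\<close>.\<close>
    have "tip mt (tip mt (xv a0)) = xv a0"
      using st notI[OF a0] unfolding static_inv_def path_forest_def mt_def by blast
    then have "tip mt (xv b0) = xv a0" using True by simp
    moreover have "xv a0 \<noteq> xv (nx b0)"
    proof
      assume "xv a0 = xv (nx b0)"
      then have "nx b0 = a0"
        using xv_eq2[of a0 "nx b0"] colz[OF a0] colz[of "nx b0"] nx_facts(1)[OF cb0(2)] cb0 ca0 by auto
      then show False using nx_facts(4)[OF ca0] by (simp add: b0_def)
    qed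
    ultimately show ?thesis using True by (simp add: a_def b_def)
  next
    case False
    then show ?thesis by (simp add: a_def b_def b0_def)
  qed
  define ta where "ta = tip mt (xv a)"
  define tb where "tb = tip mt (xv b)"
  have ed: "ed (ne a) = {a, b}" using nx_facts(6)[OF ca(2)] by (simp add: b_def)
  have st': "static_inv ((arr s adn)(i := 1)) (mt(ta := tb, tb := ta)) (I \<union> ({xv a, xv b} - {ta, tb})) (insert (ne a) SX) SM"
    using static_inv_select[OF st ca(2) ed notI[OF ca(1)] notI[OF cb(1)]] xne[OF ca(1)] tipne
      xv_pos[OF ca(2)] xv_pos[OF cb(2)] ca(1) by (simp add: ta_def tb_def mt_def b_def)
  have I': "I \<union> ({xv a, xv b} - {ta, tb}) \<subseteq> xv ` {y. cid y \<noteq> 0 \<and> \<not> col y < 2 \<and> cid y \<le> i}"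
    using I ca cb colz by fastforce
  have fin: "link_inv s0 i s'"
    if "pick_mem s0 s'" "reg s' rC = C" "arr s' aout = (arr s aout)(ne a := x4 (ne a))"
      "arr s' amt = mt(ta := tb, tb := ta)" "arr s' adn = (arr s adn)(i := 1)" for s'
    unfolding link_inv_def
  proof (intro conjI that(1,2))
    show "\<exists>I SX SM. arr s' aout = out_fun SX SM \<and> static_inv (arr s' adn) (arr s' amt) I SX SM
          \<and> I \<subseteq> xv ` {y. cid y \<noteq> 0 \<and> \<not> col y < 2 \<and> cid y \<le> i}"
      unfolding that(3-5) out out_fun_select
      by (intro exI conjI) (rule refl, rule st', rule I')
    show "\<forall>k. 1 \<le> k \<longrightarrow> k \<le> C \<longrightarrow> col (U (se k)) < 2 \<or> k \<le> i \<longrightarrow> arr s' adn k \<noteq> 0"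
    proof (intro allI impI)
      fix k assume k: "1 \<le> k" "k \<le> C" "col (U (se k)) < 2 \<or> k \<le> i"
      show "arr s' adn k \<noteq> 0"
      proof (cases "k = i")
        case False
        then have "k \<le> i \<Longrightarrow> k \<le> i - 1" by linarith
        then show ?thesis using dn[OF k(1,2)] k(3) False unfolding that(5) by auto
      qed (simp add: that(5))
    qed
  qed
  note vals = small_def md i(3) mt_def[symmetric] a0_def[symmetric] b0_def[symmetric]
  show ?thesis
  proof (cases "tip mt (xv a0) = xv b0")
    case True
    then have ab: "b0 = a" "nx a = b" by (auto simp: a_def b_def)
    note True' = True[unfolded ab]
    show ?thesis
      unfolding link_step_def
      apply (rule vc_wp)
      apply (insert True')
      apply (cases "mt (xv a0) = 0"; cases "mt (xv a) = 0"; cases "mt (xv b) = 0")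
      apply (simp_all add: vals ab tip_def)
      apply (intro post fin pick_mem_set mem; simp add: vals ab C ta_def tb_def tip_def)+
      done
  next
    case False
    then have ab: "a0 = a" "b0 = b" "nx a = b" by (auto simp: a_def b_def b0_def)
    note False' = False[unfolded ab(1,2)]
    show ?thesis
      unfolding link_step_def
      apply (rule vc_wp)
      apply (insert False')
      apply (cases "mt (xv a) = 0"; cases "mt (xv b) = 0")
      apply (simp_all add: vals ab tip_def)
      apply (intro post fin pick_mem_set mem; simp add: vals ab C ta_def tb_def tip_def)+
      done
  qed
qed

lemma wp_link_all:
  assumes mem: "pick_mem s0 s" and out: "arr s aout = out_fun SX SM"
    and st: "static_inv (arr s adn) (arr s amt) {} SX SM" and C: "reg s rC = C"
    and dn: "\<And>i. 1 \<le> i \<Longrightarrow> i \<le> C \<Longrightarrow> col (U (se i)) < 2 \<Longrightarrow> arr s adn i \<noteq> 0"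
    and post: "\<And>t s'. link_inv s0 C s' \<Longrightarrow> t \<le> 200 * m + 100 \<Longrightarrow> Q t s'"
  shows "wp link_all Q s"
proof -
  let ?I = "\<lambda>s1. link_inv s0 (reg s1 rj) s1 \<and> reg s1 rj \<le> C"
  let ?\<mu> = "\<lambda>s1. 200 * (C - reg s1 rj)"
  have body: "wp (block [
       Set_Reg rj (Add (Reg rj) (Const 1)),
       If (Less (Arr acol (Arr ase (Reg rj))) (Const 2)) Skip link_step])
    (\<lambda>t s'. ?I s' \<and> t + cond_time (Less (Reg rj) (Reg rC)) + 1 + ?\<mu> s' \<le> ?\<mu> s1) s1"
    if I: "?I s1" and cond: "cond_val s1 (Less (Reg rj) (Reg rC))" for s1
  proof -
    define i where "i = reg s1 rj + 1"
    have C1: "reg s1 rC = C" and mem1: "pick_mem s0 s1" using I by (auto simp: link_inv_def)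
    have i: "1 \<le> i" "i \<le> C" "reg s1 rj + 1 \<le> B" "reg s1 rj = i - 1" using I cond C1 C_le m_le by (auto simp: i_def)
    have iB: "i \<le> B" using i(3) by (simp add: i_def)
    note md = pick_memD[OF mem1]
    let ?s2 = "setr rj i s1"
    have inv2: "link_inv s0 (i - 1) ?s2"
      using I i(4) pick_mem_set(1)[OF mem1, of rj i] by (simp add: link_inv_def)
    have inv3: "link_inv s0 i ?s2" if col: "col (U (se i)) < 2"
    proof -
      obtain I SX SM where *: "arr s1 aout = out_fun SX SM" "static_inv (arr s1 adn) (arr s1 amt) I SX SM"
          "I \<subseteq> xv ` {y. cid y \<noteq> 0 \<and> \<not> col y < 2 \<and> cid y \<le> i - 1}"
          "\<And>k. 1 \<le> k \<Longrightarrow> k \<le> C \<Longrightarrow> col (U (se k)) < 2 \<or> k \<le> i - 1 \<Longrightarrow> arr s1 adn k \<noteq> 0"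
        using inv2 unfolding link_inv_def by (simp, blast)
      have "I \<subseteq> xv ` {y. cid y \<noteq> 0 \<and> \<not> col y < 2 \<and> cid y \<le> i}"
        using *(3) by (rule subset_trans) auto
      moreover have "arr s1 adn k \<noteq> 0" if k: "1 \<le> k" "k \<le> C" "col (U (se k)) < 2 \<or> k \<le> i" for k
      proof (cases "k = i")
        case True
        then show ?thesis using *(4)[OF k(1,2)] col by simp
      next
        case False
        then have "k \<le> i \<Longrightarrow> k \<le> i - 1" by linarith
        then show ?thesis using *(4)[OF k(1,2)] k(3) by blast
      qed
      ultimately show ?thesis
        unfolding link_inv_def using *(1,2) C1 pick_mem_set(1)[OF mem1, of rj i]
        by (intro conjI exI[of _ I] exI[of _ SX] exI[of _ SM]) simp_all
    qed
    show ?thesis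
      unfolding block.simps
      apply (rule wp_Seq, rule wp_Set_Reg; (simp add: small_def iB i_def[symmetric])?)
      apply (rule wp_Seq, rule wp_If)
      subgoal by (simp add: small_def)
      subgoal premises p
        apply (rule vc_wp, simp only: vc.simps, rule vc_wp)
        using p inv3 i by (simp add: md md(11)[OF i(1,2)])
      subgoal premises p
        apply (rule wp_link_step[OF inv2 i(1,2)])
        subgoal by simp
        subgoal using p by (simp add: md md(11)[OF i(1,2)])
        subgoal for t s'
          using i by (intro vc_wp) auto
        done
      done
  qed
  have I0: "?I (setr rj 0 s)"
    unfolding link_inv_def using pick_mem_set(1)[OF mem] out st C dn by auto
  show ?thesis
    unfolding link_all_def
    apply (rule vc_wp)
    apply (simp add: small_def)
    apply (rule wp_While[where I = ?I and \<mu> = ?\<mu>, OF I0 _ body[unfolded block.simps]])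
    subgoal by (simp add: small_def)
    subgoal by simp
    subgoal by simp
    subgoal premises p for t s2
    proof -
      have "reg s2 rj = C" using p by (auto simp: link_inv_def)
      then show ?thesis using p C_le by (auto intro!: post)
    qed
    done
qed

text \<open>Every cycle has lost a selected or moved edge, so what remains is a forest, and
  \<open>safe\<close> allows the moved edges to be added in their new places.\<close>

lemma link_inv_final:
  assumes "link_inv s0 C s"
  obtains SX SM where "arr s aout = out_fun SX SM" "forest (xedges SX)"
    "forest (all_edges - ed ` (SX \<union> SM) \<union> moved SM)"
    "\<And>j. j \<in> SX \<union> SM \<Longrightarrow> j < m"
    "\<And>j. j \<in> SM \<Longrightarrow> \<exists>y. main y \<and> ed j = {y, nx y} \<and> cid (opp y) \<noteq> 0 \<and> cid (opp (nx y)) \<noteq> 0"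
proof -
  obtain I SX SM where out: "arr s aout = out_fun SX SM"
    and st: "static_inv (arr s adn) (arr s amt) I SX SM"
    and dn: "\<And>i. 1 \<le> i \<Longrightarrow> i \<le> C \<Longrightarrow> arr s adn i \<noteq> 0"
    using assms unfolding link_inv_def by blast
  have fin: "fin (arr s adn) y" if "cid y \<noteq> 0" for y
    using dn[of "cid y"] that cid_le[of y] by (simp add: fin_def)
  have "forest (all_edges - ed ` (SX \<union> SM))"
  proof (rule forest_missing_edges)
    fix z assume "cid z \<noteq> 0"
    then obtain y where "cid y = cid z" "ne y \<in> SX \<union> SM"
      using st fin[of z] unfolding static_inv_def by blast
    then show "\<exists>y. cid y = cid z \<and> ed (ne y) \<notin> all_edges - ed ` (SX \<union> SM)" by blast
  qed auto
  then have f: "forest (all_edges - ed ` (SX \<union> SM) \<union> moved SM)"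
    using st unfolding static_inv_def safe_def by blast
  have lt: "j < m" if j: "j \<in> SX \<union> SM" for j
  proof -
    obtain y where "j = ne y" "cid y \<noteq> 0" using st j unfolding static_inv_def by blast
    then show ?thesis using nx_facts(5) by simp
  qed
  have mv: "\<exists>y. main y \<and> ed j = {y, nx y} \<and> cid (opp y) \<noteq> 0 \<and> cid (opp (nx y)) \<noteq> 0" if j: "j \<in> SM" for j
  proof -
    obtain y where y: "j = ne y" "main y" "cid (opp (U j)) \<noteq> 0" "cid (opp (V j)) \<noteq> 0"
      using st j unfolding static_inv_def by blast
    have e: "ed j = {y, nx y}" using nx_facts(6)[of y] y by (simp add: main_def)
    have "cid (opp x) \<noteq> 0" if "x \<in> ed j" for x using that y(3,4) by (auto simp: ed_def)
    then show ?thesis using y(2) e by auto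
  qed
  show ?thesis
    using that[OF out _ f lt mv] st unfolding static_inv_def path_forest_def by blast
qed

end

section \<open>Renumbering the pseudoforests\<close>

text \<open>An array that has been filled on \<open>S\<close> while its other cells still hold the
  initial 0.\<close>

definition onset :: "(nat \<Rightarrow> nat) \<Rightarrow> nat set \<Rightarrow> nat \<Rightarrow> nat" where
  "onset g S x = (if x \<in> S then g x else 0)"

lemma onset_upd: "(onset g S)(x := g x) = onset g (insert x S)"
  by (auto simp: onset_def)

lemma onset_zero: "g x = 0 \<Longrightarrow> onset g (insert x S) = onset g S"
  by (auto simp: onset_def)

lemma onset_empty: "onset g {} = (\<lambda>_. 0)"
  by (auto simp: onset_def)

locale renumbering =
  fixes n m :: nat and src tgt f :: "nat \<Rightarrow> nat"
  assumes src: "j < m \<Longrightarrow> src j < n" and tgt: "j < m \<Longrightarrow> tgt j < n"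
    and src_ne_tgt: "j < m \<Longrightarrow> src j \<noteq> tgt j"
begin

text \<open>Parts are numbered in the order of their first edges.\<close>

definition gid :: "nat \<Rightarrow> nat" where
  "gid p = card (f ` {..<(LEAST i. f i = p)})"

definition part :: "nat \<Rightarrow> nat" where
  "part j = gid (f j)"

text \<open>Copies of vertices are positive numbers, because 0 marks unset memory.\<close>

definition vU :: "nat \<Rightarrow> nat" where "vU j = 1 + part j * n + src j"
definition vV :: "nat \<Rightarrow> nat" where "vV j = 1 + part j * n + tgt j"

definition blk :: "nat \<Rightarrow> nat" where "blk z = (z - 1) div n"
definition vcol :: "nat \<Rightarrow> nat" where "vcol z = blk z mod 3"

text \<open>Colour 2 has no counterpart; the value 0 is the copy of no vertex.\<close>

definition vopp :: "nat \<Rightarrow> nat" where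
  "vopp z = (if vcol z = 0 then z + n else if vcol z = 1 then z - n else 0)"

text \<open>The number of the colour 0 copy serves as the common name within a triple.\<close>

definition vxv :: "nat \<Rightarrow> nat" where
  "vxv z = (if vcol z = 0 then z else if vcol z = 1 then z - n else z - n - n)"

definition ends :: "nat \<Rightarrow> nat set" where
  "ends j = vU ` {..<j} \<union> vV ` {..<j}"

text \<open>Triple \<open>t\<close> owns the output forests \<open>4 * t\<close> to
  \<open>4 * t + 3\<close>: the first is the extra forest, and colour \<open>c\<close> has the
  number \<open>4 * t + 1 + c\<close>. Hence \<open>2 - c\<close> is the offset of the other colour
  when \<open>c < 2\<close>.\<close>

definition ecol :: "nat \<Rightarrow> nat" where "ecol j = part j mod 3"
definition ex4 :: "nat \<Rightarrow> nat" where "ex4 j = 4 * (part j div 3)"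
definition edf :: "nat \<Rightarrow> nat" where "edf j = ex4 j + ecol j + 1"
definition ealt :: "nat \<Rightarrow> nat" where "ealt j = ex4 j + (2 - ecol j)"

lemma gid_new:
  assumes "f j \<notin> f ` {..<j}"
  shows "gid (f j) = card (f ` {..<j})"
proof -
  have "(LEAST i. f i = f j) = j"
    using assms by (intro Least_equality refl) (metis imageI lessThan_iff not_less)
  then show ?thesis by (simp add: gid_def)
qed

lemma gid_less:
  assumes "i < j" shows "gid (f i) < card (f ` {..<j})"
proof -
  define l where "l = (LEAST l. f l = f i)"
  have l: "f l = f i" "l \<le> i" unfolding l_def by (auto intro: LeastI Least_le)
  have "f i' \<noteq> f i" if "i' < l" for i'
    using not_less_Least[of i' "\<lambda>l. f l = f i"] that unfolding l_def by blast
  then have "f i \<notin> f ` {..<l}" by force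
  moreover have "f i \<in> f ` {..<j}" using assms by blast
  moreover have "f ` {..<l} \<subseteq> f ` {..<j}" using l(2) assms by (intro image_mono) auto
  ultimately have "f ` {..<l} \<subset> f ` {..<j}" by blast
  then show ?thesis unfolding gid_def l_def[symmetric] by (intro psubset_card_mono) auto
qed

text \<open>The number of parts seen so far increases strictly from one first occurrence to a later
  one.\<close>

lemma gid_inj: "gid (f i) = gid (f j) \<Longrightarrow> f i = f j"
proof (rule ccontr)
  assume eq: "gid (f i) = gid (f j)" and ne: "f i \<noteq> f j"
  define a where "a = (LEAST l. f l = f i)"
  define b where "b = (LEAST l. f l = f j)"
  have ab: "f a = f i" "f b = f j" unfolding a_def b_def by (auto intro: LeastI)
  have card: "gid (f i) = card (f ` {..<a})" "gid (f j) = card (f ` {..<b})"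
    by (simp_all add: gid_def a_def b_def)
  have "gid (f i) < gid (f j)" if "a < b"
    using gid_less[OF that] card ab by simp
  moreover have "gid (f j) < gid (f i)" if "b < a"
    using gid_less[OF that] card ab by simp
  ultimately show False using eq ne ab by (metis linorder_neqE_nat less_irrefl)
qed

lemma part_less: "j < m \<Longrightarrow> part j < m"
  using gid_less[of j m] card_image_le[of "{..<m}" f] by (simp add: part_def)

lemma blk_eq: "a < n \<Longrightarrow> blk (1 + p * n + a) = p"
  by (simp add: blk_def)

lemma blk_ends: "j < m \<Longrightarrow> blk (vU j) = part j" "j < m \<Longrightarrow> blk (vV j) = part j"
  using blk_eq src tgt by (simp_all add: vU_def vV_def)

lemma vU_ne_vV: "j < m \<Longrightarrow> vU j \<noteq> vV j"
  using src_ne_tgt by (simp add: vU_def vV_def)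

lemma ends_Suc: "ends (j + 1) = insert (vV j) (insert (vU j) (ends j))"
  by (auto simp: ends_def less_plus_1_iff)

definition deg_upto :: "nat \<Rightarrow> nat \<Rightarrow> nat" where
  "deg_upto j z = card {i. i < j \<and> z \<in> {vU i, vV i}}"

definition sum_upto :: "nat \<Rightarrow> nat \<Rightarrow> nat" where
  "sum_upto j z = \<Sum>{i. i < j \<and> z \<in> {vU i, vV i}}"

lemma inc_upto_Suc: "{i. i < j + 1 \<and> z \<in> {vU i, vV i}}
    = (if z \<in> {vU j, vV j} then insert j {i. i < j \<and> z \<in> {vU i, vV i}} else {i. i < j \<and> z \<in> {vU i, vV i}})"
  by (auto simp: less_plus_1_iff)

lemma deg_upto_Suc: "deg_upto (j + 1) z = deg_upto j z + (if z \<in> {vU j, vV j} then 1 else 0)"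
  unfolding deg_upto_def inc_upto_Suc by simp

lemma sum_upto_Suc: "sum_upto (j + 1) z = sum_upto j z + (if z \<in> {vU j, vV j} then j else 0)"
  unfolding sum_upto_def inc_upto_Suc by simp

lemma deg_upto_le: "deg_upto j z \<le> j"
proof -
  have "deg_upto j z \<le> card {..<j}" unfolding deg_upto_def by (intro card_mono) auto
  then show ?thesis by simp
qed

lemma sum_upto_le: "sum_upto j z \<le> j * j"
proof -
  have "sum_upto j z \<le> (\<Sum>i\<in>{..<j}. i)" unfolding sum_upto_def by (intro sum_mono2) auto
  also have "\<dots> \<le> (\<Sum>i\<in>{..<j}. j)" by (intro sum_mono) auto
  finally show ?thesis by simp
qed

end

section \<open>Computing the copies in one pass over the edges\<close>

abbreviation (input) "rn \<equiv> 0 :: nat"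
abbreviation (input) "rbase \<equiv> 4 :: nat"
abbreviation (input) "rcol \<equiv> 5 :: nat"
abbreviation (input) "rx \<equiv> 6 :: nat"
abbreviation (input) "rpart \<equiv> 7 :: nat"
abbreviation (input) "asrc \<equiv> 0 :: nat"
abbreviation (input) "atgt \<equiv> 1 :: nat"
abbreviation (input) "apart \<equiv> 2 :: nat"
abbreviation (input) "abase \<equiv> 4 :: nat"
abbreviation (input) "apcol \<equiv> 5 :: nat"
abbreviation (input) "apx \<equiv> 6 :: nat"

definition prepare_end :: "nat \<Rightarrow> com" where
  "prepare_end a = block [
     Set_Reg rz (Arr a (Reg rj)),
     Set_Arr adeg (Reg rz) (Add (Arr adeg (Reg rz)) (Const 1)),
     Set_Arr asum (Reg rz) (Add (Arr asum (Reg rz)) (Reg rj)),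
     If (Equal (Arr acol (Reg rj)) (Const 0))
       (block [
         Set_Arr aopp (Reg rz) (Add (Reg rz) (Reg rn)),
         Set_Arr axv (Reg rz) (Reg rz)])
       (If (Equal (Arr acol (Reg rj)) (Const 1))
         (block [
           Set_Arr aopp (Reg rz) (Sub (Reg rz) (Reg rn)),
           Set_Arr axv (Reg rz) (Sub (Reg rz) (Reg rn))])
         (Set_Arr axv (Reg rz) (Sub (Sub (Reg rz) (Reg rn)) (Reg rn))))]"

text \<open>Without multiplication and division, the values \<open>1 + p * n\<close>,
  \<open>p mod 3\<close> and \<open>4 * (p div 3)\<close> of the next new part are kept in counters.
  A stored base is at least 1, so 0 shows that a part has not occurred yet.\<close>

definition prepare_part :: com where
  "prepare_part = block [
     Set_Reg rpart (Arr apart (Reg rj)),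
     If (Equal (Arr abase (Reg rpart)) (Const 0))
       (block [
         Set_Arr abase (Reg rpart) (Reg rbase),
         Set_Arr apcol (Reg rpart) (Reg rcol),
         Set_Arr apx (Reg rpart) (Reg rx),
         Set_Reg rbase (Add (Reg rbase) (Reg rn)),
         If (Equal (Reg rcol) (Const 2))
           (block [Set_Reg rcol (Const 0), Set_Reg rx (Add (Reg rx) (Const 4))])
           (Set_Reg rcol (Add (Reg rcol) (Const 1)))])
       Skip]"

definition prepare_edge :: com where
  "prepare_edge = block [
     Set_Arr aU (Reg rj) (Add (Arr abase (Reg rpart)) (Arr asrc (Reg rj))),
     Set_Arr aV (Reg rj) (Add (Arr abase (Reg rpart)) (Arr atgt (Reg rj))),
     Set_Arr acol (Reg rj) (Arr apcol (Reg rpart)),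
     Set_Arr ax4 (Reg rj) (Arr apx (Reg rpart)),
     Set_Arr aout (Reg rj) (Add (Add (Arr apx (Reg rpart)) (Arr apcol (Reg rpart))) (Const 1)),
     Set_Arr aalt (Reg rj) (Add (Arr apx (Reg rpart)) (Sub (Const 2) (Arr apcol (Reg rpart))))]"

definition prepare :: com where
  "prepare = block [
     Set_Reg rj (Const 0),
     Set_Reg rbase (Const 1),
     Set_Reg rcol (Const 0),
     Set_Reg rx (Const 0),
     While (Less (Reg rj) (Reg rm)) (block [
       prepare_part,
       prepare_edge,
       prepare_end aU,
       prepare_end aV,
       Set_Reg rj (Add (Reg rj) (Const 1))])]"

text \<open>The terms bound sums of two copies, copies shifted by \<open>n\<close>, the sums of edge
  indices kept in \<open>asum\<close>, and the numbers of the output forests.\<close>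

locale prepare_machine = machine W B + renumbering n m src tgt f
  for W B n m src tgt f +
  assumes size_le: "2 + 2 * m * n + 2 * n + m * m + 4 * m + 4 \<le> B"
begin

definition parts_inv :: "nat set \<Rightarrow> state \<Rightarrow> bool" where
  "parts_inv D s \<longleftrightarrow> arr s abase = onset (\<lambda>p. 1 + gid p * n) D
     \<and> arr s apcol = onset (\<lambda>p. gid p mod 3) D \<and> arr s apx = onset (\<lambda>p. 4 * (gid p div 3)) D
     \<and> reg s rbase = 1 + card D * n \<and> reg s rcol = card D mod 3 \<and> reg s rx = 4 * (card D div 3)"

definition edges_inv :: "nat \<Rightarrow> state \<Rightarrow> bool" where
  "edges_inv j s \<longleftrightarrow> arr s aU = onset vU {..<j} \<and> arr s aV = onset vV {..<j}
     \<and> arr s acol = onset ecol {..<j} \<and> arr s ax4 = onset ex4 {..<j}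
     \<and> arr s aout = onset edf {..<j} \<and> arr s aalt = onset ealt {..<j}"

definition verts_inv :: "(nat \<Rightarrow> nat) \<Rightarrow> (nat \<Rightarrow> nat) \<Rightarrow> nat set \<Rightarrow> state \<Rightarrow> bool" where
  "verts_inv dg sm D s \<longleftrightarrow> arr s adeg = dg \<and> arr s asum = sm
     \<and> arr s aopp = onset vopp D \<and> arr s axv = onset vxv D"

definition input_inv :: "state \<Rightarrow> state \<Rightarrow> bool" where
  "input_inv s0 s \<longleftrightarrow> same_arrays {3..15} s0 s \<and> reg s0 rn = n \<and> reg s0 rm = m
     \<and> arr s0 asrc = onset src {..<m} \<and> arr s0 atgt = onset tgt {..<m} \<and> arr s0 apart = onset f {..<m}"

lemma input_invD:
  assumes "input_inv s0 s"
  shows "reg s rn = n" "reg s rm = m" "arr s asrc = onset src {..<m}" "arr s atgt = onset tgt {..<m}"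
    "arr s apart = onset f {..<m}"
  using assms by (auto simp: input_inv_def same_arrays_def)

lemma input_inv_set:
  "input_inv s0 s \<Longrightarrow> 3 \<le> x \<Longrightarrow> input_inv s0 (setr x v s)"
  "input_inv s0 s \<Longrightarrow> 3 \<le> a \<Longrightarrow> a \<le> 15 \<Longrightarrow> input_inv s0 (seta a i v s)"
  by (auto simp: input_inv_def same_arrays_def)

lemma size_bounds:
  assumes "j < m"
  shows "j + 1 \<le> B" "vU j + n \<le> B" "vV j + n \<le> B" "edf j \<le> B" "ealt j \<le> B" "ex4 j + ecol j \<le> B"
    "2 + vU j + vV j \<le> B"
proof -
  have p: "part j + 1 \<le> m" using part_less[OF assms] by simp
  have "(part j + 1) * n \<le> m * n" using p by (intro mult_right_mono) auto
  then have pn: "part j * n + n \<le> m * n" by (simp add: algebra_simps)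
  have s: "src j < n" "tgt j < n" using src tgt assms by auto
  have mn: "m * n + m * n = 2 * m * n" by simp
  show "j + 1 \<le> B" using assms size_le by linarith
  show "vU j + n \<le> B" "vV j + n \<le> B" "2 + vU j + vV j \<le> B"
    using pn s size_le mn unfolding vU_def vV_def by linarith+
  have d: "4 * (part j div 3) \<le> 4 * m" using p by (meson div_le_dividend le_trans mult_le_mono2 add_leD1)
  have c: "ecol j < 3" by (simp add: ecol_def)
  show "edf j \<le> B" "ealt j \<le> B" "ex4 j + ecol j \<le> B"
    using d c size_le unfolding edf_def ealt_def ex4_def by linarith+
qed

lemma wp_prepare_end:
  assumes inp: "input_inv s0 s" and j: "reg s rj = j" "j < m" and a: "arr s a j = z"
    and z: "z + n \<le> B" "blk z = part j" "dg z + 1 \<le> B" "sm z + j \<le> B"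
    and edges: "edges_inv (j + 1) s" and verts: "verts_inv dg sm D s"
    and post: "\<And>t s'. input_inv s0 s' \<Longrightarrow> reg s' rj = j \<Longrightarrow> edges_inv (j + 1) s' \<Longrightarrow>
      verts_inv (dg(z := dg z + 1)) (sm(z := sm z + j)) (insert z D) s' \<Longrightarrow>
      (\<And>E. parts_inv E s \<Longrightarrow> parts_inv E s') \<Longrightarrow> t \<le> 60 \<Longrightarrow> Q t s'"
  shows "wp (prepare_end a) Q s"
proof -
  note im = input_invD[OF inp]
  have col: "arr s acol j = vcol z"
    using edges j(2) z(2) by (simp add: edges_inv_def onset_def ecol_def vcol_def)
  have c3: "vcol z < 3" by (simp add: vcol_def)
  have v: "arr s adeg = dg" "arr s asum = sm" "arr s aopp = onset vopp D" "arr s axv = onset vxv D"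
    using verts by (auto simp: verts_inv_def)
  have zB: "z \<le> B" using z by simp
  note vals = small_def im j(1) a v col z(1,3,4) zB
  consider "vcol z = 0" | "vcol z = 1" | "vcol z = 2" using c3 by linarith
  then show ?thesis
  proof cases
    case 1
    then have "vopp z = z + n" "vxv z = z" by (auto simp: vopp_def vxv_def)
    then show ?thesis
      unfolding prepare_end_def
      using onset_upd[of vopp D z] onset_upd[of vxv D z] edges inp
      by (intro vc_wp, simp add: vals 1, intro post)
        (simp_all add: vals input_inv_set edges_inv_def parts_inv_def verts_inv_def)
  next
    case 2
    then have "vopp z = z - n" "vxv z = z - n" by (auto simp: vopp_def vxv_def)
    then show ?thesis
      unfolding prepare_end_def
      using onset_upd[of vopp D z] onset_upd[of vxv D z] edges inp
      by (intro vc_wp, simp add: vals 2, intro post)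
        (simp_all add: vals input_inv_set edges_inv_def parts_inv_def verts_inv_def)
  next
    case 3
    \<comment> \<open>The program leaves \<open>aopp\<close> untouched in this case: the required
      value is the initial 0.\<close>
    then have "vopp z = 0" "vxv z = z - n - n" by (auto simp: vopp_def vxv_def)
    then show ?thesis
      unfolding prepare_end_def
      using onset_zero[of vopp z D] onset_upd[of vxv D z] edges inp
      by (intro vc_wp, simp add: vals 3, intro post)
        (simp_all add: vals input_inv_set edges_inv_def parts_inv_def verts_inv_def)
  qed
qed

lemma wp_prepare_part:
  assumes inp: "input_inv s0 s" and j: "reg s rj = j" "j < m"
    and parts: "parts_inv (f ` {..<j}) s" and edges: "edges_inv j s" and verts: "verts_inv dg sm D s"
    and post: "\<And>t s'. input_inv s0 s' \<Longrightarrow> reg s' rj = j \<Longrightarrow> reg s' rpart = f j \<Longrightarrow>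
      parts_inv (f ` {..<j + 1}) s' \<Longrightarrow> edges_inv j s' \<Longrightarrow> verts_inv dg sm D s' \<Longrightarrow> t \<le> 60 \<Longrightarrow> Q t s'"
  shows "wp prepare_part Q s"
proof -
  note im = input_invD[OF inp]
  have fj: "arr s apart j = f j" using im(5) j(2) by (simp add: onset_def)
  have img: "f ` {..<j + 1} = insert (f j) (f ` {..<j})" by (auto simp: less_plus_1_iff)
  let ?D = "f ` {..<j}"
  have p: "arr s abase = onset (\<lambda>p. 1 + gid p * n) ?D" "arr s apcol = onset (\<lambda>p. gid p mod 3) ?D"
    "arr s apx = onset (\<lambda>p. 4 * (gid p div 3)) ?D"
    "reg s rbase = 1 + card ?D * n" "reg s rcol = card ?D mod 3" "reg s rx = 4 * (card ?D div 3)"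
    using parts by (auto simp: parts_inv_def)
  show ?thesis
  proof (cases "f j \<in> ?D")
    case True
    then have "arr s abase (f j) \<noteq> 0" using p(1) by (simp add: onset_def)
    moreover have same: "f ` {..<j + 1} = ?D"
      unfolding img by (rule insert_absorb[OF True])
    ultimately show ?thesis
      unfolding prepare_part_def
      apply (intro vc_wp)
      apply (simp add: small_def j fj)
      apply (intro post)
      unfolding same using edges verts parts
      apply (simp_all add: j inp input_inv_set edges_inv_def parts_inv_def verts_inv_def)
      done
  next
    case False
    define c where "c = card ?D"
    have g: "gid (f j) = c" using gid_new[OF False] by (simp add: c_def)
    have cj: "c \<le> j" using card_image_le[of "{..<j}" f] by (simp add: c_def)
    have "(c + 1) * n \<le> m * n" using cj j by (intro mult_right_mono) auto
    then have "1 + c * n + n \<le> B" using size_le by (simp add: algebra_simps)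
    moreover have "4 * (c div 3) + 4 \<le> B"
    proof -
      have "c div 3 \<le> m" using cj j by (meson div_le_dividend le_trans less_imp_le)
      then show ?thesis using size_le by linarith
    qed
    moreover have "c mod 3 + 1 \<le> B"
    proof -
      have "c mod 3 < 3" by simp
      then show ?thesis using B by linarith
    qed
    ultimately have B': "1 + c * n + n \<le> B" "4 * (c div 3) + 4 \<le> B" "c mod 3 + 1 \<le> B"
      by auto
    have a0: "arr s abase (f j) = 0" using p(1) False by (simp add: onset_def)
    have card': "card (f ` {..<j + 1}) = c + 1" using img False by (simp add: c_def)
    note u = onset_upd[of "\<lambda>p. 1 + gid p * n" ?D "f j"] onset_upd[of "\<lambda>p. gid p mod 3" ?D "f j"]
      onset_upd[of "\<lambda>p. 4 * (gid p div 3)" ?D "f j"]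
    note u' = u[unfolded g, folded img]
    have cn: "(c + 1) * n = c * n + n" by (simp add: algebra_simps)
    show ?thesis
    proof (cases "c mod 3 = 2")
      case True
      then have "(c + 1) mod 3 = 0" "(c + 1) div 3 = c div 3 + 1" by presburger+
      then show ?thesis
        unfolding prepare_part_def
        using edges verts inp B'
        apply (intro vc_wp)
        apply (simp add: small_def j fj a0 p(4-6) im(1) c_def[symmetric] True)
        apply (intro post)
        apply (simp_all add: j input_inv_set edges_inv_def parts_inv_def verts_inv_def p u' u'(2)[unfolded True] card' cn c_def[symmetric] True im)
        done
    next
      case False
      then have "(c + 1) mod 3 = c mod 3 + 1" "(c + 1) div 3 = c div 3" by presburger+
      then show ?thesis
        unfolding prepare_part_def
        using edges verts inp False B'
        apply (intro vc_wp)
        apply (simp add: small_def j fj a0 p(4-6) im(1) c_def[symmetric])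
        apply (intro post)
        apply (simp_all add: j input_inv_set edges_inv_def parts_inv_def verts_inv_def p u' card' cn c_def[symmetric] im)
        done
    qed
  qed
qed

lemma wp_prepare_edge:
  assumes inp: "input_inv s0 s" and j: "reg s rj = j" "j < m" and pj: "reg s rpart = f j"
    and parts: "parts_inv (f ` {..<j + 1}) s" and edges: "edges_inv j s" and verts: "verts_inv dg sm D s"
    and post: "\<And>t s'. input_inv s0 s' \<Longrightarrow> reg s' rj = j \<Longrightarrow>
      parts_inv (f ` {..<j + 1}) s' \<Longrightarrow> edges_inv (j + 1) s' \<Longrightarrow> verts_inv dg sm D s' \<Longrightarrow> t \<le> 60 \<Longrightarrow> Q t s'"
  shows "wp prepare_edge Q s"
proof -
  note im = input_invD[OF inp]
  have p: "arr s abase (f j) = 1 + part j * n" "arr s apcol (f j) = ecol j" "arr s apx (f j) = ex4 j"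
    using parts by (auto simp: parts_inv_def onset_def part_def ecol_def ex4_def)
  have e: "arr s asrc j = src j" "arr s atgt j = tgt j" using im j by (auto simp: onset_def)
  have U: "1 + (part j * n + src j) = vU j" "1 + (part j * n + tgt j) = vV j"
    by (simp_all add: vU_def vV_def)
  have o: "ex4 j + ecol j + 1 = edf j" "ex4 j + (2 - ecol j) = ealt j"
    by (simp_all add: edf_def ealt_def)
  note sb = size_bounds[OF j(2)]
  have sb': "vU j \<le> B" "vV j \<le> B" using sb by auto
  have img: "{..<j + 1} = insert j {..<j}" by (auto simp: less_plus_1_iff)
  note u = onset_upd[of _ "{..<j}" j, folded img]
  show ?thesis
    unfolding prepare_edge_def
    apply (rule vc_wp)
    using edges verts inp parts sb sb' u
    apply (simp add: small_def j pj p e U(1,2)[unfolded add.assoc[symmetric]] o)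
    apply (intro post)
    apply (simp_all add: j input_inv_set edges_inv_def parts_inv_def verts_inv_def)
    done
qed

lemma wp_prepare:
  assumes inp: "input_inv s s" and zero: "\<And>a. 3 \<le> a \<Longrightarrow> a \<le> 15 \<Longrightarrow> arr s a = (\<lambda>_. 0)"
    and post: "\<And>t s'. input_inv s s' \<Longrightarrow> edges_inv m s' \<Longrightarrow>
      verts_inv (deg_upto m) (sum_upto m) (ends m) s' \<Longrightarrow> t \<le> 400 * m + 50 \<Longrightarrow> Q t s'"
  shows "wp prepare Q s"
proof -
  let ?I = "\<lambda>s1. input_inv s s1 \<and> reg s1 rj \<le> m \<and> parts_inv (f ` {..<reg s1 rj}) s1 \<and> edges_inv (reg s1 rj) s1
    \<and> verts_inv (deg_upto (reg s1 rj)) (sum_upto (reg s1 rj)) (ends (reg s1 rj)) s1"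
  let ?\<mu> = "\<lambda>s1. 400 * (m - reg s1 rj)"
  have body: "wp (block [
       prepare_part,
       prepare_edge,
       prepare_end aU,
       prepare_end aV,
       Set_Reg rj (Add (Reg rj) (Const 1))])
    (\<lambda>t s'. ?I s' \<and> t + cond_time (Less (Reg rj) (Reg rm)) + 1 + ?\<mu> s' \<le> ?\<mu> s1) s1"
    if I: "?I s1" and cond: "cond_val s1 (Less (Reg rj) (Reg rm))" for s1
  proof -
    define j where "j = reg s1 rj"
    have im: "reg s1 rm = m" using I input_invD(2) by blast
    have j: "j < m" using cond im by (simp add: j_def)
    note sb = size_bounds[OF j]
    have U: "j + 1 \<le> B" "vU j + n \<le> B" "vV j + n \<le> B" using sb by auto
    have d: "deg_upto j z + 1 \<le> B" for z using deg_upto_le[of j z] U(1) by linarith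
    have sm: "sum_upto j z + j \<le> B" for z
    proof -
      have "j * j \<le> m * m" using j by (intro mult_mono) auto
      then show ?thesis using sum_upto_le[of j z] size_le j by linarith
    qed
    \<comment> \<open>The two ends are different cells, so the second update of degrees and sums
      does not disturb the first.\<close>
    have ne: "vV j \<noteq> vU j" using vU_ne_vV[OF j] by simp
    show ?thesis
      unfolding block.simps
      apply (rule wp_Seq)
      apply (rule wp_prepare_part[where ?s0.0 = s and j = j and dg = "deg_upto j" and sm = "sum_upto j" and D = "ends j"])
            apply (use I j j_def in \<open>simp_all\<close>)[6]
      apply (rule wp_Seq)
      apply (rule wp_prepare_edge[where ?s0.0 = s and j = j and dg = "deg_upto j" and sm = "sum_upto j" and D = "ends j"])
             apply (use j in \<open>simp_all\<close>)[7]
      apply (rule wp_Seq)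
      apply (rule wp_prepare_end[where ?s0.0 = s and j = j and z = "vU j" and dg = "deg_upto j" and sm = "sum_upto j" and D = "ends j"])
               apply (use j U d sm blk_ends(1)[OF j] in \<open>simp_all add: edges_inv_def onset_def\<close>)[10]
      apply (rule wp_Seq)
      apply (rule wp_prepare_end[where ?s0.0 = s and j = j and z = "vV j"
          and dg = "(deg_upto j)(vU j := deg_upto j (vU j) + 1)" and sm = "(sum_upto j)(vU j := sum_upto j (vU j) + j)"
          and D = "insert (vU j) (ends j)"])
               apply (use j U d sm ne blk_ends(2)[OF j] in \<open>simp_all add: edges_inv_def onset_def\<close>)[10]
      subgoal premises p for t1 s2 t2 s3 t3 s4 t4 s5
      proof -
        have "(deg_upto j)(vU j := deg_upto j (vU j) + 1, vV j := deg_upto j (vV j) + 1) = deg_upto (j + 1)"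
          "(sum_upto j)(vU j := sum_upto j (vU j) + j, vV j := sum_upto j (vV j) + j) = sum_upto (j + 1)"
          using ne by (simp_all add: fun_eq_iff deg_upto_Suc sum_upto_Suc)
        then have v: "verts_inv (deg_upto (j + 1)) (sum_upto (j + 1)) (ends (j + 1)) s5"
          using p ne by (simp add: ends_Suc)
        have q: "input_inv s s5" "reg s5 rj = j" "edges_inv (j + 1) s5" "parts_inv (f ` {..<j + 1}) s5"
          using p by auto
        have t: "t1 \<le> 60" "t2 \<le> 60" "t3 \<le> 60" "t4 \<le> 60" using p by simp_all
        show ?thesis
          apply (rule vc_wp)
          using q v t j U(1) input_inv_set(1)[OF q(1), of rj "j + 1"]
          apply (simp add: small_def j_def[symmetric])
          apply (simp add: parts_inv_def edges_inv_def verts_inv_def)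
          done
      qed
      done
  qed
  let ?s1 = "setr rx 0 (setr rcol 0 (setr rbase 1 (setr rj 0 s)))"
  have I0: "?I ?s1"
    using zero inp input_inv_set(1)
    by (simp add: parts_inv_def edges_inv_def verts_inv_def onset_empty ends_def deg_upto_def sum_upto_def fun_eq_iff)
  show ?thesis
    unfolding prepare_def
    apply (rule vc_wp)
    apply (simp add: small_def)
    apply (rule wp_While[where I = ?I and \<mu> = ?\<mu>, OF I0 _ body[unfolded block.simps]])
    subgoal by (simp add: small_def)
    subgoal by simp
    subgoal by simp
    subgoal premises p for t s2
    proof -
      have "reg s2 rm = m" using p(1) input_invD(2) by blast
      then have "reg s2 rj = m" using p by auto
      then show ?thesis using p by (auto intro!: post)
    qed
    done
qed

end

section \<open>The conversion\<close>

lemma is_cycle_in: "is_cycle E C \<Longrightarrow> C \<subseteq> E"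
  by (auto simp: is_cycle_def)

text \<open>Edges never leave a block, so connected cycles lie in the same block. There
  \<open>h\<close> maps them injectively to connected cycles of a single \<open>E' p\<close>, which
  coincide, and \<open>g\<close> recovers the cycles from their images.\<close>

lemma unicyclic_copies:
  assumes blk: "\<And>e u v. e \<in> E \<Longrightarrow> u \<in> e \<Longrightarrow> v \<in> e \<Longrightarrow> blk u = blk v"
    and proj: "\<And>e u. e \<in> E \<Longrightarrow> u \<in> e \<Longrightarrow> h ` e \<in> E' (blk u)"
    and copy: "\<And>e u. e \<in> E \<Longrightarrow> u \<in> e \<Longrightarrow> g (blk u) (h u) = u"
    and uni: "\<And>p. unicyclic (E' p)"
  shows "unicyclic E"
  unfolding unicyclic_def
proof (intro allI impI, elim conjE)
  fix C C' x y
  assume C: "is_cycle E C" "is_cycle E C'" "x \<in> \<Union> C" "y \<in> \<Union> C'" "(x, y) \<in> conn E"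
  have conn: "blk z = blk w \<and> (h w, h z) \<in> conn (E' (blk w))" if "(w, z) \<in> conn E" for w z
    using that unfolding conn_def[of E]
  proof (induction rule: rtrancl_induct)
    case (step z z')
    then have e: "{z, z'} \<in> E" by simp
    have "{h z, h z'} \<in> E' (blk z)" using proj[OF e, of z] by simp
    then have "(h z, h z') \<in> conn (E' (blk w))" using step.IH conn_edge by metis
    moreover have "blk z' = blk z" using blk[OF e, of z' z] by simp
    ultimately show ?case using step.IH conn_trans by metis
  qed simp
  have same: "blk u = blk x" if "u \<in> \<Union> C \<or> u \<in> \<Union> C'" for u
    using that
  proof
    assume "u \<in> \<Union> C"
    then show ?thesis using conn[OF is_cycle_conn[OF C(1) C(3)]] by blast
  next
    assume "u \<in> \<Union> C'"
    then have "blk u = blk y" using conn[OF is_cycle_conn[OF C(2) C(4)]] by blast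
    then show ?thesis using conn[OF C(5)] by simp
  qed
  have inv: "g (blk x) (h u) = u" if "u \<in> e" "e \<in> C \<or> e \<in> C'" for u e
  proof -
    have "blk u = blk x" using that by (intro same) blast
    moreover have "e \<in> E" using that is_cycle_in[OF C(1)] is_cycle_in[OF C(2)] by blast
    ultimately show ?thesis using copy[of e u] that(1) by simp
  qed
  have cyc: "is_cycle (E' (blk x)) ((`) h ` D)" if D: "is_cycle E D" "D = C \<or> D = C'" for D
  proof (rule is_cycle_image[OF D(1)])
    show "inj_on h (\<Union> D)"
      by (rule inj_on_inverseI[of _ "g (blk x)"]) (use inv D in blast)
    show "h ` e \<in> E' (blk x)" if e: "e \<in> D" for e
    proof -
      have eE: "e \<in> E" using e is_cycle_in[OF D(1)] by blast
      obtain xs where xs: "D = cycle_edges xs" using D(1) by (auto simp: is_cycle_def)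
      then obtain u where u: "u \<in> e" using e by (auto simp: cycle_edges_def)
      then have "blk u = blk x" using same[of u] e D(2) by blast
      then show ?thesis using proj[OF eE u] by simp
    qed
  qed
  have "(`) h ` C = (`) h ` C'"
    using unicyclicD[OF uni cyc[OF C(1)] cyc[OF C(2)], of "h x" "h y"] C(3,4) conn[OF C(5)] by auto
  moreover have "(`) (g (blk x)) ` (`) h ` D = D" if D: "D = C \<or> D = C'" for D
  proof -
    have "g (blk x) ` h ` e = e" if "e \<in> D" for e
      using inv that D by (auto simp: image_image)
    then show ?thesis by (simp add: image_image)
  qed
  ultimately show "C = C'" by metis
qed

text \<open>With \<open>q = 3 * t + c\<close> the left side is \<open>4 * t + c + 1\<close>. Three
  times it is \<open>12 * t + 3 * (c + 1)\<close>, less than \<open>12 * t + 4 * (c + 1)\<close>,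
  which is \<open>4 * (q + 1)\<close>. Thus even an incomplete last triple stays below the
  bound.\<close>

lemma less_ceiling_4_3:
  assumes "q < k"
  shows "4 * (q div 3) + q mod 3 + 1 < nat \<lceil>4 * real k / 3\<rceil>"
proof -
  have "3 * (4 * (q div 3) + q mod 3 + 1) < 4 * (q + 1)"
    by presburger
  also have "\<dots> \<le> 4 * k" using assms by simp
  finally have "3 * (4 * (q div 3) + q mod 3 + 1) < 4 * k" .
  then have "real (3 * (4 * (q div 3) + q mod 3 + 1)) < real (4 * k)" by (rule of_nat_less_iff[THEN iffD2])
  then have "real (4 * (q div 3) + q mod 3 + 1) < 4 * real k / 3" by simp
  then have "of_int (int (4 * (q div 3) + q mod 3 + 1)) < 4 * real k / 3" by (metis of_int_of_nat_eq)
  then have "int (4 * (q div 3) + q mod 3 + 1) < \<lceil>4 * real k / 3\<rceil>" by (rule less_ceiling_iff[THEN iffD2])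
  then show ?thesis by linarith
qed

context renumbering
begin

lemma rep_mod_div:
  assumes "a < n"
  shows "vcol (1 + p * n + a) = p mod 3"
    "p mod 3 = 0 \<Longrightarrow> vopp (1 + p * n + a) = 1 + (p + 1) * n + a"
    "p mod 3 = 1 \<Longrightarrow> vopp (1 + p * n + a) = 1 + (p - 1) * n + a"
    "vxv (1 + p * n + a) = 1 + 3 * (p div 3) * n + a"
proof -
  show c: "vcol (1 + p * n + a) = p mod 3" using blk_eq[OF assms] by (simp add: vcol_def)
  show "p mod 3 = 0 \<Longrightarrow> vopp (1 + p * n + a) = 1 + (p + 1) * n + a"
    using c by (simp add: vopp_def algebra_simps)
  have p: "p = 3 * (p div 3) + p mod 3" by simp
  show "p mod 3 = 1 \<Longrightarrow> vopp (1 + p * n + a) = 1 + (p - 1) * n + a"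
  proof -
    assume p1: "p mod 3 = 1"
    then obtain q where "p = q + 1" using p by (metis add.commute)
    then show ?thesis using c p1 by (simp add: vopp_def algebra_simps)
  qed
  define q where "q = 3 * (p div 3)"
  have "p mod 3 = 0 \<or> p mod 3 = 1 \<or> p mod 3 = 2" by linarith
  moreover have "p = q + p mod 3" using p by (simp add: q_def)
  ultimately consider "p mod 3 = 0" "p = q" | "p mod 3 = 1" "p = q + 1" | "p mod 3 = 2" "p = q + 2" by linarith
  then have "vxv (1 + p * n + a) = 1 + q * n + a"
  proof cases
    case 1
    then show ?thesis using c by (simp add: vxv_def)
  next
    case 2
    then have "1 + p * n + a - n = 1 + q * n + a" by (simp add: algebra_simps)
    then show ?thesis using c 2 by (simp add: vxv_def)
  next
    case 3
    then have "1 + p * n + a - n - n = 1 + q * n + a" by (simp add: algebra_simps)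
    then show ?thesis using c 3 by (simp add: vxv_def)
  qed
  then show "vxv (1 + p * n + a) = 1 + 3 * (p div 3) * n + a" by (simp add: q_def)
qed

lemma rep_inj:
  assumes "1 + p * n + a = 1 + q * n + b" "a < n" "b < n"
  shows "p = q" "a = b"
proof -
  show "p = q" using assms blk_eq by metis
  then show "a = b" using assms by simp
qed

lemma ends_rep:
  assumes "z \<in> ends m"
  obtains j a where "j < m" "a < n" "z = 1 + part j * n + a"
  using assms src tgt unfolding ends_def vU_def vV_def by blast

end

section \<open>The input as one graph of copies and as a triple structure\<close>

locale pseudoforest_input =
  fixes n :: nat and E :: "nat set set" and k :: nat and P :: "nat \<Rightarrow> nat set set"
    and es :: "(nat \<times> nat) list" and f :: "nat \<Rightarrow> nat"
  assumes simple: "simple_graph {..<n} E"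
    and partition: "edge_partition (pseudoforest {..<n}) k E P"
    and edge_list: "edge_list E es" and indices: "part_indices es k P f"
begin

abbreviation "m \<equiv> length es"

definition src :: "nat \<Rightarrow> nat" where "src j = fst (es ! j)"
definition tgt :: "nat \<Rightarrow> nat" where "tgt j = snd (es ! j)"

lemma undirected_eq: "undirected (es ! j) = {src j, tgt j}"
  by (simp add: undirected_def src_def tgt_def)

lemma undirected_in: "j < m \<Longrightarrow> {src j, tgt j} \<in> E"
  using edge_list undirected_eq[of j] unfolding edge_list_def by (metis image_eqI length_map nth_map nth_mem set_map)

lemma undirected_inj: "i < m \<Longrightarrow> j < m \<Longrightarrow> {src i, tgt i} = {src j, tgt j} \<Longrightarrow> i = j"
  using edge_list undirected_eq unfolding edge_list_def
  by (metis length_map nth_eq_iff_index_eq nth_map)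

lemma f_less: "j < m \<Longrightarrow> f j < k"
  using indices by (auto simp: part_indices_def)

sublocale renumbering n m src tgt f
proof
  fix j assume j: "j < m"
  have "{src j, tgt j} \<subseteq> {..<n} \<and> card {src j, tgt j} = 2"
    using simple undirected_in[OF j] unfolding simple_graph_def by blast
  then show "src j < n" "tgt j < n" "src j \<noteq> tgt j" by auto
qed

definition gU :: "nat \<Rightarrow> nat" where "gU = onset vU {..<m}"
definition gV :: "nat \<Rightarrow> nat" where "gV = onset vV {..<m}"

lemma gU_gV: "j < m \<Longrightarrow> gU j = vU j" "j < m \<Longrightarrow> gV j = vV j"
  by (simp_all add: gU_def gV_def onset_def)

lemma part_less_k: "j < m \<Longrightarrow> part j < k"
proof -
  assume j: "j < m"
  have "part j < card (f ` {..<m})" using gid_less[OF j] by (simp add: part_def)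
  also have "\<dots> \<le> card {..<k}" using f_less by (intro card_mono) auto
  finally show ?thesis by simp
qed

lemma copies_unicyclic: "unicyclic ((\<lambda>j. {gU j, gV j}) ` {..<m})"
proof (rule unicyclic_copies[where blk = blk and h = "\<lambda>z. (z - 1) mod n" and g = "\<lambda>p v. 1 + p * n + v"
      and E' = "\<lambda>p. {{src j, tgt j} | j. j < m \<and> part j = p}"])
  fix e u v assume "e \<in> (\<lambda>j. {gU j, gV j}) ` {..<m}" and uv: "u \<in> e" "v \<in> e"
  then obtain j where j: "j < m" "e = {vU j, vV j}" using gU_gV by auto
  then show "blk u = blk v" using uv blk_ends by auto
next
  fix e u assume "e \<in> (\<lambda>j. {gU j, gV j}) ` {..<m}" and u: "u \<in> e"
  then obtain j where j: "j < m" "e = {vU j, vV j}" using gU_gV by auto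
  have st: "(vU j - 1) mod n = src j" "(vV j - 1) mod n = tgt j"
    using src tgt j by (simp_all add: vU_def vV_def)
  have b: "blk u = part j" using j u blk_ends by auto
  show "(\<lambda>z. (z - 1) mod n) ` e \<in> {{src j, tgt j} | j. j < m \<and> part j = blk u}"
    using j st b by auto
  show "1 + blk u * n + (u - 1) mod n = u"
    using j u st b by (auto simp: vU_def vV_def)
next
  fix p
  show "unicyclic {{src j, tgt j} | j. j < m \<and> part j = p}" (is "unicyclic ?E")
  proof (cases "\<exists>i < m. part i = p")
    case True
    then obtain i where i: "i < m" "part i = p" by blast
    \<comment> \<open>The renumbering is injective on the parts that occur, so all edges numbered
      \<open>p\<close> come from one pseudoforest of the input.\<close>
    have "?E \<subseteq> P (f i)"
    proof
      fix e assume "e \<in> ?E"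
      then obtain j where j: "j < m" "part j = p" "e = {src j, tgt j}" by blast
      then have "f j = f i" using i gid_inj[of j i] by (simp add: part_def)
      then show "e \<in> P (f i)"
        using indices j undirected_eq[of j] unfolding part_indices_def by metis
    qed
    moreover have "pseudoforest {..<n} (P (f i))" "P (f i) \<subseteq> E"
      using partition f_less[OF i(1)] unfolding edge_partition_def by auto
    ultimately show ?thesis
      using unicyclic_pseudoforest[of "P (f i)" "{..<n}"] simple unicyclic_mono
      unfolding simple_graph_def by (meson subsetD)
  next
    case False
    then have e: "?E = {}" by blast
    have "\<not> is_cycle {} C" for C :: "nat set set"
      using forest_empty by (auto simp: forest_def)
    then show ?thesis unfolding e by (simp add: unicyclic_def)
  qed
qed

sublocale indexed_graph m gU gV
proof
  show "j < m \<Longrightarrow> gU j \<noteq> gV j" for j using gU_gV vU_ne_vV by simp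
  show "i = j" if ij: "i < m" "j < m" "{gU i, gV i} = {gU j, gV j}" for i j
  proof -
    have e: "{vU i, vV i} = {vU j, vV j}" using ij gU_gV by simp
    then have p: "part i = part j" using blk_ends ij by (metis doubleton_eq_iff)
    then have "{src i, tgt i} = {src j, tgt j}" using e by (auto simp: vU_def vV_def doubleton_eq_iff)
    then show ?thesis using undirected_inj ij by blast
  qed
  show "unicyclic ((\<lambda>j. {gU j, gV j}) ` {..<m})" by (rule copies_unicyclic)
qed

lemma ed_eq: "j < m \<Longrightarrow> ed j = {1 + part j * n + src j, 1 + part j * n + tgt j}"
  using gU_gV by (simp add: ed_def vU_def vV_def)

definition gopp :: "nat \<Rightarrow> nat" where "gopp = onset vopp (ends m)"
definition gxv :: "nat \<Rightarrow> nat" where "gxv = onset vxv (ends m)"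

lemma ends_ed: "j < m \<Longrightarrow> z \<in> ed j \<Longrightarrow> z \<in> ends m"
  using gU_gV by (auto simp: ed_def ends_def)

lemma verts_ends: "L \<subseteq> {..<m} \<Longrightarrow> z \<in> verts L \<Longrightarrow> z \<in> ends m"
  using ends_ed by (auto simp: verts_def)

lemma triple_structureI:
  assumes "cycle_structure m gU gV L C nx pv ne cid se"
  shows "triple_structure m gU gV L C nx pv ne cid se gopp gxv vcol"
proof -
  interpret cs: cycle_structure m gU gV L C nx pv ne cid se by fact
  have in_ends: "z \<in> ends m" if "cid z \<noteq> 0" for z
  proof (rule verts_ends)
    show "L \<subseteq> {..<m}" using cs.core by (simp add: core_def)
    show "z \<in> verts L" using that cs.traversed by (simp add: traverse_inv_def)
  qed
  have blk_nx: "blk (nx z) = blk z" if "cid z \<noteq> 0" for z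
  proof -
    have "ne z < m" "ed (ne z) = {z, nx z}" using cs.nx_facts[OF that] by auto
    then have "blk z = part (ne z)" "blk (nx z) = part (ne z)"
      using gU_gV blk_ends unfolding ed_def doubleton_eq_iff by metis+
    then show ?thesis by simp
  qed
  have blk_cid: "blk w = blk z" if z: "cid z \<noteq> 0" "cid w = cid z" for z w
  proof -
    obtain i where "w = (nx ^^ i) z" using cs.orbit_cycle(5)[OF z] by blast
    moreover have "blk ((nx ^^ i) z) = blk z" for i
      by (induction i) (use blk_nx cs.cid_funpow[OF z(1)] z in simp_all)
    ultimately show ?thesis by simp
  qed
  have rep: "\<exists>j a. j < m \<and> a < n \<and> z = 1 + part j * n + a" if "cid z \<noteq> 0" for z
    using ends_rep[OF in_ends[OF that]] by metis
  have eq: "gopp z = vopp z" "gxv z = vxv z" if "cid z \<noteq> 0" for z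
    using in_ends[OF that] by (simp_all add: gopp_def gxv_def onset_def)
  have opp: "vcol (gopp z) < 2 \<and> gopp (gopp z) = z \<and> gxv (gopp z) = gxv z \<and> blk (gopp z) \<noteq> blk z"
    if z: "cid z \<noteq> 0" "vcol z < 2" "cid (gopp z) \<noteq> 0" for z
  proof -
    obtain j a where ja: "a < n" "z = 1 + part j * n + a" using rep[OF z(1)] by blast
    define p where "p = part j"
    note r = rep_mod_div[OF ja(1)]
    have zp: "z = 1 + p * n + a" using ja by (simp add: p_def)
    have c: "p mod 3 = 0 \<or> p mod 3 = 1" using z(2) r(1)[of p] zp by auto
    then show ?thesis
    proof
      assume p0: "p mod 3 = 0"
      then have q: "(p + 1) mod 3 = 1" "(p + 1) div 3 = p div 3" by presburger+
      have o: "gopp z = 1 + (p + 1) * n + a" using eq(1)[OF z(1)] r(2)[OF p0] zp by simp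
      have "gopp (gopp z) = z" using eq(1)[OF z(3)] r(3)[OF q(1)] o zp by simp
      moreover have "gxv (gopp z) = gxv z" using eq(2)[OF z(3)] eq(2)[OF z(1)] r(4)[of p] r(4)[of "p + 1"] q o zp by simp
      ultimately show ?thesis using r(1)[of "p + 1"] q(1) blk_eq[OF ja(1)] o zp by simp
    next
      assume p1: "p mod 3 = 1"
      then obtain q where q: "p = q + 1" by (cases p) (auto simp: Suc_eq_plus1)
      have q0: "q mod 3 = 0" "(q + 1) div 3 = q div 3" using p1 q by presburger+
      have o: "gopp z = 1 + q * n + a" using eq(1)[OF z(1)] r(3)[OF p1] zp q by simp
      have "gopp (gopp z) = z" using eq(1)[OF z(3)] r(2)[OF q0(1)] o zp q by simp
      moreover have "gxv (gopp z) = gxv z" using eq(2)[OF z(3)] eq(2)[OF z(1)] r(4)[of p] r(4)[of q] q q0 o zp by simp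
      ultimately show ?thesis using r(1)[of q] q0(1) q blk_eq[OF ja(1)] o zp by simp
    qed
  qed
  \<comment> \<open>A common name fixes the triple and the original vertex, so such copies can
    differ only in colour; if neither or both have colour 2, they are equal or opposite.\<close>
  have xv: "w = z \<or> (w = gopp z \<and> vcol z < 2)" if zw: "cid z \<noteq> 0" "cid w \<noteq> 0" "gxv z = gxv w"
      "vcol z < 2 \<longleftrightarrow> vcol w < 2" for z w
  proof -
    obtain j a where ja: "a < n" "z = 1 + part j * n + a" using rep[OF zw(1)] by blast
    obtain i b where ib: "b < n" "w = 1 + part i * n + b" using rep[OF zw(2)] by blast
    define p q where "p = part j" and "q = part i"
    have zp: "z = 1 + p * n + a" "w = 1 + q * n + b" using ja ib by (simp_all add: p_def q_def)
    have "1 + 3 * (p div 3) * n + a = 1 + 3 * (q div 3) * n + b"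
      using zw(3) eq[OF zw(1)] eq[OF zw(2)] rep_mod_div(4)[OF ja(1), of p] rep_mod_div(4)[OF ib(1), of q] zp by simp
    from rep_inj[OF this ja(1) ib(1)] have d: "p div 3 = q div 3" "a = b" by auto
    have c: "vcol z = p mod 3" "vcol w = q mod 3" using rep_mod_div(1) ja ib zp by auto
    show ?thesis
    proof (cases "p mod 3 = q mod 3")
      case True
      then have "p = q" using d by (metis div_mult_mod_eq)
      then show ?thesis using zp d by simp
    next
      case False
      then have "p mod 3 = 0 \<and> q mod 3 = 1 \<or> p mod 3 = 1 \<and> q mod 3 = 0"
        using zw(4) c mod_less_divisor[of 3 p] mod_less_divisor[of 3 q] by linarith
      moreover have "p = 3 * (p div 3) + p mod 3" "q = 3 * (p div 3) + q mod 3"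
        using mult_div_mod_eq[of 3 p] mult_div_mod_eq[of 3 q] unfolding d(1) by linarith+
      ultimately have "p mod 3 = 0 \<and> q = p + 1 \<or> p mod 3 = 1 \<and> p - 1 = q" by linarith
      then show ?thesis
        using eq(1)[OF zw(1)] rep_mod_div(2,3)[OF ja(1), of p] zp d c by auto
    qed
  qed
  show ?thesis
  proof (intro triple_structure.intro triple_structure_axioms.intro)
    show "cycle_structure m gU gV L C nx pv ne cid se" by fact
    show "cid 0 = 0"
    proof (rule ccontr)
      assume "cid 0 \<noteq> 0"
      then show False using rep[of 0] by auto
    qed
    show "vcol (gopp z) < 2 \<and> gopp (gopp z) = z \<and> gxv (gopp z) = gxv z \<and> cid (gopp z) \<noteq> cid z"
      if z: "cid z \<noteq> 0" "vcol z < 2" "cid (gopp z) \<noteq> 0" for z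
      using opp[OF z] blk_cid[OF z(1), of "gopp z"] by auto
    show "w = z \<or> w = gopp z" if "cid z \<noteq> 0" "cid w \<noteq> 0" "vcol z < 2" "vcol w < 2" "gxv z = gxv w" for z w
      using xv[OF that(1,2,5)] that(3,4) by blast
    show "gxv z \<noteq> 0" if "cid z \<noteq> 0" for z
      using rep[OF that] eq(2)[OF that] rep_mod_div(4) by auto
    show "vcol z = vcol w" if "cid z \<noteq> 0" "cid z = cid w" for z w
      using blk_cid[OF that(1) that(2)[symmetric]] by (simp add: vcol_def)
    show "w = z" if "cid z \<noteq> 0" "cid w \<noteq> 0" "\<not> vcol z < 2" "\<not> vcol w < 2" "gxv z = gxv w" for z w
      using xv[OF that(1,2,5)] that(3,4) by blast
    show "gopp (nx z) \<noteq> nx (gopp z) \<and> gopp (nx z) \<noteq> pv (gopp z)"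
      if z: "cid z \<noteq> 0" "vcol z < 2" "cid (gopp z) \<noteq> 0" "cid (gopp (nx z)) \<noteq> 0" for z
    proof -
      define x where "x = gopp z"
      have nz: "cid (nx z) \<noteq> 0" "vcol (nx z) < 2"
        using cs.nx_facts(1)[OF z(1)] z blk_nx[OF z(1)] by (auto simp: vcol_def)
      \<comment> \<open>If the copies of \<open>z\<close> and \<open>nx z\<close> were consecutive
        on a cycle too, both edges would project to the same edge of \<open>E\<close> although they
        have different parts, while every edge is listed only once.\<close>
      have False if y: "cid y \<noteq> 0" "{y, nx y} = {gopp z, gopp (nx z)}" for y
      proof -
        define i j where "i = ne z" and "j = ne y"
        have i: "i < m" "ed i = {z, nx z}" and j: "j < m" "ed j = {gopp z, gopp (nx z)}"
          using cs.nx_facts(5,6)[OF z(1)] cs.nx_facts(5,6)[OF y(1)] y(2) by (auto simp: i_def j_def)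
        have "part j = blk (gopp z)" using j blk_ends gU_gV by (metis doubleton_eq_iff ed_def)
        moreover have "part i = blk z" using i blk_ends gU_gV by (metis doubleton_eq_iff ed_def)
        ultimately have pij: "part i \<noteq> part j" using opp[OF z(1,2,3)] by simp
        define h where "h = (\<lambda>u. (u - 1) mod n)"
        have h_opp: "h (gopp u) = h u" if u: "cid u \<noteq> 0" "vcol u < 2" "cid (gopp u) \<noteq> 0" for u
        proof -
          obtain l a where la: "a < n" "u = 1 + part l * n + a" using rep[OF u(1)] by blast
          have "part l mod 3 = 0 \<or> part l mod 3 = 1" using u(2) rep_mod_div(1)[OF la(1), of "part l"] la(2) by auto
          then show ?thesis
            using rep_mod_div(2,3)[OF la(1), of "part l"] la eq(1)[OF u(1)] by (auto simp: h_def)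
        qed
        have img: "h ` ed l = {src l, tgt l}" if "l < m" for l
          using ed_eq[OF that] src[OF that] tgt[OF that] by (simp add: h_def)
        have "{src j, tgt j} = {h z, h (nx z)}"
          using img[OF j(1)] unfolding j(2) by (simp add: h_opp[OF z(1,2,3)] h_opp[OF nz z(4)])
        moreover have "{src i, tgt i} = {h z, h (nx z)}"
          using img[OF i(1)] unfolding i(2) by simp
        ultimately have "{src i, tgt i} = {src j, tgt j}" by simp
        then show False using undirected_inj[OF i(1) j(1)] pij by simp
      qed
      note no = this
      have "pv (gopp z) \<noteq> gopp (nx z)" using no[of "pv (gopp z)"] cs.pv_facts[OF z(3)] z(3)
        by (metis insert_commute)
      moreover have "nx (gopp z) \<noteq> gopp (nx z)" using no[of "gopp z"] z(3) by auto
      ultimately show ?thesis by metis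
    qed
  qed
qed

lemma gopp_main:
  assumes "z \<in> ends m" "z = 1 + p * n + a" "a < n" "p mod 3 < 2"
  shows "gopp z = 1 + (if p mod 3 = 0 then p + 1 else p - 1) * n + a"
proof -
  have "p mod 3 = 0 \<or> p mod 3 = 1" using assms(4) by linarith
  then show ?thesis
    using assms(1) rep_mod_div(2,3)[OF assms(3), of p] unfolding gopp_def onset_def assms(2) by auto
qed

section \<open>Reading off the forests\<close>

definition valid_output :: "(nat \<Rightarrow> nat) \<Rightarrow> bool" where
  "valid_output out \<longleftrightarrow> (\<exists>F. edge_partition forest (nat \<lceil>4 * real k / 3\<rceil>) E F
     \<and> part_indices es (nat \<lceil>4 * real k / 3\<rceil>) F out)"

lemma valid_outputI:
  assumes lt: "\<And>j. j < m \<Longrightarrow> out j < nat \<lceil>4 * real k / 3\<rceil>"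
    and fo: "\<And>i. forest {{src j, tgt j} | j. j < m \<and> out j = i}"
  shows "valid_output out"
proof -
  let ?F = "\<lambda>i. {{src j, tgt j} | j. j < m \<and> out j = i}"
  have "(\<Union>i<nat \<lceil>4 * real k / 3\<rceil>. ?F i) = E"
  proof
    show "(\<Union>i<nat \<lceil>4 * real k / 3\<rceil>. ?F i) \<subseteq> E" using undirected_in by blast
    show "E \<subseteq> (\<Union>i<nat \<lceil>4 * real k / 3\<rceil>. ?F i)"
    proof
      fix e assume "e \<in> E"
      then have "e \<in> set (map undirected es)" using edge_list by (simp add: edge_list_def)
      then obtain j where "j < m" "e = {src j, tgt j}"
        using undirected_eq by (metis in_set_conv_nth length_map nth_map)
      then show "e \<in> (\<Union>i<nat \<lceil>4 * real k / 3\<rceil>. ?F i)" using lt by blast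
    qed
  qed
  moreover have "disjoint_family_on ?F {..<nat \<lceil>4 * real k / 3\<rceil>}"
    unfolding disjoint_family_on_def
  proof (intro ballI impI)
    fix i i' :: nat assume "i \<noteq> i'"
    show "?F i \<inter> ?F i' = {}"
    proof (rule equals0I)
      fix e assume "e \<in> ?F i \<inter> ?F i'"
      then obtain j j' where j: "j < m" "out j = i" "e = {src j, tgt j}" "j' < m" "out j' = i'" "e = {src j', tgt j'}"
        by blast
      then have "j = j'" using undirected_inj by metis
      then show False using j \<open>i \<noteq> i'\<close> by simp
    qed
  qed
  ultimately have "edge_partition forest (nat \<lceil>4 * real k / 3\<rceil>) E ?F"
    unfolding edge_partition_def using fo by blast
  moreover have "part_indices es (nat \<lceil>4 * real k / 3\<rceil>) ?F out"
    unfolding part_indices_def using lt undirected_eq by blast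
  ultimately show ?thesis unfolding valid_output_def by blast
qed

text \<open>Every output forest embeds, through the map to a single block of copies, into one of the
  two given forests: into the first if its number is divisible by 4, and into the second
  otherwise.\<close>

lemma valid_output_forests:
  assumes fX: "forest ((\<lambda>j. {gxv (gU j), gxv (gV j)}) ` SX)"
    and fV: "forest (all_edges - ed ` (SX \<union> SM) \<union> (\<lambda>j. {gopp (gU j), gopp (gV j)}) ` SM)"
    and SX: "\<And>j. j \<in> SX \<union> SM \<Longrightarrow> j < m"
    and SM: "\<And>j. j \<in> SM \<Longrightarrow> \<exists>y \<in> ed j. vcol y < 2 \<and> gopp y \<in> ends m"
    and out: "\<And>j. j < m \<Longrightarrow> out j = (if j \<in> SX then ex4 j else if j \<in> SM then ealt j else edf j)"
  shows "valid_output out"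
proof (rule valid_outputI)
  have gUV: "gU j = 1 + part j * n + src j" "gV j = 1 + part j * n + tgt j" "gU j \<in> ends m" "gV j \<in> ends m"
    if "j < m" for j
    using gU_gV[OF that] that by (auto simp: vU_def vV_def ends_def)
  define opart where "opart j = (if part j mod 3 = 0 then part j + 1 else part j - 1)" for j
  have mv: "ecol j < 2" "opart j < k" "gopp (gU j) = 1 + opart j * n + src j" "gopp (gV j) = 1 + opart j * n + tgt j"
    "ealt j = 4 * (opart j div 3) + opart j mod 3 + 1" if j: "j \<in> SM" for j
  proof -
    have jm: "j < m" using SX j by blast
    obtain y where y: "y \<in> ed j" "vcol y < 2" "gopp y \<in> ends m" using SM[OF j] by blast
    obtain a where a: "y = 1 + part j * n + a" "a < n" using y(1) gUV[OF jm] src[OF jm] tgt[OF jm] by (auto simp: ed_def)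
    have c: "part j mod 3 < 2" using y(2) rep_mod_div(1)[OF a(2)] a(1) by simp
    then show "ecol j < 2" by (simp add: ecol_def)
    have "gopp y = 1 + opart j * n + a"
      using gopp_main[OF ends_ed[OF jm y(1)] a c] by (simp add: opart_def)
    \<comment> \<open>The opposite copy is an end of a listed edge, so its part exists; this
      excludes moving an edge into a missing colour of the last triple.\<close>
    moreover obtain j' a' where "j' < m" "a' < n" "gopp y = 1 + part j' * n + a'" using ends_rep[OF y(3)] .
    ultimately have "opart j = part j'" "j' < m" using rep_inj(1) a(2) by metis+
    then show "opart j < k" using part_less_k by simp
    show "gopp (gU j) = 1 + opart j * n + src j" "gopp (gV j) = 1 + opart j * n + tgt j"
      using gopp_main[OF gUV(3)[OF jm] gUV(1)[OF jm] src[OF jm] c] gopp_main[OF gUV(4)[OF jm] gUV(2)[OF jm] tgt[OF jm] c]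
      by (simp_all add: opart_def)
    have arith: "p mod 3 = 0 \<Longrightarrow> (p + 1) div 3 = p div 3 \<and> (p + 1) mod 3 = 1"
      "p mod 3 = 1 \<Longrightarrow> (p - 1) div 3 = p div 3 \<and> (p - 1) mod 3 = 0" for p :: nat
      by presburger+
    show "ealt j = 4 * (opart j div 3) + opart j mod 3 + 1"
    proof (cases "part j mod 3 = 0")
      case True
      then show ?thesis using arith(1)[OF True] by (simp add: ealt_def ex4_def ecol_def opart_def)
    next
      case False
      then have "part j mod 3 = 1" using c by linarith
      then show ?thesis using arith(2) by (simp add: ealt_def ex4_def ecol_def opart_def)
    qed
  qed
  have df: "edf j = 4 * (part j div 3) + part j mod 3 + 1" for j
    by (simp add: edf_def ex4_def ecol_def)
  show "out j < nat \<lceil>4 * real k / 3\<rceil>" if j: "j < m" for j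
  proof -
    have "edf j < nat \<lceil>4 * real k / 3\<rceil>" using less_ceiling_4_3[OF part_less_k[OF j]] df by simp
    moreover have "ex4 j \<le> edf j" by (simp add: edf_def)
    moreover have "ealt j < nat \<lceil>4 * real k / 3\<rceil>" if "j \<in> SM" using less_ceiling_4_3[OF mv(2)[OF that]] mv(5)[OF that] by simp
    ultimately show ?thesis using out[OF j] by auto
  qed
  fix i :: nat
  \<comment> \<open>The block that corresponds to forest \<open>i\<close>. For
    \<open>i mod 4 = 0\<close> the truncated subtraction yields the colour 0 block, where the common
    names of the triple live.\<close>
  define q where "q = 3 * (i div 4) + (i mod 4 - 1)"
  define h where "h v = 1 + q * n + v" for v
  have inj: "inj_on h A" for A by (auto simp: inj_on_def h_def)
  show "forest {{src j, tgt j} | j. j < m \<and> out j = i}"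
  proof (cases "i mod 4 = 0")
    case True
    show ?thesis
    proof (rule forest_image[OF fX inj])
      fix e assume "e \<in> {{src j, tgt j} | j. j < m \<and> out j = i}"
      then obtain j where j: "j < m" "out j = i" "e = {src j, tgt j}" by blast
      have nd: "edf j mod 4 \<noteq> 0" unfolding df by presburger
      have na: "ealt j mod 4 \<noteq> 0" if "j \<in> SM" unfolding mv(5)[OF that] by presburger
      have jX: "j \<in> SX" using out[OF j(1)] nd na True j(2) by (auto split: if_splits)
      then have "i = 4 * (part j div 3)" using out[OF j(1)] j(2) by (simp add: ex4_def)
      then have "q = 3 * (part j div 3)" by (simp add: q_def)
      then have "gxv (gU j) = h (src j)" "gxv (gV j) = h (tgt j)"
        using rep_mod_div(4)[OF src[OF j(1)], of "part j"] rep_mod_div(4)[OF tgt[OF j(1)], of "part j"] gUV[OF j(1)]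
        by (simp_all add: gxv_def onset_def h_def)
      then show "h ` e \<in> (\<lambda>j. {gxv (gU j), gxv (gV j)}) ` SX" using jX j(3) by (intro image_eqI[of _ _ j]) simp_all
    qed
  next
    case False
    have idx: "q' = q" if "i = 4 * (q' div 3) + q' mod 3 + 1" for q'
    proof -
      have c: "q' mod 3 + 1 < 4" by simp
      have "i = q' mod 3 + 1 + q' div 3 * 4" using that by simp
      then have "i div 4 = q' div 3" "i mod 4 = q' mod 3 + 1" using c by simp_all
      then show ?thesis by (simp add: q_def)
    qed
    show ?thesis
    proof (rule forest_image[OF fV inj])
      fix e assume "e \<in> {{src j, tgt j} | j. j < m \<and> out j = i}"
      then obtain j where j: "j < m" "out j = i" "e = {src j, tgt j}" by blast
      have "ex4 j mod 4 = 0" by (simp add: ex4_def)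
      then have jX: "j \<notin> SX" using out[OF j(1)] False j(2) by auto
      show "h ` e \<in> all_edges - ed ` (SX \<union> SM) \<union> (\<lambda>j. {gopp (gU j), gopp (gV j)}) ` SM"
      proof (cases "j \<in> SM")
        case True
        then have "opart j = q" using out[OF j(1)] jX j(2) mv(5)[OF True] by (intro idx) simp
        then have "h ` e = {gopp (gU j), gopp (gV j)}" using mv(3,4)[OF True] j(3) by (simp add: h_def)
        then show ?thesis using True by blast
      next
        case jM: False
        then have "part j = q" using out[OF j(1)] jX j(2) df[of j] by (intro idx) simp
        then have "h ` e = ed j" using gUV[OF j(1)] j(3) by (simp add: h_def ed_def)
        moreover have "ed j \<notin> ed ` (SX \<union> SM)" using ed_cong[OF j(1)] SX jX jM by blast
        ultimately show ?thesis using j(1) by (auto simp: all_edges_def)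
      qed
    qed
  qed
qed

end

section \<open>The complete program and its bounds\<close>

definition program :: com where
  "program = block [prepare, peel, traverse, choose_all, link_all]"

locale pseudoforest_machine = machine W B + pseudoforest_input n E k P es f
  for W B n E k P es f +
  assumes size: "2 + 2 * m * n + 2 * n + m * m + 4 * m + 4 \<le> B"
begin

sublocale prepare_machine W B n m src tgt f
  by standard (rule size)

sublocale machine_graph W B m gU gV
proof
  show "gU j + gV j \<le> B" for j
  proof (cases "j < m")
    case True
    then show ?thesis using size_bounds(7)[OF True] gU_gV[OF True] by simp
  qed (simp add: gU_def gV_def onset_def)
  show "m < B" using size by simp
qed

lemma wp_choose_link:
  assumes cs: "cycle_structure m gU gV L C nx pv ne cid se" and C: "C \<le> m" "reg s rC = C"
    and mem: "arr s aU = gU" "arr s anx = nx" "arr s apv = pv" "arr s ane = ne" "arr s acid = cid"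
      "arr s ase = se" "arr s aopp = gopp" "arr s axv = gxv" "arr s ax4 = onset ex4 {..<m}"
      "arr s aalt = onset ealt {..<m}" "arr s acol = onset ecol {..<m}" "arr s aout = onset edf {..<m}"
    and zero: "arr s adn = (\<lambda>_. 0)" "arr s amt = (\<lambda>_. 0)"
    and post: "\<And>t s'. valid_output (arr s' aout) \<Longrightarrow> t \<le> 1200 * m + 300 \<Longrightarrow> Q t s'"
  shows "wp (block [choose_all, link_all]) Q s"
proof -
  interpret ts: triple_structure m gU gV L C nx pv ne cid se gopp gxv vcol
    by (rule triple_structureI[OF cs])
  interpret tm: triple_machine W B m gU gV L C nx pv ne cid se gopp gxv vcol
      "onset ex4 {..<m}" "onset ealt {..<m}" "onset edf {..<m}"
    by standard (rule C(1))
  have col: "onset ecol {..<m} (se i) = vcol (gU (se i))" if "1 \<le> i" "i \<le> C" for i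
    using ts.se_orbit(1)[OF that] gU_gV(1)[of "se i"] blk_ends(1)[of "se i"]
    by (simp add: onset_def ecol_def vcol_def)
  have pm: "tm.pick_mem s s" unfolding tm.pick_mem_def using mem col by simp
  have last: "valid_output (arr s' aout)" if inv: "tm.link_inv s C s'" for s'
  proof -
    obtain SX SM where out: "arr s' aout = tm.out_fun SX SM" and fX: "forest (ts.xedges SX)"
      and fV: "forest (all_edges - ed ` (SX \<union> SM) \<union> ts.moved SM)"
      and lt: "\<And>j. j \<in> SX \<union> SM \<Longrightarrow> j < m"
      and mv: "\<And>j. j \<in> SM \<Longrightarrow> \<exists>y. ts.main y \<and> ed j = {y, nx y} \<and> cid (gopp y) \<noteq> 0 \<and> cid (gopp (nx y)) \<noteq> 0"
      using tm.link_inv_final[OF inv] by metis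
    have in_ends: "z \<in> ends m" if "cid z \<noteq> 0" for z
    proof (rule verts_ends)
      show "L \<subseteq> {..<m}" using ts.core by (simp add: core_def)
      show "z \<in> verts L" using that ts.traversed by (simp add: traverse_inv_def)
    qed
    show ?thesis
    proof (rule valid_output_forests)
      show "forest ((\<lambda>j. {gxv (gU j), gxv (gV j)}) ` SX)" using fX by (simp add: ts.xedges_def)
      show "forest (all_edges - ed ` (SX \<union> SM) \<union> (\<lambda>j. {gopp (gU j), gopp (gV j)}) ` SM)"
        using fV by (simp add: ts.moved_def)
      show "\<And>j. j \<in> SX \<union> SM \<Longrightarrow> j < m" by (rule lt)
      show "\<exists>y \<in> ed j. vcol y < 2 \<and> gopp y \<in> ends m" if "j \<in> SM" for j
        using mv[OF that] in_ends by (auto simp: ts.main_def)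
      show "arr s' aout j = (if j \<in> SX then ex4 j else if j \<in> SM then ealt j else edf j)" if "j < m" for j
        using that unfolding out tm.out_fun_def by (simp add: onset_def)
    qed
  qed
  show ?thesis
    unfolding block.simps
    apply (rule wp_Seq)
    apply (rule tm.wp_choose_all[OF pm zero mem(12) C(2)])
    apply (rule wp_Seq)
    apply (rule tm.wp_link_all[where ?s0.0 = s], assumption+)
    apply (rule vc_wp)
    apply (simp, rule post[OF last], assumption, simp)
    done
qed

lemma wp_program:
  "wp program (\<lambda>t s'. valid_output (arr s' aout) \<and> t \<le> 3000 * m + 1000) (input_state n es k f)"
proof -
  define s where "s = input_state n es k f"
  have s: "reg s rn = n" "reg s rm = m" "arr s asrc = onset src {..<m}" "arr s atgt = onset tgt {..<m}"
    "arr s apart = onset f {..<m}" and zero: "\<And>a. 3 \<le> a \<Longrightarrow> arr s a = (\<lambda>_. 0)"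
    by (auto simp: s_def input_state_def onset_def fun_eq_iff src_def tgt_def)
  have inp: "input_inv s s" unfolding input_inv_def using s by simp
  show ?thesis
    unfolding program_def block.simps s_def[symmetric]
  proof (rule wp_Seq, rule wp_prepare[OF inp zero])
    fix t1 s1
    assume 1: "input_inv s s1" "edges_inv m s1" "verts_inv (deg_upto m) (sum_upto m) (ends m) s1"
      and t1: "t1 \<le> 400 * m + 50"
    have e1: "arr s1 aU = gU" "arr s1 aV = gV" "arr s1 acol = onset ecol {..<m}" "arr s1 ax4 = onset ex4 {..<m}"
      "arr s1 aout = onset edf {..<m}" "arr s1 aalt = onset ealt {..<m}" "arr s1 aopp = gopp" "arr s1 axv = gxv"
      "reg s1 rm = m"
      using 1 input_invD(2)[OF 1(1)] by (auto simp: edges_inv_def verts_inv_def gU_def gV_def gopp_def gxv_def)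
    \<comment> \<open>The arrays of the later phases are still untouched, so each phase finds the
      zeros it starts from.\<close>
    have z1: "arr s1 a = (\<lambda>_. 0)" if "16 \<le> a" for a
      using 1(1) that zero[of a] by (auto simp: input_inv_def same_arrays_def)
    have inc_eq: "{i. i < m \<and> z \<in> {vU i, vV i}} = inc {..<m} z" for z
      using gU_gV by (auto simp: inc_def ed_def)
    have d1: "arr s1 adeg = (\<lambda>z. card (inc {..<m} z))" "arr s1 asum = (\<lambda>z. \<Sum>(inc {..<m} z))"
      using 1(3) unfolding verts_inv_def deg_upto_def sum_upto_def inc_eq by auto
    show "wp (Seq peel (Seq traverse (Seq choose_all (Seq link_all Skip))))
      (\<lambda>u s'. valid_output (arr s' aout) \<and> t1 + u \<le> 3000 * m + 1000) s1"
    proof (rule wp_Seq, rule wp_peel[OF e1(9,1,2) z1 d1])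
      fix t2 s2 L
      assume 2: "peel_mem s1 L s2" and deg: "\<And>z. card (inc L z) = 0 \<or> card (inc L z) = 2"
        and t2: "t2 \<le> 200 * m + 50"
      have sa2: "same_arrays {adeg, asum, apeel} s1 s2" and pi: "peel_inv L (arr s2 apeel) (arr s2 adeg) (arr s2 asum)"
        using 2 by (auto simp: peel_mem_def)
      have L: "L = {j. j < m \<and> arr s2 apeel j = 0}" "arr s2 asum = (\<lambda>z. \<Sum>(inc L z))"
        "\<And>C. is_cycle all_edges C \<Longrightarrow> C \<subseteq> ed ` L"
        using pi by (auto simp: peel_inv_def)
      have core: "core L" unfolding core_def using L(1,3) deg by auto
      have tm2: "traverse_mem L s2 s2"
        using 2 L by (simp add: traverse_mem_def peel_mem_def)
      have keep2: "arr s2 a = arr s1 a" if "a \<notin> {adeg, asum, apeel}" for a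
        using same_arraysD(1)[OF sa2 that] .
      show "wp (Seq traverse (Seq choose_all (Seq link_all Skip)))
        (\<lambda>u s'. valid_output (arr s' aout) \<and> t1 + (t2 + u) \<le> 3000 * m + 1000) s2"
      proof (rule wp_Seq, rule wp_traverse[OF core tm2])
        show "arr s2 acid = (\<lambda>_. 0)" using keep2[of acid] z1[of acid] by simp
      next
        fix t3 s3
        assume 3: "traverse_mem L s2 s3" and C: "reg s3 rC \<le> m"
          and tr: "traverse_inv L m (reg s3 rC) (arr s3 anx) (arr s3 apv) (arr s3 ane) (arr s3 acid) (arr s3 ase)"
          and t3: "t3 \<le> 300 * m + 50"
        have sa3: "same_arrays traverse_arrays s2 s3" using 3 by (simp add: traverse_mem_def)
        have keep3: "arr s3 a = arr s1 a" if "a \<notin> {adeg, asum, apeel}" "a \<notin> traverse_arrays" for a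
          using same_arraysD(1)[OF sa3 that(2)] keep2[OF that(1)] by simp
        have cs: "cycle_structure m gU gV L (reg s3 rC) (arr s3 anx) (arr s3 apv) (arr s3 ane) (arr s3 acid) (arr s3 ase)"
          by standard (rule core, rule tr)
        have "wp (block [choose_all, link_all])
          (\<lambda>u s'. valid_output (arr s' aout) \<and> t1 + (t2 + (t3 + u)) \<le> 3000 * m + 1000) s3"
          by (rule wp_choose_link[OF cs C])
            (use e1 z1 keep3 t1 t2 t3 in simp_all)
        then show "wp (Seq choose_all (Seq link_all Skip))
          (\<lambda>u s'. valid_output (arr s' aout) \<and> t1 + (t2 + (t3 + u)) \<le> 3000 * m + 1000) s3"
          by simp
      qed
    qed simp
  qed
qed

end

theorem theorem17:
  "\<exists>(prog :: com) (c :: nat).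
     \<forall>(n :: nat) (E :: nat set set) (k :: nat) (P :: nat \<Rightarrow> nat set set)
       (es :: (nat \<times> nat) list) (f :: nat \<Rightarrow> nat).
       simple_graph {..<n} E \<and> edge_partition (pseudoforest {..<n}) k E P \<and>
       edge_list E es \<and> part_indices es k P f \<longrightarrow>
       (\<exists>t s' F.
          run ((n + card E + k + 2) ^ c) prog (input_state n es k f) t s' \<and>
          t \<le> c * (n + card E + 1) \<and>
          edge_partition forest (nat \<lceil>4 * real k / 3\<rceil>) E F \<and>
          part_indices es (nat \<lceil>4 * real k / 3\<rceil>) F (output_array s'))"
proof (rule exI[of _ program], rule exI[of _ 3000], intro allI impI, elim conjE)
  fix n k :: nat and E P and es :: "(nat \<times> nat) list" and f :: "nat \<Rightarrow> nat"
  assume hyps: "simple_graph {..<n} E" "edge_partition (pseudoforest {..<n}) k E P"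
    "edge_list E es" "part_indices es k P f"
  interpret pseudoforest_input n E k P es f using hyps by unfold_locales
  define N where "N = n + card E + k + 2"
  have cE: "card E = m"
    using hyps(3) distinct_card[of "map undirected es"] by (simp add: edge_list_def)
  have N: "2 \<le> N" "n \<le> N" "m \<le> N" "k \<le> N" by (simp_all add: N_def cE)
  have N2: "N ^ 2 * 2 \<le> N ^ 3" using N(1) by (simp add: power3_eq_cube power2_eq_square)
  have N3: "N ^ 2 \<le> N ^ 3" "N \<le> N ^ 3" "4 * N \<le> 2 * N ^ 3"
  proof -
    have "N * 1 \<le> N * N" using N(1) by (intro mult_left_mono) auto
    then have "N \<le> N ^ 2" by (simp add: power2_eq_square)
    then show "N ^ 2 \<le> N ^ 3" "N \<le> N ^ 3" "4 * N \<le> 2 * N ^ 3" using N2 by linarith+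
  qed
  \<comment> \<open>The quadratic size terms are at most \<open>2 * N ^ 2\<close>, which
    \<open>N ^ 3\<close> absorbs since \<open>N\<close> is at least 2; likewise 16 is at most
    \<open>N ^ 4\<close>, so words up to \<open>N ^ 7\<close> suffice. The exponent 3000 arises
    because one constant serves both as exponent and as factor of the time bound.\<close>
  interpret pseudoforest_machine "N ^ 3000" "N ^ 3" n E k P es f
  proof unfold_locales
    have "2 ^ 3 \<le> N ^ 3" using N(1) by (rule power_mono) simp
    then show "4 \<le> N ^ 3" by simp
    have "16 * N ^ 3 \<le> N ^ 4 * N ^ 3"
      using power_mono[OF N(1), of 4] by (intro mult_right_mono) auto
    also have "\<dots> = N ^ 7" by (simp flip: power_add)
    also have "\<dots> \<le> N ^ 3000" using N(1) by (intro power_increasing) auto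
    finally show "16 * N ^ 3 \<le> N ^ 3000" .
    have "2 + 2 * m * n + 2 * n + m * m + 4 * m + 4 \<le> 2 * (n + m + 2) * (n + m + 2)"
      by (simp add: algebra_simps)
    also have "\<dots> \<le> 2 * N * N" unfolding N_def cE by (intro mult_mono) auto
    also have "\<dots> \<le> N ^ 3" using N2 by (simp add: power2_eq_square)
    finally show "2 + 2 * m * n + 2 * n + m * m + 4 * m + 4 \<le> N ^ 3" .
  qed
  have "bounded (N ^ 3) (input_state n es k f)"
    unfolding bounded_def
  proof (intro conjI allI)
    show "reg (input_state n es k f) x \<le> N ^ 3" for x
      using N N3(2) by (auto simp: input_state_def)
    show "arr (input_state n es k f) a i \<le> N ^ 3" for a i
    proof -
      have "fst (es ! i) \<le> N" "snd (es ! i) \<le> N" "f i \<le> N" if "i < m"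
        using src[OF that] tgt[OF that] f_less[OF that] N by (simp_all add: src_def tgt_def)
      then show ?thesis using N3(2) le_trans by (auto simp: input_state_def)
    qed
  qed
  then obtain t s' where "run (N ^ 3000) program (input_state n es k f) t s'" "valid_output (arr s' aout)" "t \<le> 3000 * m + 1000"
    using wp_program unfolding wp_def by blast
  moreover from this obtain F where "edge_partition forest (nat \<lceil>4 * real k / 3\<rceil>) E F"
    "part_indices es (nat \<lceil>4 * real k / 3\<rceil>) F (output_array s')"
    unfolding valid_output_def output_array_def by blast
  moreover from calculation have "t \<le> 3000 * (n + card E + 1)" unfolding cE by simp
  ultimately show "\<exists>t s' F.
          run ((n + card E + k + 2) ^ 3000) program (input_state n es k f) t s' \<and>
          t \<le> 3000 * (n + card E + 1) \<and>
          edge_partition forest (nat \<lceil>4 * real k / 3\<rceil>) E F \<and>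
          part_indices es (nat \<lceil>4 * real k / 3\<rceil>) F (output_array s')"
    unfolding N_def by blast
qed

end
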